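(* Let $\Omega\subset\mathbb{R}^n$ be a bounded domain and $u\in\mathrm{Lip}_0(\Omega)$. Then $$\partial J^\infty(u)=\left\{-\operatorname{div}\sigma\ :\ \sigma\in\mathcal{DM}(\Omega,\mathbb{R}^n),\ \langle-\operatorname{div}\sigma,u\rangle=J^\infty(u),\ |\sigma|(\Omega)\le1\right\}.$$
   Context: $C_0(\Omega)$: continuous functions on $\overline\Omega$ vanishing on $\partial\Omega$, sup norm; dual $\mathcal{M}(\Omega)$ (finite signed Radon measures on $\Omega$), pairing $\langle\mu,u\rangle=\int_\Omega u\,d\mu$. $\mathrm{Lip}_0(\Omega)$: Lipschitz functions on $\overline\Omega$ vanishing on $\partial\Omega$. $J^\infty(u)=\|\nabla u\|_{L^\infty}$ for $u\in\mathrm{Lip}_0(\Omega)$, $J^\infty(u)=+\infty$ for other $u\in C_0(\Omega)$; $\partial J^\infty(u)=\{\mu\in\mathcal{M}(\Omega):J^\infty(u)+\langle\mu,v-u\rangle\le J^\infty(v)\ \forall v\in C_0(\Omega)\}$. $\mathcal{DM}(\Omega,\mathbb{R}^n)$ (divergence-measure fields): finite vector-valued Radon measures $\sigma\in\mathcal{M}(\Omega,\mathbb{R}^n)$ for which there is $\mu\in\mathcal{M}(\Omega)$ with $-\int_\Omega\nabla\varphi\cdot d\sigma=\int_\Omega\varphi\,d\mu$ for all $\varphi\in C_c^\infty(\Omega)$; then $\operatorname{div}\sigma:=\mu$. $|\sigma|$ is the total variation measure of $\sigma$. *)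

theory Defs
  imports "HOL-Analysis.Analysis" "HOL-Probability.Essential_Supremum"
begin

section \<open>Function spaces\<close>

text \<open>A function on the closure of \<open>\<Omega>\<close> is represented by a function on the whole space; every
  notion below depends only on its values on the closure of \<open>\<Omega>\<close>.\<close>

definition C0 :: "(real^'n) set \<Rightarrow> (real^'n \<Rightarrow> real) set" where
  "C0 \<Omega> = {u. continuous_on (closure \<Omega>) u \<and> (\<forall>x\<in>frontier \<Omega>. u x = 0)}"

definition Lip0 :: "(real^'n) set \<Rightarrow> (real^'n \<Rightarrow> real) set" where
  "Lip0 \<Omega> = {u. (\<exists>L. L-lipschitz_on (closure \<Omega>) u) \<and> (\<forall>x\<in>frontier \<Omega>. u x = 0)}"

text \<open>The value at points of non-differentiability is arbitrary.\<close>

definition grad :: "(real^'n \<Rightarrow> real) \<Rightarrow> real^'n \<Rightarrow> real^'n" where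
  "grad f x = (\<chi> i. frechet_derivative f (at x) (axis i 1))"

primrec Ck :: "nat \<Rightarrow> (real^'n \<Rightarrow> real) \<Rightarrow> bool" where
  "Ck 0 f \<longleftrightarrow> continuous_on UNIV f"
| "Ck (Suc k) f \<longleftrightarrow> (\<forall>x. f differentiable (at x)) \<and> (\<forall>i. Ck k (\<lambda>x. grad f x $ i))"

text \<open>Elements of $C_c^\infty(\Omega)$ are identified with their extensions by zero.\<close>

definition test_functions :: "(real^'n) set \<Rightarrow> (real^'n \<Rightarrow> real) set" where
  "test_functions \<Omega> =
     {\<phi>. (\<forall>k. Ck k \<phi>) \<and> compact (closure {x. \<phi> x \<noteq> 0}) \<and> closure {x. \<phi> x \<noteq> 0} \<subseteq> \<Omega>}"

section \<open>Signed and vector-valued measures\<close>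

text \<open>A finite signed or vector-valued measure on \<open>\<Omega>\<close> is a countably additive function on the Borel
  subsets of \<open>\<Omega>\<close>, extended by \<open>0\<close> to all other sets, so that equality of measures is equality of
  functions. With values in a Euclidean space, finiteness of the total variation is automatic, and
  for open \<open>\<Omega>\<close> so is the Radon property.\<close>

abbreviation borel_subsets :: "'a::topological_space set \<Rightarrow> 'a set set" where
  "borel_subsets \<Omega> \<equiv> sets (restrict_space borel \<Omega>)"

definition measures_on :: "'a::topological_space set \<Rightarrow> ('a set \<Rightarrow> 'b::euclidean_space) set" where
  "measures_on \<Omega> = {\<mu>.
     (\<forall>A. A \<notin> borel_subsets \<Omega> \<longrightarrow> \<mu> A = 0) \<and> \<mu> {} = 0 \<and>
     (\<forall>A :: nat \<Rightarrow> 'a set. range A \<subseteq> borel_subsets \<Omega> \<and> disjoint_family A \<longrightarrow>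
        (\<lambda>i. \<mu> (A i)) sums \<mu> (\<Union>i. A i))}"

definition total_variation ::
    "'a::topological_space set \<Rightarrow> ('a set \<Rightarrow> 'b::euclidean_space) \<Rightarrow> 'a set \<Rightarrow> ennreal" where
  "total_variation \<Omega> \<mu> E =
     (SUP A \<in> {A :: nat \<Rightarrow> 'a set.
                 range A \<subseteq> borel_subsets \<Omega> \<and> disjoint_family A \<and> (\<Union>i. A i) = E}.
        \<Sum>i. ennreal (norm (\<mu> (A i))))"

text \<open>The positive part $\mu^+(A) = \sup_{B \subseteq A} \mu(B)$ of the Jordan decomposition; the
  coercion \<open>ennreal\<close> sends negative values to \<open>0\<close>, which the supremum attains at the empty set.
  The negative part of \<open>\<mu>\<close> is the positive part of its negation.\<close>

definition pos_part :: "'a::topological_space set \<Rightarrow> ('a set \<Rightarrow> real) \<Rightarrow> 'a measure" where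
  "pos_part \<Omega> \<mu> = measure_of \<Omega> (borel_subsets \<Omega>)
     (\<lambda>A. SUP B \<in> {B \<in> borel_subsets \<Omega>. B \<subseteq> A}. ennreal (\<mu> B))"

definition pairing :: "'a::topological_space set \<Rightarrow> ('a set \<Rightarrow> real) \<Rightarrow> ('a \<Rightarrow> real) \<Rightarrow> real" where
  "pairing \<Omega> \<mu> u =
     integral\<^sup>L (pos_part \<Omega> \<mu>) u - integral\<^sup>L (pos_part \<Omega> (\<lambda>A. - \<mu> A)) u"

text \<open>The integral $\int_\Omega F \cdot d\sigma$.\<close>

definition vector_pairing ::
    "(real^'n) set \<Rightarrow> ((real^'n) set \<Rightarrow> real^'n) \<Rightarrow> (real^'n \<Rightarrow> real^'n) \<Rightarrow> real" where
  "vector_pairing \<Omega> \<sigma> F = (\<Sum>i\<in>UNIV. pairing \<Omega> (\<lambda>A. \<sigma> A $ i) (\<lambda>x. F x $ i))"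

section \<open>Divergence-measure fields\<close>

definition has_divergence ::
    "(real^'n) set \<Rightarrow> ((real^'n) set \<Rightarrow> real^'n) \<Rightarrow> ((real^'n) set \<Rightarrow> real) \<Rightarrow> bool" where
  "has_divergence \<Omega> \<sigma> \<mu> \<longleftrightarrow> \<mu> \<in> measures_on \<Omega> \<and>
     (\<forall>\<phi>\<in>test_functions \<Omega>. - vector_pairing \<Omega> \<sigma> (grad \<phi>) = pairing \<Omega> \<mu> \<phi>)"

definition DM :: "(real^'n) set \<Rightarrow> ((real^'n) set \<Rightarrow> real^'n) set" where
  "DM \<Omega> = {\<sigma> \<in> measures_on \<Omega>. \<exists>\<mu>. has_divergence \<Omega> \<sigma> \<mu>}"

definition divergence ::
    "(real^'n) set \<Rightarrow> ((real^'n) set \<Rightarrow> real^'n) \<Rightarrow> (real^'n) set \<Rightarrow> real" where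
  "divergence \<Omega> \<sigma> = (THE \<mu>. has_divergence \<Omega> \<sigma> \<mu>)"

section \<open>The functional and its subdifferential\<close>

text \<open>By Rademacher's theorem, \<open>grad u\<close> is the gradient of \<open>u\<close> at almost every point of
  \<open>\<Omega>\<close> when \<open>u\<close> is Lipschitz and \<open>\<Omega>\<close> is open, so the essential supremum is not affected by the
  arbitrary values of \<open>grad\<close>.\<close>

definition J_inf :: "(real^'n) set \<Rightarrow> (real^'n \<Rightarrow> real) \<Rightarrow> ereal" where
  "J_inf \<Omega> u =
     (if u \<in> Lip0 \<Omega> then esssup (lebesgue_on \<Omega>) (\<lambda>x. ereal (norm (grad u x))) else \<infinity>)"

definition subdiff_J_inf ::
    "(real^'n) set \<Rightarrow> (real^'n \<Rightarrow> real) \<Rightarrow> ((real^'n) set \<Rightarrow> real) set" where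
  "subdiff_J_inf \<Omega> u =
     {\<mu> \<in> measures_on \<Omega>. \<forall>v\<in>C0 \<Omega>. J_inf \<Omega> u + ereal (pairing \<Omega> \<mu> (\<lambda>x. v x - u x)) \<le> J_inf \<Omega> v}"

end

theory Submission
  imports Defs
begin

text \<open>
  A subgradient \<open>\<mu>\<close> of the one-homogeneous functional \<open>J\<close> at
  \<open>u\<close> is the same as a measure with \<open>\<langle>\<mu>, u\<rangle> = J u\<close>
  and \<open>\<langle>\<mu>, v\<rangle> \<le> J v\<close> for all \<open>v\<close>: test the
  subgradient inequality with \<open>v = 0\<close> and \<open>v = 2u\<close>
  (\<open>subdiff_J_inf_pairing\<close>). So the claim is that the measures in the polar of
  \<open>J\<close> are exactly the \<open>- div \<sigma>\<close> with
  \<open>|\<sigma>|(\<Omega>) \<le> 1\<close>.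

  Let \<open>\<mu>\<close> lie in the polar. On gradients of test functions,
  \<open>\<nabla>\<phi> \<mapsto> \<langle>\<mu>, \<phi>\<rangle>\<close> is bounded by the sup
  norm of \<open>\<nabla>\<phi>\<close>. Hahn and Banach extend it with norm at most one
  (\<open>linear_below_sublinear_and_cone\<close>), and Riesz represents the extension by a
  vector measure \<open>\<sigma>\<close> of total variation at most one
  (\<open>vector_Riesz\<close>); then \<open>- div \<sigma> = \<mu>\<close>
  (\<open>subgradient_is_divergence\<close>). Test functions determine a signed measure
  (\<open>measures_on_eqI_test_functions\<close>), so the divergence is well defined.

  Conversely let \<open>|\<sigma>|(\<Omega>) \<le> 1\<close> and let \<open>v\<close> be
  Lipschitz, zero on the boundary, with \<open>M = J v\<close>. For a test function
  \<open>\<phi>\<close>, the pairing of \<open>- div \<sigma>\<close> with \<open>\<phi>\<close>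
  is \<open>\<integral> \<nabla>\<phi> \<cdot> d\<sigma>\<close>, at most the sup norm of
  \<open>\<nabla>\<phi>\<close>. It remains to approximate \<open>v\<close> uniformly by test
  functions with gradient at most \<open>M\<close>. For this, the extension of \<open>v\<close>
  by zero is shown to be \<open>M\<close>-Lipschitz (\<open>J_inf_Lipschitz\<close>); pushing
  its values towards zero by \<open>\<epsilon>\<close> makes its support a compact subset of
  \<open>\<Omega>\<close>, and mollification keeps the Lipschitz constant
  (\<open>Lipschitz_smooth_approximation\<close>, \<open>pairing_divergence_le\<close>).

  That a bound on the gradient almost everywhere is a Lipschitz bound rests on Rademacher's
  theorem: without it, \<open>J v\<close> could ignore a set of positive measure on which
  \<open>v\<close> has no gradient. It is proved by differentiating along lines, where a
  Lipschitz function is an indefinite integral, and by testing the linearity of the directional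
  derivatives with smooth functions.
\<close>

section \<open>Linear functionals below sublinear functionals\<close>

text \<open>Homogeneity as an inequality for positive factors: it is stable under infima,
  and applied to the factor and to its inverse it becomes an equality.\<close>

definition sublinear :: "('a::real_vector \<Rightarrow> real) \<Rightarrow> bool" where
  "sublinear p \<longleftrightarrow> (\<forall>x y. p (x + y) \<le> p x + p y) \<and> (\<forall>c x. c > 0 \<longrightarrow> p (c *\<^sub>R x) \<le> c * p x)"

lemma sublinear_add: "sublinear p \<Longrightarrow> p (x + y) \<le> p x + p y"
  by (simp add: sublinear_def)

lemma sublinear_scale:
  assumes "sublinear p" "c > 0"
  shows "p (c *\<^sub>R x) = c * p x"
proof (rule antisym)
  show "p (c *\<^sub>R x) \<le> c * p x" using assms by (simp add: sublinear_def)
  have "p (inverse c *\<^sub>R (c *\<^sub>R x)) \<le> inverse c * p (c *\<^sub>R x)"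
    using assms unfolding sublinear_def by (meson inverse_positive_iff_positive)
  then show "c * p x \<le> p (c *\<^sub>R x)" using assms(2) by (simp add: field_simps)
qed

lemma sublinear_zero: assumes "sublinear p" shows "p 0 = 0"
  using sublinear_scale[OF assms, of 2 0] by simp

lemma sublinear_minus: assumes "sublinear p" shows "- p (- x) \<le> p x"
  using sublinear_add[OF assms, of x "- x"] sublinear_zero[OF assms] by simp

lemma sublinear_diff: assumes "sublinear p" shows "p y - p (- x) \<le> p (x + y)"
  using sublinear_add[OF assms, of "x + y" "- x"] by simp

text \<open>Zorn's lemma for the pointwise order. The pointwise infimum of a chain below
  \<open>q\<close> is finite since \<open>p x \<ge> - p (- x) \<ge> - q (- x)\<close>, and
  it is subadditive since two members of the chain can be replaced by the smaller one.\<close>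

lemma minimal_sublinear_exists:
  assumes q: "sublinear q"
  obtains p where "sublinear p" "\<And>x. p x \<le> q x"
    "\<And>r. sublinear r \<Longrightarrow> (\<And>x. r x \<le> p x) \<Longrightarrow> r = p"
proof -
  let ?A = "{p. sublinear p \<and> p \<le> q}"
  have "\<exists>m\<in>?A. \<forall>a\<in>?A. m \<ge> a \<longrightarrow> a = m"
  proof (rule predicate_Zorn)
    show "partial_order_on ?A (relation_of (\<lambda>x y. x \<ge> y) ?A)"
      by (rule partial_order_on_relation_ofI) auto
  next
    fix C assume C: "C \<in> Chains (relation_of (\<lambda>x y. x \<ge> y) ?A)"
    then have CA: "C \<subseteq> ?A" and total: "\<And>a b. a \<in> C \<Longrightarrow> b \<in> C \<Longrightarrow> a \<ge> b \<or> b \<ge> a"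
      by (auto simp: Chains_def relation_of_def)
    show "\<exists>u\<in>?A. \<forall>a\<in>C. a \<ge> u"
    proof (cases "C = {}")
      case True then show ?thesis using q by auto
    next
      case False
      define r where "r = (\<lambda>x. INF p\<in>C. p x)"
      have bdd: "bdd_below ((\<lambda>p. p x) ` C)" for x
      proof (rule bdd_belowI2)
        fix p assume "p \<in> C"
        then have "sublinear p" "p (- x) \<le> q (- x)" using CA by (auto simp: le_fun_def)
        then show "- q (- x) \<le> p x" using sublinear_minus[of p x] by simp
      qed
      have lower: "r x \<le> p x" if "p \<in> C" for p x
        unfolding r_def by (rule cINF_lower[OF bdd that])
      have "sublinear r"
        unfolding sublinear_def
      proof (intro conjI allI impI)
        fix x y
        have "r (x + y) \<le> p x + p' y" if pC: "p \<in> C" "p' \<in> C" for p p'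
        proof -
          obtain s where s: "s \<in> C" "s \<le> p" "s \<le> p'" using total[OF pC] pC by (meson order_refl)
          have "r (x + y) \<le> s (x + y)" by (rule lower) fact
          also have "\<dots> \<le> s x + s y" using s CA by (auto simp: sublinear_def)
          also have "\<dots> \<le> p x + p' y" using s by (auto simp: le_fun_def intro: add_mono)
          finally show ?thesis .
        qed
        then have "r (x + y) - p' y \<le> r x" if "p' \<in> C" for p'
          unfolding r_def[of] using that False by (intro cINF_greatest) (auto simp: r_def algebra_simps)
        then have "r (x + y) - r x \<le> r y"
          unfolding r_def using False by (intro cINF_greatest) (auto simp: r_def algebra_simps)
        then show "r (x + y) \<le> r x + r y" by simp
      next
        fix c :: real and x assume c: "c > 0"
        have "r (c *\<^sub>R x) / c \<le> p x" if "p \<in> C" for p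
          using lower[OF that, of "c *\<^sub>R x"] sublinear_scale[of p c x] that CA c
          by (auto simp: field_simps)
        then have "r (c *\<^sub>R x) / c \<le> r x" unfolding r_def using False by (intro cINF_greatest)
        then show "r (c *\<^sub>R x) \<le> c * r x" using c by (simp add: field_simps)
      qed
      moreover have "r \<le> q"
      proof (rule le_funI)
        fix x
        obtain p0 where p0: "p0 \<in> C" using False by blast
        then have "p0 x \<le> q x" using CA by (auto simp: le_fun_def)
        then show "r x \<le> q x" using lower[OF p0, of x] by linarith
      qed
      ultimately show ?thesis using lower by (auto simp: le_fun_def)
    qed
  qed
  then obtain p where p: "sublinear p" "p \<le> q"
    and min: "\<And>r. sublinear r \<Longrightarrow> r \<le> q \<Longrightarrow> r \<le> p \<Longrightarrow> r = p"
    by auto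
  show ?thesis
  proof (rule that)
    show "sublinear p" by (rule p(1))
    show "p x \<le> q x" for x using p(2) by (rule le_funD)
    show "r = p" if "sublinear r" "\<And>x. r x \<le> p x" for r
    proof -
      have "r \<le> p" using that(2) by (rule le_funI)
      then show ?thesis using min[OF that(1)] p(2) by (meson order_trans)
    qed
  qed
qed

text \<open>Minimality forces superadditivity: \<open>x \<mapsto> inf_(t \<ge> 0) p (x + t
  y) - t p y\<close> is sublinear and below \<open>p\<close> (take \<open>t = 0\<close>),
  hence equal to \<open>p\<close>, and \<open>t = 1\<close> gives \<open>p x + p y \<le> p
  (x + y)\<close>.\<close>

lemma minimal_sublinear_additive:
  assumes p: "sublinear p" and min: "\<And>r. sublinear r \<Longrightarrow> (\<And>x. r x \<le> p x) \<Longrightarrow> r = p"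
  shows "p (x + y) = p x + p y"
proof -
  define r where "r = (\<lambda>x. INF t\<in>{0..}. p (x + t *\<^sub>R y) - t * p y)"
  have bdd: "bdd_below ((\<lambda>t. p (x + t *\<^sub>R y) - t * p y) ` {0..})" for x
  proof (rule bdd_belowI2)
    fix t :: real assume "t \<in> {0..}"
    then have "p (t *\<^sub>R y) = t * p y"
      using sublinear_scale[OF p, of t y] sublinear_zero[OF p] by (cases "t = 0") auto
    then show "- p (- x) \<le> p (x + t *\<^sub>R y) - t * p y" using sublinear_diff[OF p, of "t *\<^sub>R y" x] by simp
  qed
  have lower: "r x \<le> p (x + t *\<^sub>R y) - t * p y" if "t \<ge> 0" for t x
    unfolding r_def by (rule cINF_lower[OF bdd]) (use that in auto)
  have "sublinear r"
    unfolding sublinear_def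
  proof (intro conjI allI impI)
    fix a b
    have *: "r (a + b) \<le> (p (a + s *\<^sub>R y) - s * p y) + (p (b + t *\<^sub>R y) - t * p y)"
      if "s \<ge> 0" "t \<ge> 0" for s t
      using lower[of "s + t" "a + b"] that sublinear_add[OF p, of "a + s *\<^sub>R y" "b + t *\<^sub>R y"]
      by (auto simp: algebra_simps)
    then have "r (a + b) - (p (b + t *\<^sub>R y) - t * p y) \<le> r a" if "t \<ge> 0" for t
      unfolding r_def[of] using that by (intro cINF_greatest) (auto simp: r_def algebra_simps)
    then have "r (a + b) - r a \<le> r b"
      unfolding r_def by (intro cINF_greatest) (auto simp: r_def algebra_simps)
    then show "r (a + b) \<le> r a + r b" by simp
  next
    fix c :: real and a assume c: "c > 0"
    have "r (c *\<^sub>R a) / c \<le> p (a + t *\<^sub>R y) - t * p y" if "t \<ge> 0" for t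
    proof -
      have "r (c *\<^sub>R a) \<le> p (c *\<^sub>R (a + t *\<^sub>R y)) - (c * t) * p y"
        using lower[of "c * t" "c *\<^sub>R a"] that c by (simp add: algebra_simps)
      then show ?thesis using c unfolding sublinear_scale[OF p c] by (simp add: field_simps)
    qed
    then have "r (c *\<^sub>R a) / c \<le> r a" unfolding r_def by (intro cINF_greatest) auto
    then show "r (c *\<^sub>R a) \<le> c * r a" using c by (simp add: field_simps)
  qed
  then have "r = p" using lower[of 0] by (intro min) auto
  then have "p x \<le> p (x + y) - p y" using lower[of 1 x] by simp
  then show ?thesis using sublinear_add[OF p, of x y] by simp
qed

lemma linear_below_sublinear:
  assumes "sublinear q"
  obtains f where "linear f" "\<And>x. f x \<le> q x"
proof -
  obtain p where p: "sublinear p" "\<And>x. p x \<le> q x"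
    and min: "\<And>r. sublinear r \<Longrightarrow> (\<And>x. r x \<le> p x) \<Longrightarrow> r = p"
    using minimal_sublinear_exists[OF assms] by blast
  have add: "p (x + y) = p x + p y" for x y
    by (rule minimal_sublinear_additive[OF p(1) min])
  have neg: "p (- x) = - p x" for x
    using add[of x "- x"] sublinear_zero[OF p(1)] by simp
  have "p (c *\<^sub>R x) = c *\<^sub>R p x" for c x
  proof -
    consider "c > 0" | "c = 0" | "c < 0" by linarith
    then show ?thesis
    proof cases
      case 3
      then show ?thesis using sublinear_scale[OF p(1), of "- c" x] neg[of "c *\<^sub>R x"] by simp
    qed (auto simp: sublinear_scale[OF p(1)] sublinear_zero[OF p(1)])
  qed
  then have "linear p" by (intro linearI add)
  then show ?thesis using that p(2) by blast
qed

text \<open>The Hahn-Banach theorem with the prescribed values given as a convex cone of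
  pairs \<open>(a, s)\<close>, read as the constraints \<open>f a \<le> s\<close>. For the
  graph of a functional the cone also contains \<open>(- a, - s)\<close>, so the constraint
  is an equality. This form covers a functional of \<open>grad \<phi>\<close> that is given
  in terms of \<open>\<phi>\<close>, without a prior proof that it is well defined. The
  functional sought lies below the sublinear \<open>x \<mapsto> inf_((a, s) \<in> R) p (x -
  a) + s\<close>.\<close>

theorem linear_below_sublinear_and_cone:
  fixes p :: "'a::real_vector \<Rightarrow> real" and R :: "('a \<times> real) set"
  assumes p: "sublinear p"
    and zero: "(0, 0) \<in> R"
    and add: "\<And>a s b t. (a, s) \<in> R \<Longrightarrow> (b, t) \<in> R \<Longrightarrow> (a + b, s + t) \<in> R"
    and scale: "\<And>a s c. (a, s) \<in> R \<Longrightarrow> c > 0 \<Longrightarrow> (c *\<^sub>R a, c * s) \<in> R"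
    and consistent: "\<And>a s. (a, s) \<in> R \<Longrightarrow> - p (- a) \<le> s"
  obtains f where "linear f" "\<And>x. f x \<le> p x" "\<And>a s. (a, s) \<in> R \<Longrightarrow> f a \<le> s"
proof -
  define q where "q = (\<lambda>x. INF r\<in>R. p (x - fst r) + snd r)"
  have bdd: "bdd_below ((\<lambda>r. p (x - fst r) + snd r) ` R)" for x
  proof (rule bdd_belowI2)
    fix r assume "r \<in> R"
    then have "- p (- fst r) \<le> snd r" using consistent[of "fst r" "snd r"] by simp
    then show "- p (- x) \<le> p (x - fst r) + snd r" using sublinear_diff[OF p, of "- fst r" x] by simp
  qed
  have lower: "q x \<le> p (x - a) + s" if "(a, s) \<in> R" for a s x
    unfolding q_def using cINF_lower[OF bdd that] by simp
  have greatest: "c \<le> q x" if "\<And>a s. (a, s) \<in> R \<Longrightarrow> c \<le> p (x - a) + s" for c x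
    unfolding q_def using zero that by (intro cINF_greatest) auto
  have "sublinear q"
    unfolding sublinear_def
  proof (intro conjI allI impI)
    fix x y
    have "q (x + y) \<le> (p (x - a) + s) + (p (y - b) + t)" if "(a, s) \<in> R" "(b, t) \<in> R" for a s b t
      using lower[OF add[OF that], of "x + y"] sublinear_add[OF p, of "x - a" "y - b"]
      by (simp add: algebra_simps)
    then have "q (x + y) - (p (y - b) + t) \<le> q x" if "(b, t) \<in> R" for b t
      using that by (intro greatest) (auto simp: algebra_simps)
    then have "q (x + y) - q x \<le> q y" by (intro greatest) (auto simp: algebra_simps)
    then show "q (x + y) \<le> q x + q y" by simp
  next
    fix c :: real and x assume c: "c > 0"
    have "q (c *\<^sub>R x) / c \<le> p (x - a) + s" if "(a, s) \<in> R" for a s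
      using lower[OF scale[OF that c], of "c *\<^sub>R x"] sublinear_scale[OF p c, of "x - a"] c
      by (simp add: field_simps scaleR_diff_right)
    then have "q (c *\<^sub>R x) / c \<le> q x" by (rule greatest)
    then show "q (c *\<^sub>R x) \<le> c * q x" using c by (simp add: field_simps)
  qed
  then obtain f where f: "linear f" "\<And>x. f x \<le> q x" using linear_below_sublinear by blast
  show ?thesis
  proof
    show "f x \<le> p x" for x using f(2)[of x] lower[OF zero, of x] by simp
    show "f a \<le> s" if "(a, s) \<in> R" for a s
      using f(2)[of a] lower[OF that, of a] sublinear_zero[OF p] by simp
  qed fact
qed

section \<open>Riesz representation of positive functionals\<close>

lemma le_of_le_mult_eps:
  fixes x K :: real
  assumes "\<And>e. e > 0 \<Longrightarrow> x \<le> e * K" shows "x \<le> 0"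
proof (rule ccontr)
  assume "\<not> x \<le> 0"
  define c where "c = 2 * (\<bar>K\<bar> + 1)"
  have c: "c > 0" "K \<le> c / 2" by (auto simp: c_def)
  have "x \<le> x / c * K" using \<open>\<not> x \<le> 0\<close> c by (intro assms divide_pos_pos) auto
  also have "\<dots> \<le> x / c * (c / 2)" using \<open>\<not> x \<le> 0\<close> c by (intro mult_left_mono) auto
  also have "\<dots> = x / 2" using c by simp
  finally show False using \<open>\<not> x \<le> 0\<close> by simp
qed

text \<open>Riesz' theorem is carried out for functionals on the nonnegative functions only.
  The positive part of a functional is naturally given there, and is additive there.\<close>

definition Cc_nonneg :: "('a::euclidean_space \<Rightarrow> real) set" where
  "Cc_nonneg = {f. continuous_on UNIV f \<and> (\<forall>x. 0 \<le> f x) \<and> bounded {x. f x \<noteq> 0}}"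

lemma Cc_nonnegI:
  "continuous_on UNIV f \<Longrightarrow> (\<And>x. 0 \<le> f x) \<Longrightarrow> bounded {x. f x \<noteq> 0} \<Longrightarrow> f \<in> Cc_nonneg"
  by (simp add: Cc_nonneg_def)

lemma Cc_nonneg_continuous: "f \<in> Cc_nonneg \<Longrightarrow> continuous_on A f"
  by (auto simp: Cc_nonneg_def intro: continuous_on_subset)

lemma Cc_nonneg_ge_0: "f \<in> Cc_nonneg \<Longrightarrow> 0 \<le> f x"
  by (auto simp: Cc_nonneg_def)

lemma Cc_nonneg_bounded_support: "f \<in> Cc_nonneg \<Longrightarrow> bounded {x. f x \<noteq> 0}"
  by (auto simp: Cc_nonneg_def)

lemma Cc_nonneg_dominated:
  assumes "f \<in> Cc_nonneg" "continuous_on UNIV g" "\<And>x. 0 \<le> g x" "\<And>x. f x = 0 \<Longrightarrow> g x = 0"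
  shows "g \<in> Cc_nonneg"
  using assms by (intro Cc_nonnegI bounded_subset[OF Cc_nonneg_bounded_support[OF assms(1)]]) auto

lemma Cc_nonneg_zero: "(\<lambda>x. 0) \<in> Cc_nonneg"
  by (auto simp: Cc_nonneg_def)

lemma Cc_nonneg_add:
  assumes "f \<in> Cc_nonneg" "g \<in> Cc_nonneg" shows "(\<lambda>x. f x + g x) \<in> Cc_nonneg"
proof (rule Cc_nonnegI)
  have "bounded ({x. f x \<noteq> 0} \<union> {x. g x \<noteq> 0})"
    using assms by (simp add: Cc_nonneg_bounded_support)
  then show "bounded {x. f x + g x \<noteq> 0}" by (rule bounded_subset) auto
qed (use assms in \<open>auto simp: Cc_nonneg_def intro!: continuous_intros add_nonneg_nonneg\<close>)

lemma Cc_nonneg_diff: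
  assumes "f \<in> Cc_nonneg" "g \<in> Cc_nonneg" "\<And>x. g x \<le> f x" shows "(\<lambda>x. f x - g x) \<in> Cc_nonneg"
proof (rule Cc_nonneg_dominated[OF assms(1)])
  show "f x - g x = 0" if "f x = 0" for x
    using that assms(3)[of x] Cc_nonneg_ge_0[OF assms(2), of x] by simp
qed (use assms in \<open>auto simp: Cc_nonneg_def intro!: continuous_intros\<close>)

lemma Cc_nonneg_cmult:
  assumes "f \<in> Cc_nonneg" "c \<ge> 0" shows "(\<lambda>x. c * f x) \<in> Cc_nonneg"
  by (rule Cc_nonneg_dominated[OF assms(1)])
    (use assms in \<open>auto simp: Cc_nonneg_def intro!: continuous_intros mult_nonneg_nonneg\<close>)

lemma Cc_nonneg_min:
  assumes "f \<in> Cc_nonneg" "continuous_on UNIV h" "\<And>x. 0 \<le> h x" shows "(\<lambda>x. min (f x) (h x)) \<in> Cc_nonneg"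
  by (rule Cc_nonneg_dominated[OF assms(1)])
    (use assms in \<open>auto simp: Cc_nonneg_def min_absorb1 intro!: continuous_intros\<close>)

lemma Cc_nonneg_excess:
  assumes "f \<in> Cc_nonneg" "c \<ge> 0" shows "(\<lambda>x. max (f x - c) 0) \<in> Cc_nonneg"
  by (rule Cc_nonneg_dominated[OF assms(1)])
    (use assms in \<open>auto simp: Cc_nonneg_def intro!: continuous_intros\<close>)

lemma Cc_nonneg_compact_superlevel:
  assumes "f \<in> Cc_nonneg" "c > 0" shows "compact {x. c \<le> f x}"
  unfolding compact_eq_bounded_closed
proof
  show "bounded {x. c \<le> f x}"
    by (rule bounded_subset[OF Cc_nonneg_bounded_support[OF assms(1)]]) (use assms(2) in auto)
  show "closed {x. c \<le> f x}"
    using assms(1) by (intro closed_Collect_le continuous_on_const Cc_nonneg_continuous)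
qed

lemma Cc_nonneg_upper_bound:
  assumes "f \<in> Cc_nonneg" obtains m :: nat where "\<And>x. f x \<le> real m"
proof -
  have "compact (f ` {x. 1 \<le> f x})"
    by (intro compact_continuous_image Cc_nonneg_continuous Cc_nonneg_compact_superlevel assms) simp
  then obtain B where B: "\<And>x. 1 \<le> f x \<Longrightarrow> \<bar>f x\<bar> \<le> B"
    using compact_imp_bounded[of "f ` {x. 1 \<le> f x}"] by (auto simp: bounded_iff)
  obtain m :: nat where "max B 1 \<le> m" using real_arch_simple by blast
  then have "f x \<le> m" for x using B[of x] by (cases "1 \<le> f x") auto
  then show ?thesis by (rule that)
qed

text \<open>Cutting \<open>y\<close> into horizontal layers of height \<open>c\<close>.\<close>

lemma sum_layers:
  fixes y c :: real
  assumes "0 \<le> y" "0 \<le> c"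
  shows "(\<Sum>k<n. min (max (y - real k * c) 0) c) = min y (real n * c)"
proof (induction n)
  case (Suc n)
  have "real (Suc n) * c = real n * c + c" by (simp add: algebra_simps)
  moreover have "real n * c \<ge> 0" using assms by simp
  ultimately show ?case using Suc assms by (auto simp: min_def max_def)
qed (use assms in simp)

text \<open>Additivity yields multiplication by natural numbers (\<open>mult_nat\<close>
  below), and all scaling in the construction is done with those.\<close>

locale positive_functional =
  fixes \<Lambda> :: "('a::euclidean_space \<Rightarrow> real) \<Rightarrow> real" and C :: real
  assumes add: "f \<in> Cc_nonneg \<Longrightarrow> g \<in> Cc_nonneg \<Longrightarrow> \<Lambda> (\<lambda>x. f x + g x) = \<Lambda> f + \<Lambda> g"
    and nonneg: "f \<in> Cc_nonneg \<Longrightarrow> 0 \<le> \<Lambda> f"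
    and bound: "f \<in> Cc_nonneg \<Longrightarrow> (\<And>x. f x \<le> 1) \<Longrightarrow> \<Lambda> f \<le> C"
begin

lemma zero: "\<Lambda> (\<lambda>x. 0) = 0"
  using add[OF Cc_nonneg_zero Cc_nonneg_zero] by simp

lemma mono:
  assumes "f \<in> Cc_nonneg" "g \<in> Cc_nonneg" "\<And>x. f x \<le> g x" shows "\<Lambda> f \<le> \<Lambda> g"
  using add[OF assms(1) Cc_nonneg_diff[OF assms(2,1,3)]] nonneg[OF Cc_nonneg_diff[OF assms(2,1,3)]]
  by simp

lemma mult_nat:
  assumes f: "f \<in> Cc_nonneg" shows "\<Lambda> (\<lambda>x. real n * f x) = real n * \<Lambda> f"
proof (induction n)
  case (Suc n)
  have "\<Lambda> (\<lambda>x. real n * f x + f x) = real n * \<Lambda> f + \<Lambda> f"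
    using Suc by (subst add) (auto intro: Cc_nonneg_cmult f)
  then show ?case by (simp add: algebra_simps)
qed (simp add: zero)

lemma sum:
  assumes "\<And>k. k < (n::nat) \<Longrightarrow> f k \<in> Cc_nonneg"
  shows "(\<lambda>x. \<Sum>k<n. f k x) \<in> Cc_nonneg \<and> \<Lambda> (\<lambda>x. \<Sum>k<n. f k x) = (\<Sum>k<n. \<Lambda> (f k))"
  using assms by (induction n) (auto simp: zero Cc_nonneg_zero add intro!: Cc_nonneg_add)

text \<open>The part \<open>min f d\<close> that is cut off is small: with \<open>d = 1 /
  n\<close>, the multiple \<open>n * min f d\<close> is at most one, so the functional is at
  most \<open>C / n\<close> on \<open>min f d\<close>. What remains has its support in the
  compact set \<open>{f \<ge> d}\<close>; this is how functions that merely vanish outside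
  an open set are reduced to functions with compact support in it.\<close>

lemma excess_approx:
  assumes f: "f \<in> Cc_nonneg" and e: "0 < e"
  obtains d where "0 < d" "\<Lambda> f \<le> \<Lambda> (\<lambda>x. max (f x - d) 0) + e"
proof -
  obtain n :: nat where n: "C / e < n" using reals_Archimedean2 by blast
  define d where "d = 1 / (real n + 1)"
  have d: "0 < d" "(real n + 1) * d = 1" by (auto simp: d_def)
  have mem: "(\<lambda>x. min (f x) d) \<in> Cc_nonneg" using d by (intro Cc_nonneg_min f) auto
  have "real (Suc n) * \<Lambda> (\<lambda>x. min (f x) d) \<le> C"
  proof (subst mult_nat[OF mem, symmetric], rule bound)
    show "(\<lambda>x. real (Suc n) * min (f x) d) \<in> Cc_nonneg" by (intro Cc_nonneg_cmult mem) auto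
    show "real (Suc n) * min (f x) d \<le> 1" for x
      proof -
      have "real (Suc n) * min (f x) d \<le> real (Suc n) * d" by (rule mult_left_mono) auto
      also have "\<dots> = 1" using d(2) by (simp add: add.commute)
      finally show ?thesis .
    qed
  qed
  also have "C \<le> real (Suc n) * e" using n e by (simp add: field_simps)
  finally have small: "\<Lambda> (\<lambda>x. min (f x) d) \<le> e" by simp
  have "f = (\<lambda>x. max (f x - d) 0 + min (f x) d)" by (auto simp: max_def min_def)
  then have "\<Lambda> f = \<Lambda> (\<lambda>x. max (f x - d) 0) + \<Lambda> (\<lambda>x. min (f x) d)"
    using add[OF Cc_nonneg_excess[OF f] mem, of d] d by simp
  then show ?thesis using that[OF d(1)] small by simp
qed

definition below :: "'a set \<Rightarrow> ('a \<Rightarrow> real) set" where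
  "below U = {f \<in> Cc_nonneg. (\<forall>x. f x \<le> 1) \<and> (\<forall>x. x \<notin> U \<longrightarrow> f x = 0)}"

definition content :: "'a set \<Rightarrow> ennreal" where
  "content U = (SUP f\<in>below U. ennreal (\<Lambda> f))"

definition outer :: "'a set \<Rightarrow> ennreal" where
  "outer A = (INF U\<in>{U. open U \<and> A \<subseteq> U}. content U)"

lemma below_nonempty: "below U \<noteq> {}"
  using Cc_nonneg_zero by (auto simp: below_def)

lemma belowD: "f \<in> below U \<Longrightarrow> f \<in> Cc_nonneg" "f \<in> below U \<Longrightarrow> f x \<le> 1"
    "f \<in> below U \<Longrightarrow> x \<notin> U \<Longrightarrow> f x = 0"
  by (auto simp: below_def)

lemma content_upper: "f \<in> below U \<Longrightarrow> ennreal (\<Lambda> f) \<le> content U"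
  unfolding content_def by (rule SUP_upper)

lemma content_mono: "U \<subseteq> V \<Longrightarrow> content U \<le> content V"
  unfolding content_def by (rule SUP_subset_mono) (auto simp: below_def)

lemma content_le: "content U \<le> ennreal C"
  unfolding content_def by (intro SUP_least ennreal_leI bound) (auto simp: below_def)

lemma content_empty: "content {} = 0"
proof -
  have "below {} = {\<lambda>x. 0}" using Cc_nonneg_zero by (auto simp: below_def)
  then show ?thesis by (simp add: content_def zero)
qed

lemma outer_open: "open U \<Longrightarrow> outer U = content U"
  unfolding outer_def by (intro antisym INF_lower2[of U] INF_greatest content_mono) auto

text \<open>Countable subadditivity by compactness. After an excess approximation, finitely
  many \<open>U i\<close> cover the support of \<open>f\<close>, where then
  \<open>\<Sum>i<n. M * dist(x, - U i) \<ge> 1\<close> for a large \<open>M\<close>.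
  Truncating \<open>f\<close> at the partial sums of this sum and taking differences splits
  \<open>f\<close> into summands \<open>g i\<close> below the \<open>U i\<close>.\<close>

lemma content_UN_le:
  fixes U :: "nat \<Rightarrow> 'a set"
  assumes U: "\<And>i. open (U i)"
  shows "content (\<Union>i. U i) \<le> (\<Sum>i. content (U i))"
  unfolding content_def[of "\<Union>i. U i"]
proof (rule SUP_least, rule ennreal_le_epsilon)
  fix f and e :: real assume f: "f \<in> below (\<Union>i. U i)" and e: "0 < e"
  note fK = belowD(1)[OF f]
  obtain d where d: "0 < d" and fd: "\<Lambda> f \<le> \<Lambda> (\<lambda>x. max (f x - d) 0) + e"
    by (rule excess_approx[OF fK e])
  define h where "h x = max (f x - d) 0" for x
  have h: "h \<in> Cc_nonneg" unfolding h_def using d by (intro Cc_nonneg_excess fK) auto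
  have h1: "h x \<le> 1" for x using belowD(2)[OF f, of x] d by (simp add: h_def)
  let ?K = "{x. d \<le> f x}"
  have K: "compact ?K" by (rule Cc_nonneg_compact_superlevel[OF fK d])
  obtain n where n: "?K \<subseteq> (\<Union>i<n. U i)"
  proof -
    have "?K \<subseteq> (\<Union>i\<in>UNIV. U i)"
    proof
      fix x assume "x \<in> ?K"
      then have "f x \<noteq> 0" using d by auto
      then show "x \<in> (\<Union>i\<in>UNIV. U i)" using belowD(3)[OF f, of x] by auto
    qed
    then obtain I where "I \<subseteq> (UNIV::nat set)" "finite I" "?K \<subseteq> (\<Union>i\<in>I. U i)"
      using compactE_image[OF K, of UNIV U] U by metis
    moreover obtain n where "I \<subseteq> {..<n}" using \<open>finite I\<close> finite_nat_iff_bounded by blast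
    ultimately show ?thesis using that[of n] by blast
  qed
  (* the distance to the empty set is zero, so the whole space is treated separately *)
  define r where "r i x = (if U i = UNIV then 1 else infdist x (- U i))" for i x
  have r_cont: "continuous_on UNIV (r i)" for i
    unfolding r_def by (cases "U i = UNIV") (auto intro!: continuous_intros)
  have r_nonneg: "0 \<le> r i x" for i x by (simp add: r_def infdist_nonneg)
  have r_zero: "r i x = 0 \<longleftrightarrow> x \<notin> U i" for i x
    using U[of i] in_closed_iff_infdist_zero[of "- U i" x] by (auto simp: r_def closed_Compl)
  have "\<exists>M>0. \<forall>x\<in>?K. 1 \<le> (\<Sum>i<n. M * r i x)"
  proof (cases "?K = {}")
    case True then show ?thesis by (intro exI[of _ 1]) auto
  next
    case False
    have "continuous_on ?K (\<lambda>x. \<Sum>i<n. r i x)"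
      by (intro continuous_on_sum continuous_on_subset[OF r_cont]) auto
    then obtain x0 where x0: "x0 \<in> ?K" "\<And>x. x \<in> ?K \<Longrightarrow> (\<Sum>i<n. r i x0) \<le> (\<Sum>i<n. r i x)"
      using continuous_attains_inf[OF K False] by metis
    obtain j where "j < n" "x0 \<in> U j" using n x0(1) by auto
    then have "0 < (\<Sum>i<n. r i x0)"
      using r_zero[of j x0] r_nonneg by (intro sum_pos2[of _ j]) (auto simp: less_le)
    then show ?thesis
      using x0(2) by (intro exI[of _ "1 / (\<Sum>i<n. r i x0)"])
        (auto simp: sum_distrib_left[symmetric] field_simps sum_divide_distrib[symmetric])
  qed
  then obtain M where M: "M > 0" and M1: "\<And>x. d \<le> f x \<Longrightarrow> 1 \<le> (\<Sum>i<n. M * r i x)" by auto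
  define s where "s k x = min (h x) (\<Sum>i<k. M * r i x)" for k x
  have S_nonneg: "0 \<le> (\<Sum>i<k. M * r i x)" for k x using M r_nonneg by (intro sum_nonneg) auto
  have s: "s k \<in> Cc_nonneg" for k
    unfolding s_def by (intro Cc_nonneg_min h S_nonneg continuous_on_sum continuous_intros r_cont)
  have s_mono: "s k x \<le> s (Suc k) x" for k x
    unfolding s_def using M r_nonneg[of k x] by (intro min.mono) auto
  define g where "g k x = s (Suc k) x - s k x" for k x
  have g: "g k \<in> below (U k)" for k
    unfolding below_def
  proof (intro CollectI conjI allI impI)
    show "g k \<in> Cc_nonneg" unfolding g_def[abs_def] by (intro Cc_nonneg_diff s s_mono)
    show "g k x \<le> 1" for x
      using h1[of x] Cc_nonneg_ge_0[OF s, of k x] by (auto simp: g_def s_def)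
    show "g k x = 0" if "x \<notin> U k" for x
      using that r_zero[of k x] by (simp add: g_def s_def)
  qed
  have "(\<Sum>k<n. g k x) = h x" for x
  proof -
    have "(\<Sum>k<n. g k x) = s n x - s 0 x" unfolding g_def by (rule sum_lessThan_telescope)
    also have "s 0 x = 0" using Cc_nonneg_ge_0[OF h, of x] by (simp add: s_def)
    also have "s n x = h x"
    proof (cases "d \<le> f x")
      case True
      then have "h x \<le> (\<Sum>i<n. M * r i x)" using M1[OF True] h1[of x] by linarith
      then show ?thesis by (simp add: s_def min_absorb1)
    next
      case False
      then have "h x = 0" by (simp add: h_def)
      then show ?thesis using S_nonneg[of x n] by (simp add: s_def min_absorb1)
    qed
    finally show ?thesis by simp
  qed
  then have "(\<lambda>x. \<Sum>k<n. g k x) = h" by (rule ext)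
  then have "\<Lambda> h = (\<Sum>k<n. \<Lambda> (g k))"
    using sum[where n=n and f=g] belowD(1)[OF g] by metis
  then have "ennreal (\<Lambda> h) = (\<Sum>k<n. ennreal (\<Lambda> (g k)))"
    using nonneg[OF belowD(1)[OF g]] by (simp add: sum_ennreal)
  also have "\<dots> \<le> (\<Sum>k<n. content (U k))" by (intro sum_mono content_upper g)
  also have "\<dots> \<le> (\<Sum>i. content (U i))" by (rule sum_le_suminf) auto
  finally have "ennreal (\<Lambda> h) + ennreal e \<le> (\<Sum>i. content (U i)) + ennreal e" by (rule add_right_mono)
  moreover have "ennreal (\<Lambda> f) \<le> ennreal (\<Lambda> h + e)" using fd by (intro ennreal_leI) (simp add: h_def[abs_def])
  ultimately show "ennreal (\<Lambda> f) \<le> (\<Sum>i. content (U i)) + ennreal e"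
    using nonneg[OF h] e by (simp add: order_trans)
qed

lemma outer_measure_space_outer: "outer_measure_space (Pow UNIV) outer"
  unfolding outer_measure_space_def
proof (intro conjI)
  show "positive (Pow UNIV) outer" using outer_open[of "{}"] content_empty by (simp add: positive_def)
  show "increasing (Pow UNIV) outer"
    unfolding increasing_def outer_def by (auto intro!: INF_superset_mono)
  show "countably_subadditive (Pow UNIV) outer"
    unfolding countably_subadditive_def
  proof (intro allI impI, rule ennreal_le_epsilon)
    fix A :: "nat \<Rightarrow> 'a set" and e :: real assume e: "0 < e"
    have "\<exists>U. open U \<and> A i \<subseteq> U \<and> content U \<le> outer (A i) + ennreal (e * (1/2) ^ Suc i)" for i
    proof -
      have fin: "outer (A i) < top"
      proof -
        have "outer (A i) \<le> content UNIV" unfolding outer_def by (rule INF_lower) auto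
        also have "\<dots> < top" using content_le[of UNIV] ennreal_less_top le_less_trans by blast
        finally show ?thesis .
      qed
      then have "outer (A i) < outer (A i) + ennreal (e * (1/2) ^ Suc i)"
        using e by (simp add: ennreal_zero_less_mult_iff ennreal_add_left_cancel_less[of _ 0, simplified])
      then show ?thesis
        unfolding outer_def[of "A i"] INF_less_iff by (auto intro: less_imp_le)
    qed
    then obtain U where U: "\<And>i. open (U i)" "\<And>i. A i \<subseteq> U i"
      "\<And>i. content (U i) \<le> outer (A i) + ennreal (e * (1/2) ^ Suc i)" by metis
    have "outer (\<Union>i. A i) \<le> content (\<Union>i. U i)"
      unfolding outer_def using U by (intro INF_lower) (auto intro!: open_UN)
    also have "\<dots> \<le> (\<Sum>i. content (U i))" by (rule content_UN_le[OF U(1)])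
    also have "\<dots> \<le> (\<Sum>i. outer (A i) + ennreal (e * (1/2) ^ Suc i))" by (intro suminf_le U(3)) auto
    also have "\<dots> = (\<Sum>i. outer (A i)) + (\<Sum>i. ennreal (e * (1/2) ^ Suc i))" by (rule suminf_add[symmetric]) auto
    also have "(\<Sum>i. ennreal (e * (1/2) ^ Suc i)) = ennreal e"
      using e sums_mult[OF power_half_series, of e] by (intro suminf_ennreal_eq) auto
    finally show "outer (\<Union>i. A i) \<le> (\<Sum>i. outer (A i)) + ennreal e" .
  qed
qed

text \<open>The Caratheodory condition for an open \<open>V\<close>. In an open \<open>U
  \<supseteq> A\<close>, take \<open>f\<close> nearly optimal for \<open>U \<inter>
  V\<close>, cut to the compact superlevel set \<open>K\<close>, and any \<open>g\<close>
  for \<open>U - K \<supseteq> A - V\<close>. Their sum is admissible for \<open>U\<close>.\<close>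

lemma open_splits_outer:
  assumes V: "open V"
  shows "outer (V \<inter> A) + outer (A - V) \<le> outer A"
proof -
  have "outer (V \<inter> A) + outer (A - V) \<le> content U" if U: "open U" "A \<subseteq> U" for U
  proof -
    have "ennreal (\<Lambda> f) + outer (A - V) \<le> content U" if f: "f \<in> below (U \<inter> V)" for f
    proof (rule ennreal_le_epsilon)
      fix e :: real assume e: "0 < e"
      note fK = belowD(1)[OF f]
      obtain d where d: "0 < d" and fd: "\<Lambda> f \<le> \<Lambda> (\<lambda>x. max (f x - d) 0) + e"
        by (rule excess_approx[OF fK e])
      define h where "h x = max (f x - d) 0" for x
      have h: "h \<in> Cc_nonneg" unfolding h_def using d by (intro Cc_nonneg_excess fK) auto
      let ?K = "{x. d \<le> f x}"
      have K: "closed ?K" using Cc_nonneg_compact_superlevel[OF fK d] by (rule compact_imp_closed)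
      have KV: "?K \<subseteq> V"
      proof
        fix x assume "x \<in> ?K"
        then have "f x \<noteq> 0" using d by auto
        then show "x \<in> V" using belowD(3)[OF f, of x] by auto
      qed
      have "ennreal (\<Lambda> h) + ennreal (\<Lambda> g) \<le> content U" if g: "g \<in> below (U - ?K)" for g
      proof -
        have "(\<lambda>x. h x + g x) \<in> below U"
          unfolding below_def
        proof (intro CollectI conjI allI impI)
          show "(\<lambda>x. h x + g x) \<in> Cc_nonneg" by (intro Cc_nonneg_add h belowD(1)[OF g])
          show "h x + g x \<le> 1" for x
            using belowD(2)[OF f, of x] belowD(2)[OF g, of x] belowD(3)[OF g, of x] d
            by (cases "d \<le> f x") (auto simp: h_def)
          show "h x + g x = 0" if "x \<notin> U" for x
            using belowD(3)[OF f, of x] belowD(3)[OF g, of x] that d by (auto simp: h_def)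
        qed
        from content_upper[OF this] show ?thesis
          by (simp add: add[OF h belowD(1)[OF g]] nonneg[OF h] nonneg[OF belowD(1)[OF g]])
      qed
      then have 1: "ennreal (\<Lambda> h) + content (U - ?K) \<le> content U"
        unfolding content_def[of "U - ?K"] ennreal_SUP_add_right[OF below_nonempty] by (rule SUP_least)
      have 2: "outer (A - V) \<le> content (U - ?K)"
        unfolding outer_def using U K KV by (intro INF_lower) (auto intro!: open_Diff)
      have 3: "ennreal (\<Lambda> f) \<le> ennreal (\<Lambda> h) + ennreal e"
      proof -
        have "ennreal (\<Lambda> f) \<le> ennreal (\<Lambda> h + e)" using fd by (intro ennreal_leI) (simp add: h_def[abs_def])
        then show ?thesis using nonneg[OF h] e by simp
      qed
      have "ennreal (\<Lambda> f) + outer (A - V) \<le> (ennreal (\<Lambda> h) + ennreal e) + content (U - ?K)"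
        by (rule add_mono[OF 3 2])
      also have "\<dots> = (ennreal (\<Lambda> h) + content (U - ?K)) + ennreal e" by (simp add: ac_simps)
      also have "\<dots> \<le> content U + ennreal e" by (rule add_right_mono[OF 1])
      finally show "ennreal (\<Lambda> f) + outer (A - V) \<le> content U + ennreal e" .
    qed
    then have "content (U \<inter> V) + outer (A - V) \<le> content U"
      unfolding content_def[of "U \<inter> V"] ennreal_SUP_add_left[OF below_nonempty, symmetric] by (rule SUP_least)
    moreover have "outer (V \<inter> A) \<le> content (U \<inter> V)"
      unfolding outer_def using U V by (intro INF_lower) auto
    ultimately show ?thesis by (meson add_right_mono order_trans)
  qed
  then show ?thesis unfolding outer_def[of A] by (intro INF_greatest) auto
qed

definition representing_measure :: "'a measure" where
  "representing_measure = measure_of UNIV (sets borel) outer"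

lemma sets_representing_measure [simp]: "sets representing_measure = sets borel"
  unfolding representing_measure_def using sets.sigma_sets_eq[of borel] by simp

lemma space_representing_measure [simp]: "space representing_measure = UNIV"
  by (simp add: representing_measure_def)

lemma emeasure_representing_measure:
  assumes "A \<in> sets borel" shows "emeasure representing_measure A = outer A"
proof -
  let ?L = "lambda_system UNIV (Pow UNIV) outer"
  interpret Pow: sigma_algebra "UNIV :: 'a set" "Pow UNIV" by (rule sigma_algebra_Pow)
  have ms: "measure_space UNIV ?L outer"
    by (rule Pow.caratheodory_lemma[OF outer_measure_space_outer])
  have sub: "outer (X \<union> Y) \<le> outer X + outer Y" if "X \<inter> Y = {}" for X Y
    using Pow.countably_subadditive_subadditive outer_measure_space_outer that
    unfolding outer_measure_space_def subadditive_def by blast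
  have "V \<in> ?L" if "open V" for V
    unfolding lambda_system_def
  proof (intro CollectI conjI ballI antisym)
    fix A :: "'a set"
    show "outer (V \<inter> A) + outer ((UNIV - V) \<inter> A) \<le> outer A"
      using open_splits_outer[OF that, of A] by (simp add: Int_commute Diff_eq)
    show "outer A \<le> outer (V \<inter> A) + outer ((UNIV - V) \<inter> A)"
      proof -
      have "(V \<inter> A) \<union> ((UNIV - V) \<inter> A) = A" "(V \<inter> A) \<inter> ((UNIV - V) \<inter> A) = {}" by auto
      then show ?thesis using sub[of "V \<inter> A" "(UNIV - V) \<inter> A"] by simp
    qed
  qed simp
  moreover have "sigma_algebra UNIV ?L" using ms by (simp add: measure_space_def)
  ultimately have borel: "sets borel \<subseteq> ?L"
    unfolding sets_borel by (intro sigma_algebra.sigma_sets_subset) auto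
  show ?thesis
  proof (rule emeasure_measure_of[OF representing_measure_def])
    show "positive (sets representing_measure) outer"
      using ms borel by (auto simp: measure_space_def positive_def)
    show "countably_additive (sets representing_measure) outer"
      using ms borel by (auto simp: measure_space_def countably_additive_def subset_eq)
  qed (use assms in auto)
qed

lemma representing_measure_open: "open U \<Longrightarrow> emeasure representing_measure U = content U"
  by (simp add: emeasure_representing_measure outer_open)

lemma finite_measure_representing_measure: "finite_measure representing_measure"
proof (rule finite_measureI)
  have "content UNIV < top" using content_le[of UNIV] ennreal_less_top le_less_trans by blast
  then show "emeasure representing_measure (space representing_measure) \<noteq> \<infinity>"
    by (simp add: representing_measure_open)
qed

text \<open>Cut \<open>f\<close> into layers of height \<open>c\<close>. On the
  \<open>k\<close>-th layer, both the integral and the functional lie between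
  \<open>c\<close> times the measure of \<open>{f > (k + 1) c}\<close> and \<open>c\<close>
  times the measure of \<open>{f > k c}\<close>. The differences of these bounds telescope
  to at most \<open>c\<close> times the total mass.\<close>

lemma integral_representing_measure:
  assumes f: "f \<in> Cc_nonneg"
  shows "integral\<^sup>L representing_measure f = \<Lambda> f"
proof -
  let ?M = representing_measure
  interpret finite_measure ?M by (rule finite_measure_representing_measure)
  obtain m :: nat where m: "\<And>x. f x \<le> m" using Cc_nonneg_upper_bound[OF f] by blast
  have meas: "g \<in> borel_measurable ?M" if "g \<in> Cc_nonneg" for g
    using borel_measurable_continuous_onI[OF Cc_nonneg_continuous[OF that]] by (simp cong: measurable_cong_sets)
  have est: "\<bar>integral\<^sup>L ?M f - \<Lambda> f\<bar> \<le> e * measure ?M UNIV" if e: "e > 0" for e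
  proof -
    obtain N :: nat where N0: "1 / e < N" using reals_Archimedean2 by blast
    moreover have "0 < 1 / e" using e by simp
    ultimately have "0 < real N" by linarith
    then have N: "N > 0" "1 / real N \<le> e" using e N0 by (auto simp: field_simps)
    define c where "c = 1 / real N"
    have c: "c > 0" "real N * c = 1" "c \<le> e" using N by (auto simp: c_def)
    define l where "l k x = min (max (f x - real k * c) 0) c" for k x
    define U where "U k = {x. real k * c < f x}" for k
    have U: "open (U k)" for k
      unfolding U_def by (intro open_Collect_less continuous_on_const Cc_nonneg_continuous f)
    then have U_sets [measurable]: "U k \<in> sets ?M" for k by simp
    have l: "l k \<in> Cc_nonneg" for k
      unfolding l_def using c by (intro Cc_nonneg_min Cc_nonneg_excess f) auto
    have upper_l: "real N * l k x \<le> 1" for k x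
      using mult_left_mono[of "l k x" c "real N"] c by (simp add: l_def)
    have above_l: "l k x = c" if "x \<in> U (Suc k)" for k x
      using that c by (auto simp: l_def U_def algebra_simps)
    have off_l: "l k x = 0" if "x \<notin> U k" for k x
      using that c by (auto simp: l_def U_def)
    have l_bounds: "0 \<le> l k x" "l k x \<le> c" for k x using c by (auto simp: l_def)
    have upper: "\<Lambda> (l k) \<le> c * measure ?M (U k)" for k
    proof -
      have "(\<lambda>x. real N * l k x) \<in> below (U k)"
        using upper_l off_l by (auto simp: below_def intro!: Cc_nonneg_cmult l)
      from content_upper[OF this] have "real N * \<Lambda> (l k) \<le> measure ?M (U k)"
        unfolding representing_measure_open[OF U, symmetric] emeasure_eq_measure
        by (simp add: mult_nat[OF l] ennreal_le_iff)
      then show ?thesis using N by (simp add: c_def field_simps)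
    qed
    have lower: "c * measure ?M (U (Suc k)) \<le> \<Lambda> (l k)" for k
    proof -
      have "content (U (Suc k)) \<le> ennreal (real N * \<Lambda> (l k))"
        unfolding content_def
      proof (intro SUP_least ennreal_leI, subst mult_nat[OF l, symmetric], rule mono)
        fix g assume g: "g \<in> below (U (Suc k))"
        show "g \<in> Cc_nonneg" by (rule belowD(1)[OF g])
        show "(\<lambda>x. real N * l k x) \<in> Cc_nonneg" by (intro Cc_nonneg_cmult l) simp
        show "g x \<le> real N * l k x" for x
          using belowD(2)[OF g, of x] belowD(3)[OF g, of x] above_l[of x k] c(2) Cc_nonneg_ge_0[OF l, of k x]
          by (cases "x \<in> U (Suc k)") auto
      qed
      then have "measure ?M (U (Suc k)) \<le> real N * \<Lambda> (l k)"
        unfolding representing_measure_open[OF U, symmetric]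
        using nonneg[OF l, of k] by (simp add: emeasure_eq_measure ennreal_le_iff)
      then show ?thesis using N by (simp add: c_def field_simps)
    qed
    have int_l: "integrable ?M (l k)" for k
      by (rule integrable_const_bound[of _ c]) (auto intro!: meas l simp: l_bounds)
    have int_U: "integrable ?M (\<lambda>x. c * indicator (U k) x)" for k
      by (intro integrable_mult_right integrable_real_indicator U_sets) (simp add: emeasure_finite less_top[symmetric])
    have upper_int: "integral\<^sup>L ?M (l k) \<le> c * measure ?M (U k)" for k
    proof -
      have "integral\<^sup>L ?M (l k) \<le> (\<integral>x. c * indicator (U k) x \<partial>?M)"
        using l_bounds off_l by (intro integral_mono int_l int_U) (auto simp: indicator_def)
      then show ?thesis by simp
    qed
    have lower_int: "c * measure ?M (U (Suc k)) \<le> integral\<^sup>L ?M (l k)" for k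
    proof -
      have "(\<integral>x. c * indicator (U (Suc k)) x \<partial>?M) \<le> integral\<^sup>L ?M (l k)"
        using l_bounds above_l by (intro integral_mono int_l int_U) (auto simp: indicator_def)
      then show ?thesis by simp
    qed
    define n where "n = m * N"
    have f_sum: "f = (\<lambda>x. \<Sum>k<n. l k x)"
    proof
      fix x
      have "real n * c = m" using c(2) by (simp add: n_def)
      then show "f x = (\<Sum>k<n. l k x)"
        unfolding l_def using sum_layers[of "f x" c n] c m[of x] Cc_nonneg_ge_0[OF f, of x] by simp
    qed
    have "\<Lambda> f = (\<Sum>k<n. \<Lambda> (l k))" using sum[where n=n and f=l] l f_sum by simp
    moreover have "integral\<^sup>L ?M f = (\<Sum>k<n. integral\<^sup>L ?M (l k))"
      by (subst f_sum) (rule Bochner_Integration.integral_sum[OF int_l])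
    ultimately have "\<bar>integral\<^sup>L ?M f - \<Lambda> f\<bar> = \<bar>\<Sum>k<n. integral\<^sup>L ?M (l k) - \<Lambda> (l k)\<bar>"
      by (simp add: sum_subtractf)
    also have "\<dots> \<le> (\<Sum>k<n. c * measure ?M (U k) - c * measure ?M (U (Suc k)))"
    proof (rule order_trans[OF sum_abs], rule sum_mono)
      fix k
      show "\<bar>integral\<^sup>L ?M (l k) - \<Lambda> (l k)\<bar> \<le> c * measure ?M (U k) - c * measure ?M (U (Suc k))"
        using upper[of k] lower[of k] upper_int[of k] lower_int[of k] by linarith
    qed
    also have "\<dots> = c * measure ?M (U 0) - c * measure ?M (U n)"
      using sum_lessThan_telescope'[of "\<lambda>k. c * measure ?M (U k)" n] by simp
    also have "\<dots> \<le> c * measure ?M (U 0)" using c by simp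
    also have "\<dots> \<le> e * measure ?M UNIV"
      using c finite_measure_mono[of "U 0" UNIV] e by (intro mult_mono) auto
    finally show ?thesis .
  qed
  have "\<bar>integral\<^sup>L ?M f - \<Lambda> f\<bar> \<le> 0"
    using est by (rule le_of_le_mult_eps)
  then show ?thesis by simp
qed

end

text \<open>The positive part of \<open>T\<close> is \<open>\<Lambda> f = sup {T g | 0 \<le>
  g \<le> f}\<close>. It is additive because \<open>h \<le> f + g\<close> splits into
  \<open>min h f \<le> f\<close> and \<open>h - min h f \<le> g\<close>. Both
  \<open>\<Lambda>\<close> and \<open>\<Lambda> - T\<close> are positive functionals.\<close>

lemma Riesz_signed:
  fixes T :: "('a::euclidean_space \<Rightarrow> real) \<Rightarrow> real"
  assumes add: "\<And>f g. f \<in> Cc_nonneg \<Longrightarrow> g \<in> Cc_nonneg \<Longrightarrow> T (\<lambda>x. f x + g x) = T f + T g"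
    and bound: "\<And>f. f \<in> Cc_nonneg \<Longrightarrow> (\<And>x. f x \<le> 1) \<Longrightarrow> \<bar>T f\<bar> \<le> C"
  obtains P N where "finite_measure P" "finite_measure N" "sets P = sets borel" "sets N = sets borel"
    "\<And>f. f \<in> Cc_nonneg \<Longrightarrow> integral\<^sup>L P f - integral\<^sup>L N f = T f"
proof -
  define D where "D f = {g \<in> Cc_nonneg. \<forall>x. g x \<le> f x}" for f :: "'a \<Rightarrow> real"
  define \<Lambda> where "\<Lambda> f = (SUP g\<in>D f. T g)" for f
  have T0: "T (\<lambda>x. 0) = 0" using add[OF Cc_nonneg_zero Cc_nonneg_zero] by simp
  have T_mult: "T (\<lambda>x. real n * f x) = real n * T f" if f: "f \<in> Cc_nonneg" for n f
  proof (induction n)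
    case (Suc n)
    have "T (\<lambda>x. real n * f x + f x) = real n * T f + T f"
      using Suc by (subst add) (auto intro: Cc_nonneg_cmult f)
    then show ?case by (simp add: algebra_simps)
  qed (simp add: T0)
  have D0: "(\<lambda>x. 0) \<in> D f" if "f \<in> Cc_nonneg" for f
    using that Cc_nonneg_zero by (auto simp: D_def Cc_nonneg_ge_0)
  have bdd: "bdd_above (T ` D f)" if f: "f \<in> Cc_nonneg" for f
  proof -
    obtain m :: nat where m: "\<And>x. f x \<le> m" using Cc_nonneg_upper_bound[OF f] by blast
    show ?thesis
    proof (rule bdd_aboveI2)
      fix g assume "g \<in> D f"
      then have g: "g \<in> Cc_nonneg" "\<And>x. g x \<le> f x" by (auto simp: D_def)
      let ?g = "\<lambda>x. 1 / real (Suc m) * g x"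
      have g': "?g \<in> Cc_nonneg" by (intro Cc_nonneg_cmult g(1)) auto
      have "?g x \<le> 1" for x using g(2)[of x] m[of x] by (simp add: field_simps)
      then have "\<bar>T ?g\<bar> \<le> C" by (intro bound g') 
      moreover have "T g = real (Suc m) * T ?g" using T_mult[OF g', of "Suc m"] by simp
      ultimately show "T g \<le> real (Suc m) * C" by (auto simp: abs_le_iff intro!: mult_left_mono)
    qed
  qed
  have upper: "T g \<le> \<Lambda> f" if "f \<in> Cc_nonneg" "g \<in> D f" for f g
    unfolding \<Lambda>_def by (rule cSUP_upper[OF that(2) bdd[OF that(1)]])
  have least: "\<Lambda> f \<le> c" if "f \<in> Cc_nonneg" "\<And>g. g \<in> D f \<Longrightarrow> T g \<le> c" for f c
    unfolding \<Lambda>_def using D0[OF that(1)] that(2) by (intro cSUP_least) auto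
  have \<Lambda>_add: "\<Lambda> (\<lambda>x. f x + g x) = \<Lambda> f + \<Lambda> g" if f: "f \<in> Cc_nonneg" and g: "g \<in> Cc_nonneg" for f g
  proof (rule antisym)
    show "\<Lambda> (\<lambda>x. f x + g x) \<le> \<Lambda> f + \<Lambda> g"
    proof (rule least[OF Cc_nonneg_add[OF f g]])
      fix h assume "h \<in> D (\<lambda>x. f x + g x)"
      then have h: "h \<in> Cc_nonneg" "\<And>x. h x \<le> f x + g x" by (auto simp: D_def)
      have h1: "(\<lambda>x. min (h x) (f x)) \<in> Cc_nonneg"
        by (intro Cc_nonneg_min h(1) Cc_nonneg_continuous f Cc_nonneg_ge_0)
      have h2: "(\<lambda>x. h x - min (h x) (f x)) \<in> Cc_nonneg" by (intro Cc_nonneg_diff h(1) h1) auto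
      have "T h = T (\<lambda>x. min (h x) (f x)) + T (\<lambda>x. h x - min (h x) (f x))"
        using add[OF h1 h2] by simp
      also have "\<dots> \<le> \<Lambda> f + \<Lambda> g"
        using h h1 h2 Cc_nonneg_ge_0[OF g]
        by (intro add_mono upper f g) (auto simp: D_def min_def algebra_simps)
      finally show "T h \<le> \<Lambda> f + \<Lambda> g" .
    qed
    have "T h + T k \<le> \<Lambda> (\<lambda>x. f x + g x)" if "h \<in> D f" "k \<in> D g" for h k
      using that by (subst add[symmetric])
        (auto simp: D_def intro!: upper Cc_nonneg_add f g add_mono)
    then have "\<Lambda> f \<le> \<Lambda> (\<lambda>x. f x + g x) - T k" if "k \<in> D g" for k
      using that by (intro least f) (auto simp: algebra_simps)
    then have "\<Lambda> g \<le> \<Lambda> (\<lambda>x. f x + g x) - \<Lambda> f"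
      by (intro least g) (auto simp: algebra_simps)
    then show "\<Lambda> f + \<Lambda> g \<le> \<Lambda> (\<lambda>x. f x + g x)" by simp
  qed
  interpret P: positive_functional \<Lambda> C
  proof
    show "\<Lambda> (\<lambda>x. f x + g x) = \<Lambda> f + \<Lambda> g" if "f \<in> Cc_nonneg" "g \<in> Cc_nonneg" for f g
      using that by (rule \<Lambda>_add)
    show "0 \<le> \<Lambda> f" if "f \<in> Cc_nonneg" for f using upper[OF that D0[OF that]] T0 by simp
    show "\<Lambda> f \<le> C" if "f \<in> Cc_nonneg" "\<And>x. f x \<le> 1" for f
    proof (rule least[OF that(1)])
      fix g assume "g \<in> D f"
      then have "g \<in> Cc_nonneg" "\<And>x. g x \<le> 1" using that(2) by (auto simp: D_def intro: order_trans)
      then show "T g \<le> C" using bound[of g] by (simp add: abs_le_iff)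
    qed
  qed
  interpret N: positive_functional "\<lambda>f. \<Lambda> f - T f" "C + C"
  proof
    show "\<Lambda> (\<lambda>x. f x + g x) - T (\<lambda>x. f x + g x) = (\<Lambda> f - T f) + (\<Lambda> g - T g)"
      if "f \<in> Cc_nonneg" "g \<in> Cc_nonneg" for f g
      using that by (simp add: \<Lambda>_add add)
    show "0 \<le> \<Lambda> f - T f" if "f \<in> Cc_nonneg" for f
      using upper[OF that, of f] that by (simp add: D_def)
    show "\<Lambda> f - T f \<le> C + C" if "f \<in> Cc_nonneg" "\<And>x. f x \<le> 1" for f
      using P.bound[OF that] bound[OF that] by (simp add: abs_le_iff)
  qed
  show ?thesis
    by (rule that[OF P.finite_measure_representing_measure N.finite_measure_representing_measure])
      (simp_all add: P.integral_representing_measure N.integral_representing_measure)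
qed

section \<open>Signed and vector-valued measures\<close>

lemma sigma_sets_borel_subsets: "sigma_sets \<Omega> (borel_subsets \<Omega>) = borel_subsets \<Omega>"
  using sets.sigma_sets_eq[of "restrict_space borel \<Omega>"] by (simp add: space_restrict_space)

lemma borel_subsets_Pow: "borel_subsets \<Omega> \<subseteq> Pow \<Omega>"
  using sets.space_closed[of "restrict_space borel \<Omega>"] by (simp add: space_restrict_space)

lemma borel_subsets_top: "\<Omega> \<in> borel_subsets \<Omega>"
  using sets.top[of "restrict_space borel \<Omega>"] by (simp add: space_restrict_space)

lemma measures_on_outside: "\<mu> \<in> measures_on \<Omega> \<Longrightarrow> A \<notin> borel_subsets \<Omega> \<Longrightarrow> \<mu> A = 0"
  by (simp add: measures_on_def)

lemma measures_on_empty: "\<mu> \<in> measures_on \<Omega> \<Longrightarrow> \<mu> {} = 0"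
  by (simp add: measures_on_def)

lemma measures_on_sums:
  "\<mu> \<in> measures_on \<Omega> \<Longrightarrow> range A \<subseteq> borel_subsets \<Omega> \<Longrightarrow> disjoint_family A \<Longrightarrow>
    (\<lambda>i. \<mu> (A i)) sums \<mu> (\<Union>i. A i)"
  by (simp add: measures_on_def)

lemma measures_on_Un:
  assumes \<mu>: "\<mu> \<in> measures_on \<Omega>" and A: "A \<in> borel_subsets \<Omega>" and B: "B \<in> borel_subsets \<Omega>"
    and "A \<inter> B = {}"
  shows "\<mu> (A \<union> B) = \<mu> A + \<mu> B"
proof -
  have "disjoint_family (binaryset A B)"
    using assms(4) by (auto simp: disjoint_family_on_def binaryset_def)
  then have "(\<lambda>i. \<mu> (binaryset A B i)) sums \<mu> (\<Union>i. binaryset A B i)"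
    using A B by (intro measures_on_sums[OF \<mu>]) (auto simp: range_binaryset_eq)
  moreover have "(\<lambda>i. \<mu> (binaryset A B i)) sums (\<mu> A + \<mu> B)"
    by (rule binaryset_sums) (rule measures_on_empty[OF \<mu>])
  ultimately show ?thesis by (simp add: UN_binaryset_eq sums_iff)
qed

lemma measures_on_Diff:
  assumes \<mu>: "\<mu> \<in> measures_on \<Omega>" and "A \<in> borel_subsets \<Omega>" "B \<in> borel_subsets \<Omega>" "B \<subseteq> A"
  shows "\<mu> (A - B) = \<mu> A - \<mu> B"
  proof -
  have "(A - B) \<inter> B = {}" "A - B \<union> B = A" using assms(4) by auto
  then show ?thesis using measures_on_Un[OF \<mu>, of "A - B" B] assms(2,3) by auto
qed

lemma measures_on_bounded_linear:
  assumes \<mu>: "\<mu> \<in> measures_on \<Omega>" and f: "bounded_linear f"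
  shows "(\<lambda>A. f (\<mu> A)) \<in> measures_on \<Omega>"
  using \<mu> bounded_linear.sums[OF f] linear_0[OF bounded_linear.linear[OF f]]
  unfolding measures_on_def by auto

lemma measures_on_uminus: "\<mu> \<in> measures_on \<Omega> \<Longrightarrow> (\<lambda>A. - \<mu> A) \<in> measures_on \<Omega>"
  by (rule measures_on_bounded_linear[OF _ bounded_linear_minus[OF bounded_linear_ident]])

lemma measures_on_diff:
  assumes "\<mu> \<in> measures_on \<Omega>" "\<nu> \<in> measures_on \<Omega>"
  shows "(\<lambda>A. \<mu> A - \<nu> A) \<in> measures_on \<Omega>"
  using assms unfolding measures_on_def by (auto intro: sums_diff)

lemma measures_on_nth: "\<sigma> \<in> measures_on \<Omega> \<Longrightarrow> (\<lambda>A. \<sigma> A $ i) \<in> measures_on \<Omega>"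
  by (rule measures_on_bounded_linear[OF _ bounded_linear_vec_nth])

subsection \<open>The Jordan decomposition\<close>

text \<open>The values of the measure \<open>pos_part\<close>, before countable additivity
  is known.\<close>

definition upper_variation :: "'a::topological_space set \<Rightarrow> ('a set \<Rightarrow> real) \<Rightarrow> 'a set \<Rightarrow> ennreal" where
  "upper_variation \<Omega> \<mu> A = (SUP B \<in> {B \<in> borel_subsets \<Omega>. B \<subseteq> A}. ennreal (\<mu> B))"

lemma upper_variation_upper:
  "B \<in> borel_subsets \<Omega> \<Longrightarrow> B \<subseteq> A \<Longrightarrow> ennreal (\<mu> B) \<le> upper_variation \<Omega> \<mu> A"
  unfolding upper_variation_def by (rule SUP_upper) simp

text \<open>A set on which \<open>\<mu>\<close> is negative may be replaced by the empty
  set, so that the truncation by \<open>ennreal\<close> is compatible with addition.\<close>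

lemma upper_variation_superadditive:
  assumes \<mu>: "\<mu> \<in> measures_on \<Omega>" and "X \<inter> Y = {}" "X \<union> Y \<subseteq> Z"
  shows "upper_variation \<Omega> \<mu> X + upper_variation \<Omega> \<mu> Y \<le> upper_variation \<Omega> \<mu> Z"
proof -
  have nonempty: "{B \<in> borel_subsets \<Omega>. B \<subseteq> A} \<noteq> {}" for A by auto
  have *: "ennreal (\<mu> B) + ennreal (\<mu> C) \<le> upper_variation \<Omega> \<mu> Z"
    if "B \<in> borel_subsets \<Omega>" "B \<subseteq> X" "C \<in> borel_subsets \<Omega>" "C \<subseteq> Y" for B C
  proof -
    define B' where "B' = (if \<mu> B \<ge> 0 then B else {})"
    define C' where "C' = (if \<mu> C \<ge> 0 then C else {})"
    have mem: "B' \<in> borel_subsets \<Omega>" "C' \<in> borel_subsets \<Omega>" "B' \<inter> C' = {}" "B' \<union> C' \<subseteq> Z"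
      using that assms(2,3) by (auto simp: B'_def C'_def)
    have pos: "\<mu> B' \<ge> 0" "\<mu> C' \<ge> 0" "ennreal (\<mu> B) = ennreal (\<mu> B')" "ennreal (\<mu> C) = ennreal (\<mu> C')"
      by (auto simp: B'_def C'_def measures_on_empty[OF \<mu>] ennreal_neg)
    have "ennreal (\<mu> B) + ennreal (\<mu> C) = ennreal (\<mu> (B' \<union> C'))"
      using pos measures_on_Un[OF \<mu> mem(1-3)] by (simp flip: ennreal_plus)
    also have "\<dots> \<le> upper_variation \<Omega> \<mu> Z"
      using mem by (intro upper_variation_upper) auto
    finally show ?thesis .
  qed
  then have "upper_variation \<Omega> \<mu> X + ennreal (\<mu> C) \<le> upper_variation \<Omega> \<mu> Z"
    if "C \<in> borel_subsets \<Omega>" "C \<subseteq> Y" for C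
    using that unfolding upper_variation_def[of \<Omega> \<mu> X] ennreal_SUP_add_left[OF nonempty, symmetric]
    by (intro SUP_least) auto
  then show ?thesis
    unfolding upper_variation_def[of \<Omega> \<mu> Y] ennreal_SUP_add_right[OF nonempty]
    by (intro SUP_least) auto
qed

lemma ennreal_sum_le: "ennreal (\<Sum>i<n. x i) \<le> (\<Sum>i<(n::nat). ennreal (x i))"
proof (induction n)
  case (Suc n)
  have "ennreal (a + b) \<le> ennreal a + ennreal b" for a b
    by (cases "a \<ge> 0"; cases "b \<ge> 0") (auto simp: ennreal_neg ennreal_leI simp flip: ennreal_plus)
  then have "ennreal (\<Sum>i<Suc n. x i) \<le> ennreal (\<Sum>i<n. x i) + ennreal (x n)" by simp
  also have "\<dots> \<le> (\<Sum>i<n. ennreal (x i)) + ennreal (x n)" by (intro add_mono Suc) auto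
  finally show ?case by simp
qed simp

lemma upper_variation_countably_additive:
  assumes \<mu>: "\<mu> \<in> measures_on \<Omega>"
  shows "countably_additive (borel_subsets \<Omega>) (upper_variation \<Omega> \<mu>)"
proof (rule countably_additiveI)
  fix A :: "nat \<Rightarrow> 'a set"
  assume A: "range A \<subseteq> borel_subsets \<Omega>" "disjoint_family A" "(\<Union>i. A i) \<in> borel_subsets \<Omega>"
  show "(\<Sum>i. upper_variation \<Omega> \<mu> (A i)) = upper_variation \<Omega> \<mu> (\<Union>i. A i)"
  proof (rule antisym)
    have "(\<Sum>i<n. upper_variation \<Omega> \<mu> (A i)) \<le> upper_variation \<Omega> \<mu> (\<Union>i<n. A i)" for n
    proof (induction n)
      case (Suc n)
      have "(\<Sum>i<Suc n. upper_variation \<Omega> \<mu> (A i)) \<le>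
          upper_variation \<Omega> \<mu> (\<Union>i<n. A i) + upper_variation \<Omega> \<mu> (A n)"
        using Suc by (simp add: add_right_mono)
      also have "\<dots> \<le> upper_variation \<Omega> \<mu> (\<Union>i<Suc n. A i)"
      proof (rule upper_variation_superadditive[OF \<mu>])
        show "(\<Union>i<n. A i) \<inter> A n = {}"
          using A(2) by (auto simp: disjoint_family_on_def) (metis IntI empty_iff less_irrefl)
      qed (auto simp: lessThan_Suc)
      finally show ?case .
    qed simp
    also have "upper_variation \<Omega> \<mu> (\<Union>i<n. A i) \<le> upper_variation \<Omega> \<mu> (\<Union>i. A i)" for n
      unfolding upper_variation_def by (rule SUP_subset_mono) auto
    finally show "(\<Sum>i. upper_variation \<Omega> \<mu> (A i)) \<le> upper_variation \<Omega> \<mu> (\<Union>i. A i)"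
      unfolding suminf_eq_SUP by (intro SUP_least)
    show "upper_variation \<Omega> \<mu> (\<Union>i. A i) \<le> (\<Sum>i. upper_variation \<Omega> \<mu> (A i))"
      unfolding upper_variation_def[of \<Omega> \<mu> "\<Union>i. A i"]
    proof (rule SUP_least)
      fix B assume "B \<in> {B \<in> borel_subsets \<Omega>. B \<subseteq> (\<Union>i. A i)}"
      then have B: "B \<in> borel_subsets \<Omega>" "B \<subseteq> (\<Union>i. A i)" by auto
      have BA: "B \<inter> A i \<in> borel_subsets \<Omega>" for i using B A by auto
      have "(\<lambda>i. \<mu> (B \<inter> A i)) sums \<mu> (\<Union>i. B \<inter> A i)"
        using A(2) BA by (intro measures_on_sums[OF \<mu>]) (auto simp: disjoint_family_on_def)
      also have "(\<Union>i. B \<inter> A i) = B" using B by auto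
      finally have "(\<lambda>n. \<Sum>i<n. \<mu> (B \<inter> A i)) \<longlonglongrightarrow> \<mu> B" by (simp add: sums_def)
      then have "(\<lambda>n. ennreal (\<Sum>i<n. \<mu> (B \<inter> A i))) \<longlonglongrightarrow> ennreal (\<mu> B)"
        by (rule tendsto_ennrealI)
      then show "ennreal (\<mu> B) \<le> (\<Sum>i. upper_variation \<Omega> \<mu> (A i))"
      proof (rule LIMSEQ_le_const2, intro exI allI impI)
        fix n
        have "ennreal (\<Sum>i<n. \<mu> (B \<inter> A i)) \<le> (\<Sum>i<n. ennreal (\<mu> (B \<inter> A i)))" by (rule ennreal_sum_le)
        also have "\<dots> \<le> (\<Sum>i<n. upper_variation \<Omega> \<mu> (A i))"
          by (intro sum_mono upper_variation_upper BA) auto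
        also have "\<dots> \<le> (\<Sum>i. upper_variation \<Omega> \<mu> (A i))" by (rule sum_le_suminf) auto
        finally show "ennreal (\<Sum>i<n. \<mu> (B \<inter> A i)) \<le> (\<Sum>i. upper_variation \<Omega> \<mu> (A i))" .
      qed
    qed
  qed
qed

lemma space_pos_part [simp]: "space (pos_part \<Omega> \<mu>) = \<Omega>"
  unfolding pos_part_def by (rule space_measure_of) (rule borel_subsets_Pow)

lemma sets_pos_part [simp, measurable_cong]: "sets (pos_part \<Omega> \<mu>) = borel_subsets \<Omega>"
  unfolding pos_part_def using borel_subsets_Pow[of \<Omega>] by (simp add: sigma_sets_borel_subsets)

lemma emeasure_pos_part:
  assumes \<mu>: "\<mu> \<in> measures_on \<Omega>" and A: "A \<in> borel_subsets \<Omega>"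
  shows "emeasure (pos_part \<Omega> \<mu>) A = upper_variation \<Omega> \<mu> A"
proof -
  have "emeasure (pos_part \<Omega> \<mu>) A = (\<lambda>A. SUP B \<in> {B \<in> borel_subsets \<Omega>. B \<subseteq> A}. ennreal (\<mu> B)) A"
  proof (rule emeasure_measure_of[OF pos_part_def])
    show "borel_subsets \<Omega> \<subseteq> Pow \<Omega>" by (rule borel_subsets_Pow)
    show "positive (sets (pos_part \<Omega> \<mu>)) (\<lambda>A. SUP B \<in> {B \<in> borel_subsets \<Omega>. B \<subseteq> A}. ennreal (\<mu> B))"
    proof -
      have "{B \<in> borel_subsets \<Omega>. B \<subseteq> {}} = {{}}" by auto
      then show ?thesis by (simp add: positive_def measures_on_empty[OF \<mu>])
    qed
    show "countably_additive (sets (pos_part \<Omega> \<mu>)) (\<lambda>A. SUP B \<in> {B \<in> borel_subsets \<Omega>. B \<subseteq> A}. ennreal (\<mu> B))"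
      using upper_variation_countably_additive[OF \<mu>]
      by (simp add: upper_variation_def[abs_def])
  qed (use A in simp)
  then show ?thesis by (simp add: upper_variation_def)
qed

text \<open>If \<open>\<mu> B\<close> is large for some \<open>B \<subseteq> E\<close> then
  so is \<open>|\<mu> (E - B)|\<close>, and one of \<open>B\<close>, \<open>E - B\<close>
  still has infinite upper variation. The other one is removed.\<close>

lemma emeasure_pos_part_splitting:
  assumes \<mu>: "\<mu> \<in> measures_on \<Omega>" and E: "E \<in> borel_subsets \<Omega>" "emeasure (pos_part \<Omega> \<mu>) E = \<infinity>"
  obtains E' where "E' \<in> borel_subsets \<Omega>" "E' \<subseteq> E" "emeasure (pos_part \<Omega> \<mu>) E' = \<infinity>" "\<bar>\<mu> (E - E')\<bar> \<ge> 1"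
proof -
  have "ennreal (1 + \<bar>\<mu> E\<bar>) < (SUP B \<in> {B \<in> borel_subsets \<Omega>. B \<subseteq> E}. ennreal (\<mu> B))"
    using E(2) ennreal_less_top[of "1 + \<bar>\<mu> E\<bar>"]
    unfolding emeasure_pos_part[OF \<mu> E(1)] upper_variation_def infinity_ennreal_def by metis
  then obtain B where B: "B \<in> borel_subsets \<Omega>" "B \<subseteq> E" and *: "ennreal (1 + \<bar>\<mu> E\<bar>) < ennreal (\<mu> B)"
    by (auto simp: less_SUP_iff)
  from * have "1 + \<bar>\<mu> E\<bar> < \<mu> B" by (subst (asm) ennreal_less_iff) auto
  moreover have diff: "\<mu> (E - B) = \<mu> E - \<mu> B" by (rule measures_on_Diff) (use \<mu> E B in auto)
  ultimately have large: "\<bar>\<mu> B\<bar> \<ge> 1" "\<bar>\<mu> (E - B)\<bar> \<ge> 1" by linarith+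
  have "emeasure (pos_part \<Omega> \<mu>) E = emeasure (pos_part \<Omega> \<mu>) B + emeasure (pos_part \<Omega> \<mu>) (E - B)"
    using B E by (subst plus_emeasure) (auto simp: Un_absorb1)
  then consider "emeasure (pos_part \<Omega> \<mu>) B = \<infinity>" | "emeasure (pos_part \<Omega> \<mu>) (E - B) = \<infinity>"
    using E(2) by (metis ennreal_add_eq_top infinity_ennreal_def)
  then show ?thesis
  proof cases
    case 1
    then show ?thesis using that[of B] B large by auto
  next
    case 2
    moreover have "E - (E - B) = B" using B by auto
    ultimately show ?thesis using that[of "E - B"] B E large by auto
  qed
qed

text \<open>A signed measure with real values is bounded: otherwise repeated splitting
  removes infinitely many disjoint sets with \<open>|\<mu>| \<ge> 1\<close>, and the series
  of their measures cannot converge.\<close>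

lemma finite_measure_pos_part:
  assumes \<mu>: "\<mu> \<in> measures_on \<Omega>"
  shows "finite_measure (pos_part \<Omega> \<mu>)"
proof (rule finite_measureI, rule notI)
  assume "emeasure (pos_part \<Omega> \<mu>) (space (pos_part \<Omega> \<mu>)) = \<infinity>"
  then have top: "emeasure (pos_part \<Omega> \<mu>) \<Omega> = \<infinity>" by simp
  obtain E where E: "\<And>n. E n \<in> borel_subsets \<Omega> \<and> emeasure (pos_part \<Omega> \<mu>) (E n) = \<infinity>"
    and step: "\<And>n. E (Suc n) \<subseteq> E n \<and> \<bar>\<mu> (E n - E (Suc n))\<bar> \<ge> 1"
    using dependent_nat_choice[of "\<lambda>n E. E \<in> borel_subsets \<Omega> \<and> emeasure (pos_part \<Omega> \<mu>) E = \<infinity>"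
        "\<lambda>n E E'. E' \<subseteq> E \<and> \<bar>\<mu> (E - E')\<bar> \<ge> 1"]
      top borel_subsets_top[of \<Omega>] emeasure_pos_part_splitting[OF \<mu>] by metis
  have dec: "decseq E" using step by (intro decseq_SucI) auto
  have "disjoint_family (\<lambda>n. E n - E (Suc n))"
  proof -
    have "(E m - E (Suc m)) \<inter> (E n - E (Suc n)) = {}" if "m < n" for m n
      using decseqD[OF dec, of "Suc m" n] that by auto
    then show ?thesis unfolding disjoint_family_on_def by (metis Int_commute linorder_neqE_nat)
  qed
  then have "(\<lambda>n. \<mu> (E n - E (Suc n))) sums \<mu> (\<Union>n. E n - E (Suc n))"
    using E by (intro measures_on_sums[OF \<mu>]) auto
  then have "(\<lambda>n. \<mu> (E n - E (Suc n))) \<longlonglongrightarrow> 0" by (intro summable_LIMSEQ_zero) (rule sums_summable)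
  then have "\<forall>\<^sub>F n in sequentially. \<bar>\<mu> (E n - E (Suc n))\<bar> < 1"
    by (auto dest: tendstoD[where e=1] simp: dist_real_def)
  then show False using step by (auto simp: eventually_sequentially) (meson linorder_not_le order_refl)
qed

text \<open>For \<open>B \<subseteq> A\<close>, the value \<open>\<mu> B = \<mu> A + (-
  \<mu> (A - B))\<close> is at most \<open>\<mu> A\<close> plus the negative part of
  \<open>A\<close>. The same inequality for \<open>- \<mu>\<close> is the reverse one.\<close>

lemma measure_pos_part_le:
  assumes \<mu>: "\<mu> \<in> measures_on \<Omega>" and A: "A \<in> borel_subsets \<Omega>"
  shows "measure (pos_part \<Omega> \<mu>) A \<le> \<mu> A + measure (pos_part \<Omega> (\<lambda>A. - \<mu> A)) A"
proof -
  let ?N = "pos_part \<Omega> (\<lambda>A. - \<mu> A)"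
  have \<mu>': "(\<lambda>A. - \<mu> A) \<in> measures_on \<Omega>" by (rule measures_on_uminus[OF \<mu>])
  interpret P: finite_measure "pos_part \<Omega> \<mu>" by (rule finite_measure_pos_part[OF \<mu>])
  interpret N: finite_measure ?N by (rule finite_measure_pos_part[OF \<mu>'])
  have *: "\<mu> B \<le> \<mu> A + measure ?N A" if B: "B \<in> borel_subsets \<Omega>" "B \<subseteq> A" for B
  proof -
    have "ennreal (- \<mu> (A - B)) \<le> emeasure ?N A"
      unfolding emeasure_pos_part[OF \<mu>' A]
      using A B upper_variation_upper[of "A - B" \<Omega> A "\<lambda>A. - \<mu> A"] by auto
    then have "- \<mu> (A - B) \<le> measure ?N A"
      by (simp add: N.emeasure_eq_measure ennreal_le_iff)
    then show ?thesis using measures_on_Diff[OF \<mu> A B] by simp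
  qed
  have nonneg: "0 \<le> \<mu> A + measure ?N A" using *[of "{}"] measures_on_empty[OF \<mu>] by simp
  have "emeasure (pos_part \<Omega> \<mu>) A \<le> ennreal (\<mu> A + measure ?N A)"
    unfolding emeasure_pos_part[OF \<mu> A] upper_variation_def
    by (intro SUP_least ennreal_leI) (use * in auto)
  then show ?thesis using nonneg by (simp add: P.emeasure_eq_measure)
qed

lemma Jordan_decomposition:
  assumes \<mu>: "\<mu> \<in> measures_on \<Omega>" and A: "A \<in> borel_subsets \<Omega>"
  shows "\<mu> A = measure (pos_part \<Omega> \<mu>) A - measure (pos_part \<Omega> (\<lambda>A. - \<mu> A)) A"
  using measure_pos_part_le[OF \<mu> A] measure_pos_part_le[OF measures_on_uminus[OF \<mu>] A] by simp

subsection \<open>Integration against a signed measure by Riemann sums\<close>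

text \<open>The range is totally bounded; take preimages of small balls and make them
  disjoint. That the representatives \<open>q i\<close> are values of \<open>f\<close>
  preserves bounds on \<open>f\<close>.\<close>

lemma bounded_measurable_partition:
  fixes f :: "'a \<Rightarrow> 'b::euclidean_space"
  assumes f: "f \<in> borel_measurable M" and bdd: "bounded (f ` space M)" and "e > 0"
  obtains A :: "nat \<Rightarrow> 'a set" and q n where "\<And>i. A i \<in> sets M" "disjoint_family A"
    "(\<Union>i<n. A i) = space M" "\<And>i x. i < n \<Longrightarrow> x \<in> A i \<Longrightarrow> norm (f x - q i) \<le> e"
    "\<And>i. i < n \<Longrightarrow> q i \<in> f ` space M"
proof -
  note [measurable] = f
  obtain k where k: "finite k" "k \<subseteq> f ` space M" "f ` space M \<subseteq> (\<Union>x\<in>k. ball x e)"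
  proof -
    have "compact (closure (f ` space M))" using bdd by (simp add: compact_closure)
    moreover have "closure (f ` space M) \<subseteq> \<Union> ((\<lambda>x. ball x e) ` (f ` space M))"
      using \<open>e > 0\<close> by (force simp: closure_approachable)
    ultimately obtain k where "k \<subseteq> f ` space M" "finite k"
        "closure (f ` space M) \<subseteq> (\<Union>x\<in>k. ball x e)"
      using compactE_image[of "closure (f ` space M)" "f ` space M" "\<lambda>x. ball x e"] open_ball by metis
    then show ?thesis using that[of k] closure_subset[of "f ` space M"] by auto
  qed
  obtain q n where q: "k = q ` {i::nat. i < n}" using finite_imp_nat_seg_image_inj_on[OF k(1)] by auto
  define B where "B i = (if i < n then f -` ball (q i) e \<inter> space M else {})" for i
  have B: "B i \<in> sets M" for i unfolding B_def by auto
  show ?thesis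
  proof (rule that[of "disjointed B"])
    show "disjointed B i \<in> sets M" for i
      using sets.range_disjointed_sets[of B M] B by auto
    show "disjoint_family (disjointed B)" by (rule disjoint_family_disjointed)
    have "(\<Union>i<n. disjointed B i) = (\<Union>i<n. B i)"
      using UN_disjointed_eq[of B] finite_UN_disjointed_eq[of B n] by (simp add: atLeast0LessThan)
    also have "\<dots> = space M" using k(3) q by (force simp: B_def)
    finally show "(\<Union>i<n. disjointed B i) = space M" .
    show "norm (f x - q i) \<le> e" if "i < n" "x \<in> disjointed B i" for i x
      using that disjointed_subset[of B i] by (auto simp: B_def dist_norm norm_minus_commute)
    show "q i \<in> f ` space M" if "i < n" for i using that k(2) q by auto
  qed
qed

lemma (in finite_measure) integral_Riemann_sum:
  fixes f :: "'a \<Rightarrow> real"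
  assumes f [measurable]: "f \<in> borel_measurable M" and A [measurable]: "\<And>i. A i \<in> sets M"
    and disj: "disjoint_family A" and cover: "(\<Union>i<n. A i) = space M"
    and close: "\<And>i x. i < n \<Longrightarrow> x \<in> A i \<Longrightarrow> \<bar>f x - q i\<bar> \<le> e"
  shows "\<bar>integral\<^sup>L M f - (\<Sum>i<(n::nat). q i * measure M (A i))\<bar> \<le> e * measure M (space M)"
proof -
  define s where "s x = (\<Sum>i<n. q i * indicator (A i) x)" for x
  have s: "integrable M s" "integral\<^sup>L M s = (\<Sum>i<n. q i * measure M (A i))"
  proof -
    have int: "integrable M (\<lambda>x. q i * indicator (A i) x)" for i
      by (intro integrable_mult_right integrable_real_indicator A) (simp add: emeasure_finite less_top[symmetric])
    show "integrable M s" unfolding s_def by (rule Bochner_Integration.integrable_sum) (rule int)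
    show "integral\<^sup>L M s = (\<Sum>i<n. q i * measure M (A i))"
      unfolding s_def by (subst Bochner_Integration.integral_sum[OF int]) simp
  qed
  have close': "\<bar>f x - s x\<bar> \<le> e" if "x \<in> space M" for x
  proof -
    have "x \<in> (\<Union>i<n. A i)" using cover that by simp
    then obtain i where i: "i < n" "x \<in> A i" by blast
    have "s x = (\<Sum>j<n. if j = i then q i else 0)"
      unfolding s_def using i disj
      by (intro sum.cong) (auto simp: disjoint_family_on_def indicator_def)
    then show ?thesis using i close by simp
  qed
  have s_meas: "s \<in> borel_measurable M" using s(1) by (rule borel_measurable_integrable)
  have int: "integrable M (\<lambda>x. f x - s x)"
    by (rule integrable_const_bound[of _ e]) (use close' f s_meas in auto)
  then have "integrable M (\<lambda>x. (f x - s x) + s x)" using s(1) by (rule Bochner_Integration.integrable_add)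
  then have "integrable M f" by simp
  then have "integral\<^sup>L M f - integral\<^sup>L M s = (\<integral>x. f x - s x \<partial>M)" using s(1) by simp
  also have "\<bar>\<dots>\<bar> \<le> (\<integral>x. \<bar>f x - s x\<bar> \<partial>M)" by (rule integral_abs_bound)
  also have "\<dots> \<le> (\<integral>x. e \<partial>M)" using int by (intro integral_mono) (auto intro: close')
  finally show ?thesis using s(2) by (simp add: mult.commute)
qed

lemma measurable_pos_part: "f \<in> borel_measurable (restrict_space borel \<Omega>) \<Longrightarrow> f \<in> borel_measurable (pos_part \<Omega> \<mu>)"
  by (subst measurable_cong_sets[OF sets_pos_part refl])

text \<open>The Riemann sums involve only \<open>\<mu>\<close> itself and not its Jordan
  decomposition. Everything that is needed about the pairing as a function of the measure is
  read off from them.\<close>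

lemma pairing_Riemann_sum:
  assumes \<mu>: "\<mu> \<in> measures_on \<Omega>" and f: "f \<in> borel_measurable (restrict_space borel \<Omega>)"
    and A: "\<And>i. A i \<in> borel_subsets \<Omega>" "disjoint_family A" "(\<Union>i<n. A i) = \<Omega>"
    and close: "\<And>i x. i < n \<Longrightarrow> x \<in> A i \<Longrightarrow> \<bar>f x - q i\<bar> \<le> e"
  shows "\<bar>pairing \<Omega> \<mu> f - (\<Sum>i<(n::nat). q i * \<mu> (A i))\<bar>
    \<le> e * (measure (pos_part \<Omega> \<mu>) \<Omega> + measure (pos_part \<Omega> (\<lambda>A. - \<mu> A)) \<Omega>)"
proof -
  let ?P = "pos_part \<Omega> \<mu>" and ?N = "pos_part \<Omega> (\<lambda>A. - \<mu> A)"
  interpret P: finite_measure ?P by (rule finite_measure_pos_part[OF \<mu>])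
  interpret N: finite_measure ?N by (rule finite_measure_pos_part[OF measures_on_uminus[OF \<mu>]])
  have "\<bar>integral\<^sup>L ?P f - (\<Sum>i<n. q i * measure ?P (A i))\<bar> \<le> e * measure ?P \<Omega>"
    using P.integral_Riemann_sum[OF measurable_pos_part[OF f], of A n q e] A close by simp
  moreover have "\<bar>integral\<^sup>L ?N f - (\<Sum>i<n. q i * measure ?N (A i))\<bar> \<le> e * measure ?N \<Omega>"
    using N.integral_Riemann_sum[OF measurable_pos_part[OF f], of A n q e] A close by simp
  moreover have "(\<Sum>i<n. q i * \<mu> (A i)) = (\<Sum>i<n. q i * measure ?P (A i)) - (\<Sum>i<n. q i * measure ?N (A i))"
    unfolding sum_subtractf[symmetric] right_diff_distrib[symmetric]
    using Jordan_decomposition[OF \<mu> A(1)] by simp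
  ultimately show ?thesis unfolding pairing_def distrib_left by linarith
qed

text \<open>Any representation of \<open>\<mu>\<close> as a difference of finite measures
  computes the pairing, since all of them share the same Riemann sums.\<close>

lemma pairing_eq_integral_diff:
  assumes \<mu>: "\<mu> \<in> measures_on \<Omega>" and "finite_measure P" "finite_measure N"
    and sets: "sets P = borel_subsets \<Omega>" "sets N = borel_subsets \<Omega>"
    and diff: "\<And>A. A \<in> borel_subsets \<Omega> \<Longrightarrow> \<mu> A = measure P A - measure N A"
    and f: "f \<in> borel_measurable (restrict_space borel \<Omega>)" "bounded (f ` \<Omega>)"
  shows "pairing \<Omega> \<mu> f = integral\<^sup>L P f - integral\<^sup>L N f"
proof -
  interpret P: finite_measure P by fact
  interpret N: finite_measure N by fact
  have space: "space P = \<Omega>" "space N = \<Omega>"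
    using sets_eq_imp_space_eq[OF sets(1)] sets_eq_imp_space_eq[OF sets(2)] by (auto simp: space_restrict_space)
  have fP: "f \<in> borel_measurable P" "f \<in> borel_measurable N" using f(1) sets by (auto cong: measurable_cong_sets)
  let ?K = "measure (pos_part \<Omega> \<mu>) \<Omega> + measure (pos_part \<Omega> (\<lambda>A. - \<mu> A)) \<Omega>"
  have "\<bar>pairing \<Omega> \<mu> f - (integral\<^sup>L P f - integral\<^sup>L N f)\<bar> \<le> e * (?K + measure P \<Omega> + measure N \<Omega>)"
    if e: "e > 0" for e
  proof -
    obtain A n and q :: "nat \<Rightarrow> real" where A: "\<And>i. A i \<in> sets P" "disjoint_family A" "(\<Union>i<n. A i) = space P"
      and close: "\<And>i x. i < n \<Longrightarrow> x \<in> A i \<Longrightarrow> norm (f x - q i) \<le> e"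
      using bounded_measurable_partition[OF fP(1) _ e] f(2) unfolding space by metis
    have "\<bar>pairing \<Omega> \<mu> f - (\<Sum>i<n. q i * \<mu> (A i))\<bar> \<le> e * ?K"
      by (rule pairing_Riemann_sum[OF \<mu> f(1)]) (use A close space sets in auto)
    moreover have "\<bar>integral\<^sup>L P f - (\<Sum>i<n. q i * measure P (A i))\<bar> \<le> e * measure P \<Omega>"
      using P.integral_Riemann_sum[OF fP(1), of A n q e] A close space sets by auto
    moreover have "\<bar>integral\<^sup>L N f - (\<Sum>i<n. q i * measure N (A i))\<bar> \<le> e * measure N \<Omega>"
      using N.integral_Riemann_sum[OF fP(2), of A n q e] A close space sets by auto
    moreover have "(\<Sum>i<n. q i * \<mu> (A i)) = (\<Sum>i<n. q i * measure P (A i)) - (\<Sum>i<n. q i * measure N (A i))"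
      unfolding sum_subtractf[symmetric] right_diff_distrib[symmetric]
      using diff A(1) sets by simp
    ultimately show ?thesis unfolding distrib_left by linarith
  qed
  then have "\<bar>pairing \<Omega> \<mu> f - (integral\<^sup>L P f - integral\<^sup>L N f)\<bar> \<le> 0" by (rule le_of_le_mult_eps)
  then show ?thesis by simp
qed

lemma integrable_pos_part:
  fixes f :: "'a::topological_space \<Rightarrow> real"
  assumes "\<mu> \<in> measures_on \<Omega>" "f \<in> borel_measurable (restrict_space borel \<Omega>)" "bounded (f ` \<Omega>)"
  shows "integrable (pos_part \<Omega> \<mu>) f"
proof -
  interpret finite_measure "pos_part \<Omega> \<mu>" by (rule finite_measure_pos_part) fact
  obtain B where "\<And>x. x \<in> \<Omega> \<Longrightarrow> norm (f x) \<le> B" using assms(3) by (auto simp: bounded_iff)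
  then show ?thesis using measurable_pos_part[OF assms(2)]
    by (intro integrable_const_bound[of _ B]) auto
qed

lemma pairing_diff:
  assumes "\<mu> \<in> measures_on \<Omega>" "f \<in> borel_measurable (restrict_space borel \<Omega>)" "bounded (f ` \<Omega>)"
    "g \<in> borel_measurable (restrict_space borel \<Omega>)" "bounded (g ` \<Omega>)"
  shows "pairing \<Omega> \<mu> (\<lambda>x. f x - g x) = pairing \<Omega> \<mu> f - pairing \<Omega> \<mu> g"
  unfolding pairing_def using assms by (simp add: integrable_pos_part measures_on_uminus)

lemma pairing_add:
  assumes "\<mu> \<in> measures_on \<Omega>" "f \<in> borel_measurable (restrict_space borel \<Omega>)" "bounded (f ` \<Omega>)"
    "g \<in> borel_measurable (restrict_space borel \<Omega>)" "bounded (g ` \<Omega>)"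
  shows "pairing \<Omega> \<mu> (\<lambda>x. f x + g x) = pairing \<Omega> \<mu> f + pairing \<Omega> \<mu> g"
  unfolding pairing_def using assms by (simp add: integrable_pos_part measures_on_uminus)

lemma pairing_cmult: "pairing \<Omega> \<mu> (\<lambda>x. c * f x) = c * pairing \<Omega> \<mu> f"
  unfolding pairing_def by (simp add: right_diff_distrib)

lemma pairing_uminus: "pairing \<Omega> (\<lambda>A. - \<mu> A) f = - pairing \<Omega> \<mu> f"
  unfolding pairing_def by simp

lemma pairing_cong: "(\<And>x. x \<in> \<Omega> \<Longrightarrow> f x = g x) \<Longrightarrow> pairing \<Omega> \<mu> f = pairing \<Omega> \<mu> g"
  unfolding pairing_def by (metis (no_types, lifting) Bochner_Integration.integral_cong space_pos_part)

lemma pairing_bound: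
  assumes \<mu>: "\<mu> \<in> measures_on \<Omega>" and f: "f \<in> borel_measurable (restrict_space borel \<Omega>)"
    and "\<And>x. x \<in> \<Omega> \<Longrightarrow> \<bar>f x\<bar> \<le> e"
  shows "\<bar>pairing \<Omega> \<mu> f\<bar> \<le> e * (measure (pos_part \<Omega> \<mu>) \<Omega> + measure (pos_part \<Omega> (\<lambda>A. - \<mu> A)) \<Omega>)"
proof -
  have "disjoint_family (\<lambda>i::nat. if i = 0 then \<Omega> else {})" by (auto simp: disjoint_family_on_def)
  then show ?thesis
    using pairing_Riemann_sum[OF \<mu> f, of "\<lambda>i. if i = 0 then \<Omega> else {}" 1 "\<lambda>i. 0" e] assms(3)
    by (simp add: borel_subsets_top lessThan_Suc)
qed

lemma total_variation_partition:
  assumes "\<And>i. A i \<in> borel_subsets \<Omega>" "disjoint_family A" "(\<Union>i<n. A i) = \<Omega>"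
  shows "(\<Sum>i<(n::nat). ennreal (norm (\<sigma> (A i)))) \<le> total_variation \<Omega> \<sigma> \<Omega>"
proof -
  have "(\<Sum>i<n. ennreal (norm (\<sigma> (A i)))) \<le> (\<Sum>i. ennreal (norm (\<sigma> (A i))))" by (rule sum_le_suminf) auto
  also have "\<dots> \<le> total_variation \<Omega> \<sigma> \<Omega>"
    unfolding total_variation_def
  proof (rule SUP_upper)
    have "A i \<subseteq> \<Omega>" for i using assms(1)[of i] borel_subsets_Pow by auto
    then have "(\<Union>i. A i) = \<Omega>" using assms(3) by auto
    then show "A \<in> {A. range A \<subseteq> borel_subsets \<Omega> \<and> disjoint_family A \<and> \<Union> (range A) = \<Omega>}" using assms by auto
  qed
  finally show ?thesis .
qed

lemma borel_measurable_vec_nth_comp: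
  fixes F :: "'a \<Rightarrow> real^'n"
  assumes "F \<in> borel_measurable M" shows "(\<lambda>x. F x $ i) \<in> borel_measurable M"
  using assms by (intro borel_measurable_continuous_on[where f="\<lambda>y. y $ i"]) (auto intro!: continuous_intros)

text \<open>On a partition with representatives \<open>q i\<close>, the vector pairing is
  close to \<open>\<Sum>i. q i \<bullet> \<sigma> (A i) \<le> C * (\<Sum>i. norm (\<sigma>
  (A i)))\<close>.\<close>

lemma vector_pairing_bound:
  fixes \<sigma> :: "(real^'n) set \<Rightarrow> real^'n"
  assumes \<sigma>: "\<sigma> \<in> measures_on \<Omega>" and tv: "total_variation \<Omega> \<sigma> \<Omega> \<le> ennreal t" and t: "t \<ge> 0"
    and F: "F \<in> borel_measurable (restrict_space borel \<Omega>)" and C: "\<And>x. x \<in> \<Omega> \<Longrightarrow> norm (F x) \<le> C" "C \<ge> 0"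
  shows "vector_pairing \<Omega> \<sigma> F \<le> C * t"
proof -
  define K where "K = (\<Sum>i\<in>UNIV. measure (pos_part \<Omega> (\<lambda>A. \<sigma> A $ i)) \<Omega> + measure (pos_part \<Omega> (\<lambda>A. - (\<sigma> A $ i))) \<Omega>)"
  have bdd: "bounded (F ` \<Omega>)" using C(1) by (auto simp: bounded_iff)
  have space: "space (restrict_space borel \<Omega>) = \<Omega>" by (simp add: space_restrict_space)
  have "vector_pairing \<Omega> \<sigma> F - C * t \<le> e * K" if e: "e > 0" for e
  proof -
    obtain A q n where A: "\<And>i. A i \<in> borel_subsets \<Omega>" "disjoint_family A" "(\<Union>i<(n::nat). A i) = \<Omega>"
      and close: "\<And>i x. i < n \<Longrightarrow> x \<in> A i \<Longrightarrow> norm (F x - q i) \<le> e"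
      and q: "\<And>i. i < n \<Longrightarrow> q i \<in> F ` \<Omega>"
      using bounded_measurable_partition[OF F _ e] bdd unfolding space by metis
    have comp: "\<bar>pairing \<Omega> (\<lambda>A. \<sigma> A $ j) (\<lambda>x. F x $ j) - (\<Sum>i<n. q i $ j * \<sigma> (A i) $ j)\<bar>
      \<le> e * (measure (pos_part \<Omega> (\<lambda>A. \<sigma> A $ j)) \<Omega> + measure (pos_part \<Omega> (\<lambda>A. - (\<sigma> A $ j))) \<Omega>)" for j
    proof (rule pairing_Riemann_sum[OF measures_on_nth[OF \<sigma>] _ A])
      show "(\<lambda>x. F x $ j) \<in> borel_measurable (restrict_space borel \<Omega>)" by (rule borel_measurable_vec_nth_comp[OF F])
      show "\<bar>F x $ j - q i $ j\<bar> \<le> e" if "i < n" "x \<in> A i" for i x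
        using close[OF that] component_le_norm_cart[of "F x - q i" j] by simp
    qed
    have "vector_pairing \<Omega> \<sigma> F \<le> (\<Sum>j\<in>UNIV. (\<Sum>i<n. q i $ j * \<sigma> (A i) $ j) +
        e * (measure (pos_part \<Omega> (\<lambda>A. \<sigma> A $ j)) \<Omega> + measure (pos_part \<Omega> (\<lambda>A. - (\<sigma> A $ j))) \<Omega>))"
      unfolding vector_pairing_def by (intro sum_mono) (use comp in \<open>auto simp: abs_le_iff algebra_simps\<close>)
    also have "\<dots> = (\<Sum>j\<in>UNIV. \<Sum>i<n. q i $ j * \<sigma> (A i) $ j) + e * K"
      by (simp add: K_def sum.distrib sum_distrib_left[symmetric])
    also have "(\<Sum>j\<in>UNIV. \<Sum>i<n. q i $ j * \<sigma> (A i) $ j) = (\<Sum>i<n. q i \<bullet> \<sigma> (A i))"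
      by (subst sum.swap) (simp add: inner_vec_def)
    also have "\<dots> \<le> (\<Sum>i<n. C * norm (\<sigma> (A i)))"
    proof (rule sum_mono)
      fix i assume "i \<in> {..<n}"
      then have "norm (q i) \<le> C" using q[of i] C by auto
      then show "q i \<bullet> \<sigma> (A i) \<le> C * norm (\<sigma> (A i))"
        by (meson mult_right_mono norm_cauchy_schwarz norm_ge_zero order_trans)
    qed
    also have "\<dots> \<le> C * t"
    proof -
      have "ennreal (\<Sum>i<n. norm (\<sigma> (A i))) \<le> ennreal t"
        using total_variation_partition[OF A, of \<sigma>] tv by (auto simp: sum_ennreal)
      then have "(\<Sum>i<n. norm (\<sigma> (A i))) \<le> t" using t by (simp add: ennreal_le_iff)
      then show ?thesis using C(2) by (simp add: sum_distrib_left[symmetric] mult_left_mono)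
    qed
    finally show ?thesis by simp
  qed
  then have "vector_pairing \<Omega> \<sigma> F - C * t \<le> 0" by (rule le_of_le_mult_eps)
  then show ?thesis by simp
qed

section \<open>Riesz representation of vector-valued functionals\<close>

definition Cc :: "('a::euclidean_space \<Rightarrow> 'b::real_normed_vector) set" where
  "Cc = {F. continuous_on UNIV F \<and> bounded {x. F x \<noteq> 0}}"

lemma CcI: "continuous_on UNIV F \<Longrightarrow> bounded {x. F x \<noteq> 0} \<Longrightarrow> F \<in> Cc"
  by (simp add: Cc_def)

lemma Cc_dominated:
  assumes "F \<in> Cc" "continuous_on UNIV G" "\<And>x. F x = 0 \<Longrightarrow> G x = 0" shows "G \<in> Cc"
proof (rule CcI)
  have "bounded {x. F x \<noteq> 0}" using assms(1) by (simp add: Cc_def)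
  then show "bounded {x. G x \<noteq> 0}" by (rule bounded_subset) (use assms(3) in auto)
qed fact

lemma Cc_continuous: "F \<in> Cc \<Longrightarrow> continuous_on UNIV F"
  by (simp add: Cc_def)

lemma Cc_bounded_range:
  assumes "F \<in> Cc" obtains B where "\<And>x. norm (F x) \<le> B"
proof -
  have "bounded {x. F x \<noteq> 0}" using assms by (simp add: Cc_def)
  then have "compact (closure {x. F x \<noteq> 0})" by (simp add: compact_closure)
  then have "compact (F ` closure {x. F x \<noteq> 0})"
    by (rule compact_continuous_image[OF continuous_on_subset[OF Cc_continuous[OF assms] subset_UNIV]])
  then have "bounded (F ` closure {x. F x \<noteq> 0})" by (rule compact_imp_bounded)
  then obtain B where B: "\<forall>y\<in>F ` closure {x. F x \<noteq> 0}. norm y \<le> B" unfolding bounded_iff by blast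
  have "norm (F x) \<le> max 0 B" for x
  proof (cases "F x = 0")
    case False
    then have "x \<in> closure {x. F x \<noteq> 0}" using closure_subset[of "{x. F x \<noteq> 0}"] by auto
    then show ?thesis using B by (auto simp: le_max_iff_disj)
  qed simp
  then show ?thesis by (rule that)
qed

lemma Cc_add: "F \<in> Cc \<Longrightarrow> G \<in> Cc \<Longrightarrow> (\<lambda>x. F x + G x) \<in> Cc"
proof -
  assume F: "F \<in> Cc" and G: "G \<in> Cc"
  show ?thesis
  proof (rule CcI)
    have "bounded ({x. F x \<noteq> 0} \<union> {x. G x \<noteq> 0})" using F G by (simp add: Cc_def)
    then show "bounded {x. F x + G x \<noteq> 0}" by (rule bounded_subset) auto
    show "continuous_on UNIV (\<lambda>x. F x + G x)"
      using F G by (auto simp: Cc_def intro!: continuous_intros)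
  qed
qed

lemma Cc_uminus: "F \<in> Cc \<Longrightarrow> (\<lambda>x. - F x) \<in> Cc"
  by (rule Cc_dominated) (auto simp: Cc_def intro!: continuous_intros)

lemma Cc_zero: "(\<lambda>x. 0) \<in> Cc"
  by (auto simp: Cc_def)

lemma Cc_sum: "finite I \<Longrightarrow> (\<And>i. i \<in> I \<Longrightarrow> F i \<in> Cc) \<Longrightarrow> (\<lambda>x. \<Sum>i\<in>I. F i x) \<in> Cc"
  by (induction I rule: finite_induct) (auto intro: Cc_zero Cc_add)

lemma Cc_nonneg_iff: "f \<in> Cc_nonneg \<longleftrightarrow> f \<in> Cc \<and> (\<forall>x. 0 \<le> f x)"
  by (auto simp: Cc_nonneg_def Cc_def)

lemma Cc_scaleR_const: "f \<in> Cc \<Longrightarrow> (\<lambda>x. f x *\<^sub>R v) \<in> Cc"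
  by (rule Cc_dominated) (auto simp: Cc_def intro!: continuous_intros)

lemma integrable_Cc:
  fixes f :: "'a::euclidean_space \<Rightarrow> real"
  assumes "finite_measure P" "sets P = sets borel" "f \<in> Cc" shows "integrable P f"
proof -
  interpret finite_measure P by fact
  obtain B where "\<And>x. norm (f x) \<le> B" using Cc_bounded_range[OF assms(3)] by blast
  moreover have "f \<in> borel_measurable P"
    using borel_measurable_continuous_onI[OF Cc_continuous[OF assms(3)]] assms(2)
    by (simp cong: measurable_cong_sets)
  ultimately show ?thesis by (intro integrable_const_bound[of _ B]) auto
qed

lemma inner_regular_approx:
  fixes P :: "'a::euclidean_space measure"
  assumes "finite_measure P" "sets P = sets borel" "B \<in> sets borel" "e > 0"
  obtains K where "compact K" "K \<subseteq> B" "measure P B \<le> measure P K + e"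
proof -
  interpret finite_measure P by fact
  have sup: "emeasure P B = (SUP K\<in>{K. K \<subseteq> B \<and> compact K}. emeasure P K)"
    by (rule inner_regular[OF assms(2) _ assms(3)]) (simp add: emeasure_finite)
  have "\<exists>K. compact K \<and> K \<subseteq> B \<and> measure P B \<le> measure P K + e"
  proof (rule ccontr)
    assume none: "\<nexists>K. compact K \<and> K \<subseteq> B \<and> measure P B \<le> measure P K + e"
    have less: "measure P K < measure P B - e" if "K \<subseteq> B" "compact K" for K
    proof -
      have "\<not> measure P B \<le> measure P K + e" using none that by blast
      then show ?thesis by linarith
    qed
    have "emeasure P B \<le> ennreal (measure P B - e)"
      unfolding sup
    proof (rule SUP_least)
      fix K assume "K \<in> {K. K \<subseteq> B \<and> compact K}"
      then have "measure P K \<le> measure P B - e" using less[of K] by simp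
      then show "emeasure P K \<le> ennreal (measure P B - e)" by (simp add: emeasure_eq_measure ennreal_leI)
    qed
    moreover have "0 < measure P B - e" using less[of "{}"] by simp
    ultimately show False using assms(4) by (simp add: emeasure_eq_measure ennreal_le_iff)
  qed
  then show ?thesis using that by blast
qed

text \<open>The components \<open>f \<mapsto> T (f e\<^sub>i)\<close> are represented by
  differences \<open>P i - N i\<close> of finite measures, which gives
  \<open>\<sigma>\<close>. For the total variation, let \<open>K k\<close> be disjoint
  compact sets and \<open>w k\<close> the direction of \<open>\<sigma> (K k)\<close>.
  Continuous hats around the \<open>K k\<close> with values along \<open>w k\<close>,
  retracted to the unit ball and cut off near infinity, tend to \<open>\<Sum>k. w k\<close>
  times the indicator of \<open>K k\<close>; so \<open>\<Sum>k. norm (\<sigma> (K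
  k))\<close> is a limit of values \<open>T F \<le> 1\<close>. Disjoint Borel sets are
  approximated from inside by compact ones.\<close>

lemma vector_Riesz:
  fixes T :: "(real^'n \<Rightarrow> real^'n) \<Rightarrow> real"
  assumes add: "\<And>F G. F \<in> Cc \<Longrightarrow> G \<in> Cc \<Longrightarrow> T (\<lambda>x. F x + G x) = T F + T G"
    and bound: "\<And>F. F \<in> Cc \<Longrightarrow> (\<And>x. norm (F x) \<le> 1) \<Longrightarrow> T F \<le> 1"
    and \<Omega>: "open \<Omega>"
  obtains \<sigma> where "\<sigma> \<in> measures_on \<Omega>" "total_variation \<Omega> \<sigma> \<Omega> \<le> 1"
    "\<And>F. F \<in> Cc \<Longrightarrow> (\<And>x. x \<notin> \<Omega> \<Longrightarrow> F x = 0) \<Longrightarrow> vector_pairing \<Omega> \<sigma> F = T F"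
proof -
  have T0: "T (\<lambda>x. 0) = 0" using add[OF Cc_zero Cc_zero] by simp
  have T_uminus: "T (\<lambda>x. - F x) = - T F" if "F \<in> Cc" for F
    using add[OF that Cc_uminus[OF that]] T0 by simp
  have T_sum: "T (\<lambda>x. \<Sum>i\<in>I. F i x) = (\<Sum>i\<in>I. T (F i))" if "finite I" "\<And>i. i \<in> I \<Longrightarrow> F i \<in> Cc" for F and I :: "'n set"
    using that by (induction I rule: finite_induct) (auto simp: T0 add Cc_sum)
  have abs_bound: "\<bar>T F\<bar> \<le> 1" if "F \<in> Cc" "\<And>x. norm (F x) \<le> 1" for F
    using bound[OF that] bound[OF Cc_uminus[OF that(1)]] that by (simp add: T_uminus abs_le_iff)
  define t where "t i f = T (\<lambda>x. f x *\<^sub>R axis i 1)" for i and f :: "real^'n \<Rightarrow> real"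
  have t_add: "t i (\<lambda>x. f x + g x) = t i f + t i g" if "f \<in> Cc" "g \<in> Cc" for i f g
    unfolding t_def scaleR_add_left by (rule add) (intro Cc_scaleR_const that)+
  have t_bound: "\<bar>t i f\<bar> \<le> 1" if "f \<in> Cc" "\<And>x. \<bar>f x\<bar> \<le> 1" for i f
    unfolding t_def by (rule abs_bound) (use that in \<open>auto intro: Cc_scaleR_const simp: norm_axis_1\<close>)
  have ex: "\<exists>P N. finite_measure P \<and> finite_measure N \<and> sets P = sets borel \<and> sets N = sets borel \<and>
      (\<forall>f\<in>Cc_nonneg. integral\<^sup>L P f - integral\<^sup>L N f = t i f)" for i
  proof (rule Riesz_signed[of "t i" 1])
    show "t i (\<lambda>x. f x + g x) = t i f + t i g" if "f \<in> Cc_nonneg" "g \<in> Cc_nonneg" for f g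
      using that by (intro t_add) (auto simp: Cc_nonneg_iff)
    show "\<bar>t i f\<bar> \<le> 1" if "f \<in> Cc_nonneg" "\<And>x. f x \<le> 1" for f
      using that by (intro t_bound) (auto simp: Cc_nonneg_iff)
  qed blast
  define good where "good i P N \<longleftrightarrow> finite_measure P \<and> finite_measure N \<and>
      sets P = sets borel \<and> sets N = sets borel \<and>
      (\<forall>f\<in>Cc_nonneg. integral\<^sup>L P f - integral\<^sup>L N f = t i f)" for i P N
  have "\<forall>i. \<exists>P N. good i P N" unfolding good_def by (rule allI) (rule ex)
  then have "\<exists>P. \<forall>i. \<exists>N. good i (P i) N" by (rule choice)
  then obtain P where "\<forall>i. \<exists>N. good i (P i) N" ..
  then have "\<exists>N. \<forall>i. good i (P i) (N i)" by (rule choice)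
  then obtain N where good: "\<forall>i. good i (P i) (N i)" ..
  have PN: "finite_measure (P i)" "finite_measure (N i)" "sets (P i) = sets borel" "sets (N i) = sets borel"
    and rep0: "f \<in> Cc_nonneg \<Longrightarrow> integral\<^sup>L (P i) f - integral\<^sup>L (N i) f = t i f" for i f
    using good unfolding good_def by blast+
  have rep1: "integral\<^sup>L (P i) f - integral\<^sup>L (N i) f = t i f" if f: "f \<in> Cc" for i f
  proof -
    define fp fn where "fp x = max (f x) 0" and "fn x = max (- f x) 0" for x
    have "continuous_on UNIV fp" "continuous_on UNIV fn"
      unfolding fp_def fn_def by (intro continuous_intros Cc_continuous[OF f])+
    then have mem: "fp \<in> Cc" "fn \<in> Cc"
      by (auto intro!: Cc_dominated[OF f] simp: fp_def fn_def)
    then have nn: "fp \<in> Cc_nonneg" "fn \<in> Cc_nonneg" by (auto simp: Cc_nonneg_iff fp_def fn_def)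
    have "fp = (\<lambda>x. f x + fn x)" by (auto simp: fp_def fn_def)
    moreover have "t i (\<lambda>x. f x + fn x) = t i f + t i fn" by (rule t_add[OF f mem(2)])
    moreover have "integral\<^sup>L M (\<lambda>x. f x + fn x) = integral\<^sup>L M f + integral\<^sup>L M fn"
      if "finite_measure M" "sets M = sets borel" for M
      using integrable_Cc[OF that f] integrable_Cc[OF that mem(2)] by simp
    ultimately show ?thesis using rep0[OF nn(1), of i] rep0[OF nn(2), of i] PN by simp
  qed
  have rep: "(\<Sum>i\<in>UNIV. integral\<^sup>L (P i) (\<lambda>x. F x $ i) - integral\<^sup>L (N i) (\<lambda>x. F x $ i)) = T F"
    if F: "F \<in> Cc" for F
  proof -
    have comp: "(\<lambda>x. F x $ i) \<in> Cc" for i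
      by (rule Cc_dominated[OF F]) (auto intro!: continuous_intros Cc_continuous[OF F])
    have "T F = T (\<lambda>x. \<Sum>i\<in>UNIV. (F x $ i) *\<^sub>R axis i 1)"
      by (simp add: scalar_mult_eq_scaleR[symmetric] basis_expansion)
    also have "\<dots> = (\<Sum>i\<in>UNIV. t i (\<lambda>x. F x $ i))"
      unfolding t_def by (rule T_sum) (auto intro: Cc_scaleR_const comp)
    finally show ?thesis by (simp add: rep1[OF comp])
  qed
  define \<sigma> where "\<sigma> A = (if A \<in> borel_subsets \<Omega> then \<chi> i. measure (P i) A - measure (N i) A else 0)" for A
  have borel: "A \<in> sets borel" "A \<subseteq> \<Omega>" if "A \<in> borel_subsets \<Omega>" for A
    using that \<Omega> by (auto simp: sets_restrict_space_iff)
  have \<sigma>: "\<sigma> \<in> measures_on \<Omega>"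
    unfolding measures_on_def
  proof (intro CollectI conjI allI impI)
    show "\<sigma> A = 0" if "A \<notin> borel_subsets \<Omega>" for A using that by (simp add: \<sigma>_def)
    show "\<sigma> {} = 0" by (simp add: \<sigma>_def vec_eq_iff)
    fix A :: "nat \<Rightarrow> (real^'n) set" assume A: "range A \<subseteq> borel_subsets \<Omega> \<and> disjoint_family A"
    have "(\<lambda>k. measure M (A k)) sums measure M (\<Union>k. A k)" if "finite_measure M" "sets M = sets borel" for M
    proof (rule finite_measure.finite_measure_UNION[OF that(1)])
      show "range A \<subseteq> sets M" using A borel(1) that(2) by auto
    qed (use A in auto)
    then have "(\<lambda>k. measure (P i) (A k) - measure (N i) (A k)) sums
        (measure (P i) (\<Union>k. A k) - measure (N i) (\<Union>k. A k))" for i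
      using PN by (intro sums_diff) auto
    moreover have "(\<Union>k. A k) \<in> borel_subsets \<Omega>" using A by auto
    ultimately have "(\<lambda>m. (\<Sum>k<m. \<sigma> (A k)) $ i) \<longlonglongrightarrow> \<sigma> (\<Union>k. A k) $ i" for i
      using A by (auto simp: sums_def \<sigma>_def range_subsetD)
    then show "(\<lambda>k. \<sigma> (A k)) sums \<sigma> (\<Union>k. A k)" unfolding sums_def by (rule vec_tendstoI)
  qed
  have vp: "vector_pairing \<Omega> \<sigma> F = T F" if F: "F \<in> Cc" and F0: "\<And>x. x \<notin> \<Omega> \<Longrightarrow> F x = 0" for F
  proof -
    have "pairing \<Omega> (\<lambda>A. \<sigma> A $ i) (\<lambda>x. F x $ i) = integral\<^sup>L (P i) (\<lambda>x. F x $ i) - integral\<^sup>L (N i) (\<lambda>x. F x $ i)" for i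
    proof -
      have comp: "(\<lambda>x. F x $ i) \<in> Cc"
        by (rule Cc_dominated[OF F]) (auto intro!: continuous_intros Cc_continuous[OF F])
      have restrict: "integral\<^sup>L (restrict_space M \<Omega>) (\<lambda>x. F x $ i) = integral\<^sup>L M (\<lambda>x. F x $ i)"
        "finite_measure (restrict_space M \<Omega>)" "sets (restrict_space M \<Omega>) = borel_subsets \<Omega>"
        "\<And>A. A \<in> borel_subsets \<Omega> \<Longrightarrow> measure (restrict_space M \<Omega>) A = measure M A"
        if M: "finite_measure M" "sets M = sets borel" for M
      proof -
        have \<Omega>M: "\<Omega> \<inter> space M \<in> sets M" "space M = UNIV"
          using \<Omega> M(2) sets_eq_imp_space_eq[OF M(2)] by auto
        show "integral\<^sup>L (restrict_space M \<Omega>) (\<lambda>x. F x $ i) = integral\<^sup>L M (\<lambda>x. F x $ i)"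
          unfolding integral_restrict_space[OF \<Omega>M(1)]
          by (intro Bochner_Integration.integral_cong) (auto simp: indicator_def F0)
        show "finite_measure (restrict_space M \<Omega>)"
          using M(1) \<Omega>M by (intro finite_measure_restrict_space) auto
        show "sets (restrict_space M \<Omega>) = borel_subsets \<Omega>" by (rule sets_restrict_space_cong[OF M(2)])
        show "measure (restrict_space M \<Omega>) A = measure M A" if "A \<in> borel_subsets \<Omega>" for A
          using borel(2)[OF that] \<Omega>M by (intro measure_restrict_space) auto
      qed
      obtain B where B: "\<And>x. norm (F x $ i) \<le> B" using Cc_bounded_range[OF comp] by blast
      have "pairing \<Omega> (\<lambda>A. \<sigma> A $ i) (\<lambda>x. F x $ i)
          = integral\<^sup>L (restrict_space (P i) \<Omega>) (\<lambda>x. F x $ i) - integral\<^sup>L (restrict_space (N i) \<Omega>) (\<lambda>x. F x $ i)"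
      proof (rule pairing_eq_integral_diff[OF measures_on_nth[OF \<sigma>]])
        show "(\<lambda>x. F x $ i) \<in> borel_measurable (restrict_space borel \<Omega>)"
          by (intro measurable_restrict_space1 borel_measurable_continuous_onI Cc_continuous[OF comp])
        show "bounded ((\<lambda>x. F x $ i) ` \<Omega>)" using B by (auto simp: bounded_iff)
        show "\<sigma> A $ i = measure (restrict_space (P i) \<Omega>) A - measure (restrict_space (N i) \<Omega>) A"
          if "A \<in> borel_subsets \<Omega>" for A
          using that restrict(4)[OF PN(1,3)] restrict(4)[OF PN(2,4)] by (simp add: \<sigma>_def)
      qed (use restrict(2,3) PN in auto)
      then show ?thesis using restrict(1)[OF PN(1,3)] restrict(1)[OF PN(2,4)] by simp
    qed
    then show ?thesis using rep[OF F] by (simp add: vector_pairing_def)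
  qed
  have compacts: "(\<Sum>k<n. norm (\<sigma> (K k))) \<le> 1"
    if K: "\<And>k. k < n \<Longrightarrow> compact (K k) \<and> K k \<subseteq> \<Omega>" and disj: "\<And>j k. j < n \<Longrightarrow> k < n \<Longrightarrow> j \<noteq> k \<Longrightarrow> K j \<inter> K k = {}"
    for n and K :: "nat \<Rightarrow> (real^'n) set"
  proof -
    have Kb: "K k \<in> borel_subsets \<Omega>" "K k \<in> sets borel" if "k < n" for k
      using K[OF that] \<Omega> by (auto simp: sets_restrict_space_iff compact_imp_closed)
    define w where "w k = sgn (\<sigma> (K k))" for k
    have w1: "norm (w k) \<le> 1" for k by (simp add: w_def norm_sgn)
    have w\<sigma>: "w k \<bullet> \<sigma> (K k) = norm (\<sigma> (K k))" for k
      by (cases "\<sigma> (K k) = 0") (simp_all add: w_def sgn_div_norm dot_square_norm power2_eq_square)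
    have "bounded (\<Union>k<n. K k)" using K by (auto intro!: bounded_UN compact_imp_bounded)
    then obtain R where R: "\<forall>x\<in>(\<Union>k<n. K k). norm x \<le> R" unfolding bounded_iff by blast
    define cut where "cut x = max 0 (min 1 (R + 1 - norm x))" for x :: "real^'n"
    have cut: "0 \<le> cut x" "cut x \<le> 1" for x by (auto simp: cut_def)
    have cut1: "cut x = 1" if "k < n" "x \<in> K k" for k x
    proof -
      have "norm x \<le> R" using R that by blast
      then show ?thesis by (simp add: cut_def)
    qed
    (* the radial retraction to the closed unit ball, which keeps the hats admissible where they
       overlap *)
    define clip where "clip y = (1 / max 1 (norm y)) *\<^sub>R y" for y :: "real^'n"
    have clip_norm: "norm (clip y) \<le> 1" for y by (simp add: clip_def divide_le_eq)
    have clip_id: "clip y = y" if "norm y \<le> 1" for y using that by (simp add: clip_def max_def)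
    have clip_cont: "continuous_on UNIV clip"
      unfolding clip_def by (intro continuous_intros) (auto simp: max_def)
    (* the distance to the empty set is zero, so an empty set needs the constant zero explicitly *)
    define h where "h j k x = (if K k = {} then 0 else max 0 (1 - real j * infdist x (K k)))" for j :: nat and k x
    have h_cont: "continuous_on UNIV (h j k)" for j k
      unfolding h_def by (cases "K k = {}") (auto intro!: continuous_intros)
    have h_lim: "(\<lambda>j. h j k x) \<longlonglongrightarrow> indicator (K k) x" if "k < n" for k x
    proof (cases "x \<in> K k")
      case True
      then have "h j k x = 1" for j by (auto simp: h_def)
      then show ?thesis using True by simp
    next
      case False
      have "\<forall>\<^sub>F j in sequentially. h j k x = 0"
      proof (cases "K k = {}")
        case nonempty: False
        have "closed (K k)" using K[OF that] by (simp add: compact_imp_closed)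
        then have pos: "infdist x (K k) > 0"
          using False nonempty in_closed_iff_infdist_zero[of "K k" x] infdist_nonneg[of x "K k"] by linarith
        obtain j0 :: nat where j0: "1 / infdist x (K k) < j0" using reals_Archimedean2 by blast
        have "h j k x = 0" if "j \<ge> j0" for j
        proof -
          have "1 / infdist x (K k) \<le> real j" using j0 that by linarith
          then have "1 \<le> real j * infdist x (K k)" using pos by (simp add: field_simps)
          then show ?thesis by (simp add: h_def)
        qed
        then show ?thesis by (auto simp: eventually_sequentially)
      qed (simp add: h_def)
      then show ?thesis using False by (simp add: tendsto_eventually)
    qed
    define F where "F j x = cut x *\<^sub>R clip (\<Sum>k<n. h j k x *\<^sub>R w k)" for j x
    define S where "S x = (\<Sum>k<n. indicator (K k) x *\<^sub>R w k)" for x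
    have S_eq: "S x = w k" if "k < n" "x \<in> K k" for k x
    proof -
      have "S x = (\<Sum>l<n. if l = k then w k else 0)"
        unfolding S_def using that disj by (intro sum.cong) (auto simp: indicator_def)
      then show ?thesis using that by simp
    qed
    have S0: "S x = 0" if "\<And>k. k < n \<Longrightarrow> x \<notin> K k" for x
      unfolding S_def using that by (intro sum.neutral) auto
    have F_lim: "(\<lambda>j. F j x) \<longlonglongrightarrow> S x" for x
    proof -
      have "(\<lambda>j. \<Sum>k<n. h j k x *\<^sub>R w k) \<longlonglongrightarrow> S x"
        unfolding S_def by (intro tendsto_intros h_lim) auto
      then have "(\<lambda>j. clip (\<Sum>k<n. h j k x *\<^sub>R w k)) \<longlonglongrightarrow> clip (S x)"
        using clip_cont by (auto intro: continuous_on_tendsto_compose[of UNIV])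
      then have "(\<lambda>j. F j x) \<longlonglongrightarrow> cut x *\<^sub>R clip (S x)"
        unfolding F_def by (intro tendsto_intros)
      moreover have "cut x *\<^sub>R clip (S x) = S x"
      proof (cases "\<exists>k<n. x \<in> K k")
        case True
        then show ?thesis using S_eq cut1 clip_id w1 by auto
      next
        case False
        then have "S x = 0" by (intro S0) auto
        then show ?thesis by (simp add: clip_id)
      qed
      ultimately show ?thesis by simp
    qed
    have F_norm: "norm (F j x) \<le> 1" for j x
      using cut[of x] clip_norm[of "\<Sum>k<n. h j k x *\<^sub>R w k"] by (simp add: F_def mult_le_one)
    have F_cont: "continuous_on UNIV (F j)" for j
    proof -
      have "continuous_on UNIV (\<lambda>x. clip (\<Sum>k<n. h j k x *\<^sub>R w k))"
        by (rule continuous_on_compose2[OF clip_cont]) (auto intro!: continuous_intros h_cont)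
      then show ?thesis unfolding F_def cut_def by (intro continuous_intros)
    qed
    have F_Cc: "F j \<in> Cc" for j
    proof (rule CcI[OF F_cont], rule bounded_subset[OF bounded_cball[of 0 "R + 1"]])
      show "{x. F j x \<noteq> 0} \<subseteq> cball 0 (R + 1)" by (auto simp: F_def cut_def max_def min_def split: if_splits)
    qed
    have lim: "(\<lambda>j. integral\<^sup>L M (\<lambda>x. F j x $ i)) \<longlonglongrightarrow> (\<Sum>k<n. w k $ i * measure M (K k))"
      if M: "finite_measure M" "sets M = sets borel" for M i
    proof -
      interpret finite_measure M by fact
      have "(\<lambda>j. integral\<^sup>L M (\<lambda>x. F j x $ i)) \<longlonglongrightarrow> (\<integral>x. S x $ i \<partial>M)"
      proof (rule integral_dominated_convergence[where w="\<lambda>x. 1"])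
        have "(\<lambda>x. S x $ i) = (\<lambda>x. \<Sum>k<n. indicator (K k) x * w k $ i)"
          by (simp add: S_def fun_eq_iff)
        also have "\<dots> \<in> borel_measurable M"
          using Kb M(2) by (intro borel_measurable_sum borel_measurable_times borel_measurable_indicator) auto
        finally show "(\<lambda>x. S x $ i) \<in> borel_measurable M" .
        show "(\<lambda>x. F j x $ i) \<in> borel_measurable M" for j
          using borel_measurable_continuous_onI[OF F_cont, of j] M(2)
          by (intro borel_measurable_vec_nth_comp) (simp cong: measurable_cong_sets)
        show "AE x in M. (\<lambda>j. F j x $ i) \<longlonglongrightarrow> S x $ i"
          using F_lim by (intro AE_I2 tendsto_vec_nth)
        show "AE x in M. norm (F j x $ i) \<le> 1" for j
        proof (intro AE_I2)
          fix x
          show "norm (F j x $ i) \<le> 1"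
            using component_le_norm_cart[of "F j x" i] F_norm[of j x] by simp
        qed
      qed simp
      also have "(\<integral>x. S x $ i \<partial>M) = (\<integral>x. (\<Sum>k<n. w k $ i * indicator (K k) x) \<partial>M)"
        by (simp add: S_def mult.commute)
      also have "\<dots> = (\<Sum>k<n. (\<integral>x. w k $ i * indicator (K k) x \<partial>M))"
        using Kb(2) M(2) by (intro Bochner_Integration.integral_sum integrable_mult_right integrable_real_indicator)
          (auto simp: emeasure_finite less_top[symmetric])
      also have "\<dots> = (\<Sum>k<n. w k $ i * measure M (K k))"
        using sets_eq_imp_space_eq[OF M(2)] by simp
      finally show ?thesis .
    qed
    have "(\<lambda>j. T (F j)) \<longlonglongrightarrow> (\<Sum>i\<in>UNIV. (\<Sum>k<n. w k $ i * measure (P i) (K k)) - (\<Sum>k<n. w k $ i * measure (N i) (K k)))"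
      unfolding rep[OF F_Cc, symmetric] using PN by (intro tendsto_intros lim)
    also have "(\<Sum>i\<in>UNIV. (\<Sum>k<n. w k $ i * measure (P i) (K k)) - (\<Sum>k<n. w k $ i * measure (N i) (K k)))
        = (\<Sum>i\<in>UNIV. \<Sum>k<n. w k $ i * \<sigma> (K k) $ i)"
      using Kb(1) by (simp add: sum_subtractf[symmetric] right_diff_distrib[symmetric] \<sigma>_def)
    also have "\<dots> = (\<Sum>k<n. w k \<bullet> \<sigma> (K k))" by (subst sum.swap) (simp add: inner_vec_def)
    also have "\<dots> = (\<Sum>k<n. norm (\<sigma> (K k)))" by (simp add: w\<sigma>)
    finally show ?thesis
      by (rule LIMSEQ_le_const2) (use bound[OF F_Cc F_norm] in auto)
  qed
  have partial: "(\<Sum>k<n. norm (\<sigma> (A k))) \<le> 1"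
    if A: "range A \<subseteq> borel_subsets \<Omega>" "disjoint_family A" for A :: "nat \<Rightarrow> (real^'n) set" and n
  proof -
    have Ab: "A k \<in> borel_subsets \<Omega>" "A k \<in> sets borel" for k using A(1) borel(1) by auto
    have "(\<Sum>k<n. norm (\<sigma> (A k))) - 1 \<le> e * (real n * (2 * CARD('n)))" if e: "e > 0" for e
    proof -
      have "\<exists>K. compact K \<and> K \<subseteq> A k \<and> (\<forall>i. measure (P i) (A k) \<le> measure (P i) K + e \<and> measure (N i) (A k) \<le> measure (N i) K + e)" for k
      proof -
        have ex: "\<exists>K. compact K \<and> K \<subseteq> A k \<and> measure M (A k) \<le> measure M K + e"
          if "finite_measure M" "sets M = sets borel" for M
          using inner_regular_approx[OF that Ab(2) e] by metis
        obtain KP where KP: "\<And>i. compact (KP i) \<and> KP i \<subseteq> A k \<and> measure (P i) (A k) \<le> measure (P i) (KP i) + e"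
          using ex[OF PN(1,3)] by metis
        obtain KN where KN: "\<And>i. compact (KN i) \<and> KN i \<subseteq> A k \<and> measure (N i) (A k) \<le> measure (N i) (KN i) + e"
          using ex[OF PN(2,4)] by metis
        define K where "K = (\<Union>i\<in>UNIV. KP i \<union> KN i)"
        have K: "compact K" "K \<subseteq> A k" unfolding K_def using KP KN by (auto intro!: compact_UN compact_Un)
        have mono: "measure M K' \<le> measure M K" if "finite_measure M" "sets M = sets borel" "K' \<subseteq> K" for M K'
          using that K(1) by (intro finite_measure.finite_measure_mono) (auto simp: compact_imp_closed)
        show ?thesis
        proof (intro exI[of _ K] conjI allI K)
          fix i
          have "measure (P i) (KP i) \<le> measure (P i) K" "measure (N i) (KN i) \<le> measure (N i) K"
            by (rule mono[OF PN(1,3)], force simp: K_def) (rule mono[OF PN(2,4)], force simp: K_def)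
          then show "measure (P i) (A k) \<le> measure (P i) K + e" "measure (N i) (A k) \<le> measure (N i) K + e"
            using KP[of i] KN[of i] by linarith+
        qed
      qed
      then obtain K where K: "\<And>k. compact (K k)" "\<And>k. K k \<subseteq> A k"
        "\<And>k i. measure (P i) (A k) \<le> measure (P i) (K k) + e" "\<And>k i. measure (N i) (A k) \<le> measure (N i) (K k) + e"
        by metis
      have Kb: "K k \<in> borel_subsets \<Omega>" "K k \<in> sets borel" for k
      proof -
        show "K k \<in> sets borel" using K(1) by (simp add: compact_imp_closed)
        then show "K k \<in> borel_subsets \<Omega>"
          using K(2)[of k] borel(2)[OF Ab(1)[of k]] \<Omega> by (auto simp: sets_restrict_space_iff)
      qed
      have close: "norm (\<sigma> (A k)) \<le> norm (\<sigma> (K k)) + 2 * CARD('n) * e" for k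
      proof -
        have mono: "measure M (K k) \<le> measure M (A k)" if "finite_measure M" "sets M = sets borel" for M
          using that K(2) Ab(2) by (intro finite_measure.finite_measure_mono) auto
        have "\<bar>(\<sigma> (A k) - \<sigma> (K k)) $ i\<bar> \<le> 2 * e" for i
          using mono[OF PN(1,3), of i] mono[OF PN(2,4), of i] K(3)[of i k] K(4)[of i k] Ab(1)[of k] Kb(1)[of k]
          by (simp add: \<sigma>_def abs_le_iff)
        then have "norm (\<sigma> (A k) - \<sigma> (K k)) \<le> (\<Sum>i\<in>(UNIV::'n set). 2 * e)"
          by (intro order_trans[OF norm_le_l1_cart] sum_mono)
        then show ?thesis using norm_triangle_sub[of "\<sigma> (A k)" "\<sigma> (K k)"] by (simp add: mult_ac)
      qed
      have "(\<Sum>k<n. norm (\<sigma> (A k))) \<le> (\<Sum>k<n. norm (\<sigma> (K k)) + 2 * CARD('n) * e)" by (intro sum_mono close)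
      also have "\<dots> = (\<Sum>k<n. norm (\<sigma> (K k))) + e * (real n * (2 * CARD('n)))" by (simp add: sum.distrib mult_ac)
      also have "(\<Sum>k<n. norm (\<sigma> (K k))) \<le> 1"
      proof (rule compacts)
        show "compact (K k) \<and> K k \<subseteq> \<Omega>" for k using K(1,2) borel(2)[OF Ab(1)[of k]] by blast
        show "K j \<inter> K k = {}" if "j \<noteq> k" for j k
        proof -
          have "A j \<inter> A k = {}" using A(2) that by (simp add: disjoint_family_on_def)
          then show ?thesis using K(2)[of j] K(2)[of k] by blast
        qed
      qed
      finally show ?thesis by simp
    qed
    then have "(\<Sum>k<n. norm (\<sigma> (A k))) - 1 \<le> 0" by (rule le_of_le_mult_eps)
    then show ?thesis by simp
  qed
  have tv: "total_variation \<Omega> \<sigma> \<Omega> \<le> 1"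
    unfolding total_variation_def
  proof (intro SUP_least)
    fix A :: "nat \<Rightarrow> (real^'n) set"
    assume "A \<in> {A. range A \<subseteq> borel_subsets \<Omega> \<and> disjoint_family A \<and> \<Union> (range A) = \<Omega>}"
    then have "(\<Sum>k<n. ennreal (norm (\<sigma> (A k)))) \<le> 1" for n
      using partial[of A n] by (simp add: sum_ennreal)
    then show "(\<Sum>k. ennreal (norm (\<sigma> (A k)))) \<le> 1" unfolding suminf_eq_SUP by (intro SUP_least)
  qed
  show ?thesis by (rule that[OF \<sigma> tv vp])
qed

section \<open>Test functions\<close>

lemma grad_nth:
  assumes "(f has_derivative D) (at x)" shows "grad f x $ i = D (axis i 1)"
  using frechet_derivative_at[OF assms] by (simp add: grad_def)

lemma linear_eq_inner:
  fixes D :: "real^'n \<Rightarrow> real"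
  assumes "linear D" shows "D h = (\<chi> i. D (axis i 1)) \<bullet> h"
proof -
  have "D h = D (\<Sum>i\<in>UNIV. (h $ i) *\<^sub>R axis i 1)"
    using basis_expansion[of h] by (simp add: scalar_mult_eq_scaleR)
  also have "\<dots> = (\<Sum>i\<in>UNIV. h $ i * D (axis i 1))"
    by (simp add: linear_sum[OF assms] linear_scale[OF assms])
  finally show ?thesis by (simp add: inner_vec_def mult.commute)
qed

lemma has_derivative_grad:
  assumes "f differentiable (at x)" shows "(f has_derivative (\<lambda>h. grad f x \<bullet> h)) (at x)"
proof -
  obtain D where D: "(f has_derivative D) (at x)" using assms by (auto simp: differentiable_def)
  have "(\<chi> i. D (axis i 1)) = grad f x" by (simp add: vec_eq_iff grad_nth[OF D])
  then have "D = (\<lambda>h. grad f x \<bullet> h)" by (metis linear_eq_inner has_derivative_linear[OF D])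
  then show ?thesis using D by simp
qed

lemma grad_eqI:
  assumes "(f has_derivative (\<lambda>h. G \<bullet> h)) (at x)" shows "grad f x = G"
  by (simp add: vec_eq_iff grad_nth[OF assms] inner_axis)

lemma Ck_SucI:
  assumes "\<And>x. (f has_derivative (\<lambda>h. G x \<bullet> h)) (at x)" "\<And>i. Ck k (\<lambda>x. G x $ i)"
  shows "Ck (Suc k) f"
proof -
  have "grad f = G" using grad_eqI[OF assms(1)] by auto
  then show ?thesis using assms by (auto simp: differentiable_def)
qed

lemma Ck_grad: "Ck (Suc k) f \<Longrightarrow> Ck k (\<lambda>x. grad f x $ i)"
  by simp

lemma Ck_has_derivative: "Ck (Suc k) f \<Longrightarrow> (f has_derivative (\<lambda>h. grad f x \<bullet> h)) (at x)"
  by (rule has_derivative_grad) simp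

lemma Ck_SucD: "Ck (Suc k) f \<Longrightarrow> Ck k f"
proof (induction k arbitrary: f)
  case 0
  then show ?case
    by (auto intro!: continuous_at_imp_continuous_on differentiable_imp_continuous_within)
next
  case (Suc k)
  have "Ck k (\<lambda>x. grad f x $ i)" for i by (rule Suc.IH[OF Ck_grad[OF Suc.prems]])
  then show ?case using Suc.prems by auto
qed

lemma Ck_continuous: "Ck k f \<Longrightarrow> continuous_on A f"
proof (induction k)
  case 0 then show ?case by (auto intro: continuous_on_subset)
next
  case (Suc k) then show ?case using Ck_SucD by blast
qed

lemma Ck_const: "Ck k (\<lambda>x::real^'n. c)"
proof (induction k arbitrary: c)
  case (Suc k)
  have "Ck k (\<lambda>x::real^'n. (0::real^'n) $ i)" for i using Suc[of 0] by simp
  then show ?case by (rule Ck_SucI[rotated]) simp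
qed simp

lemma Ck_nth: "Ck k (\<lambda>x::real^'n. x $ i)"
proof (cases k)
  case (Suc m)
  have "((\<lambda>x::real^'n. x $ i) has_derivative (\<lambda>h. axis i 1 \<bullet> h)) (at x)" for x :: "real^'n"
    by (simp add: inner_axis' bounded_linear_imp_has_derivative bounded_linear_vec_nth)
  then show ?thesis unfolding Suc by (rule Ck_SucI) (rule Ck_const)
qed (auto intro!: continuous_intros)

lemma Ck_add: "Ck k f \<Longrightarrow> Ck k g \<Longrightarrow> Ck k (\<lambda>x. f x + g x)"
proof (induction k arbitrary: f g)
  case (Suc k)
  show ?case
  proof (rule Ck_SucI)
    show "((\<lambda>x. f x + g x) has_derivative (\<lambda>h. (grad f x + grad g x) \<bullet> h)) (at x)" for x
      using has_derivative_add[OF Ck_has_derivative[OF Suc.prems(1)] Ck_has_derivative[OF Suc.prems(2)]]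
      by (simp add: inner_add_left)
    show "Ck k (\<lambda>x. (grad f x + grad g x) $ i)" for i
      using Suc.IH[OF Ck_grad[OF Suc.prems(1)] Ck_grad[OF Suc.prems(2)]] by simp
  qed
qed (auto intro!: continuous_intros)

lemma Ck_mult: "Ck k f \<Longrightarrow> Ck k g \<Longrightarrow> Ck k (\<lambda>x. f x * g x)"
proof (induction k arbitrary: f g)
  case (Suc k)
  show ?case
  proof (rule Ck_SucI)
    show "((\<lambda>x. f x * g x) has_derivative (\<lambda>h. (f x *\<^sub>R grad g x + g x *\<^sub>R grad f x) \<bullet> h)) (at x)" for x
      using has_derivative_mult[OF Ck_has_derivative[OF Suc.prems(1)] Ck_has_derivative[OF Suc.prems(2)]]
      by (simp add: inner_add_left mult.commute)
    show "Ck k (\<lambda>x. (f x *\<^sub>R grad g x + g x *\<^sub>R grad f x) $ i)" for i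
      using Ck_add[OF Suc.IH[OF Ck_SucD[OF Suc.prems(1)] Ck_grad[OF Suc.prems(2)]]
          Suc.IH[OF Ck_SucD[OF Suc.prems(2)] Ck_grad[OF Suc.prems(1)]]] by simp
  qed
qed (auto intro!: continuous_intros)

lemma Ck_cmult: "Ck k f \<Longrightarrow> Ck k (\<lambda>x. c * f x)"
  by (intro Ck_mult Ck_const)

lemma Ck_prod: "(\<And>i. i \<in> I \<Longrightarrow> Ck k (f i)) \<Longrightarrow> Ck k (\<lambda>x. \<Prod>i\<in>I. f i x)"
  by (induction I rule: infinite_finite_induct) (auto intro!: Ck_const Ck_mult)

subsection \<open>Smooth bump functions\<close>

text \<open>The functions \<open>exp (- 1 / s) / s ^ m\<close>, continued by zero. The
  powers in the denominator make the family closed under differentiation up to linear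
  combinations, so that smoothness is a single induction (\<open>Ck_flat_comp\<close>).\<close>

definition flat :: "nat \<Rightarrow> real \<Rightarrow> real" where
  "flat m s = (if s > 0 then exp (- (1 / s)) / s ^ m else 0)"

lemma power_le_fact_exp:
  assumes "0 \<le> (t::real)" shows "t ^ n \<le> fact n * exp t"
proof -
  have "(\<Sum>k\<in>{n}. t ^ k /\<^sub>R fact k) \<le> exp t"
    unfolding exp_def using assms by (intro sum_le_suminf summable_exp_generic) auto
  then show ?thesis by (simp add: field_simps)
qed

text \<open>With \<open>t = 1 / s\<close> this is \<open>t ^ (m + 2) \<le> fact (m + 2) *
  exp t\<close>. The square on the right-hand side gives the derivative at zero.\<close>

lemma flat_le: "\<bar>flat m s\<bar> \<le> fact (m + 2) * s ^ 2"
proof (cases "s > 0")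
  case True
  define t where "t = 1 / s"
  have t: "t > 0" "s = 1 / t" using True by (auto simp: t_def)
  have "flat m s = t ^ (m + 2) * exp (- t) * s ^ 2"
    unfolding t(2) flat_def using t(1) by (simp add: power_divide power_add power2_eq_square field_simps)
  also have "\<dots> \<le> (fact (m + 2) * exp t) * exp (- t) * s ^ 2"
    using t by (intro mult_right_mono power_le_fact_exp) auto
  also have "\<dots> = fact (m + 2) * s ^ 2" by (simp add: exp_minus)
  finally show ?thesis using True by (simp add: flat_def)
qed (simp add: flat_def)

lemma DERIV_flat: "(flat m has_real_derivative (flat (m + 2) s - m * flat (m + 1) s)) (at s)"
proof -
  consider "s > 0" | "s = 0" | "s < 0" by linarith
  then show ?thesis
  proof cases
    case 1
    have "((\<lambda>s. exp (- (1 / s)) / s ^ m) has_real_derivative (flat (m + 2) s - m * flat (m + 1) s)) (at s)"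
    proof (cases m)
      case 0
      then show ?thesis using 1
        by (auto intro!: derivative_eq_intros simp: flat_def power2_eq_square field_simps)
    next
      case (Suc n)
      show ?thesis using 1 unfolding Suc
        by (auto intro!: derivative_eq_intros simp: flat_def power2_eq_square divide_simps)
          (cases n; simp add: algebra_simps)
    qed
    then show ?thesis
      by (rule has_field_derivative_transform_within_open[where S="{0<..}"]) (use 1 in \<open>auto simp: flat_def\<close>)
  next
    case 2
    have "((\<lambda>h. (flat m (0 + h) - flat m 0) / h) \<longlongrightarrow> 0) (at 0)"
    proof (rule Lim_null_comparison)
      show "\<forall>\<^sub>F h in at 0. norm ((flat m (0 + h) - flat m 0) / h) \<le> fact (m + 2) * \<bar>h\<bar>"
        unfolding eventually_at_filter
      proof (intro always_eventually allI impI)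
        fix h :: real assume h: "h \<noteq> 0"
        have "\<bar>flat m h\<bar> \<le> fact (m + 2) * \<bar>h\<bar> * \<bar>h\<bar>"
          using flat_le[of m h] by (simp add: power2_eq_square mult.assoc abs_mult[symmetric])
        then show "norm ((flat m (0 + h) - flat m 0) / h) \<le> fact (m + 2) * \<bar>h\<bar>"
          using h by (simp add: flat_def[of m 0] abs_divide divide_le_eq del: fact_Suc)
      qed
      have "((\<lambda>h::real. fact (m + 2) * \<bar>h\<bar>) \<longlongrightarrow> fact (m + 2) * \<bar>0\<bar>) (at 0)" by (intro tendsto_intros)
      then show "((\<lambda>h::real. fact (m + 2) * \<bar>h\<bar>) \<longlongrightarrow> 0) (at 0)" by simp
    qed
    then show ?thesis using 2 by (simp add: DERIV_def flat_def)
  next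
    case 3
    have "((\<lambda>s. 0) has_real_derivative 0) (at s)" by simp
    then have "(flat m has_real_derivative 0) (at s)"
      by (rule has_field_derivative_transform_within_open[where S="{..<0}"]) (use 3 in \<open>auto simp: flat_def\<close>)
    then show ?thesis using 3 by (simp add: flat_def)
  qed
qed

lemma continuous_on_flat: "continuous_on UNIV (flat m)"
  using DERIV_flat by (meson DERIV_isCont continuous_at_imp_continuous_on)

lemma Ck_flat_comp:
  assumes "\<And>k. Ck k g" shows "Ck k (\<lambda>x. flat m (g x))"
proof (induction k arbitrary: m)
  case 0
  have "continuous_on UNIV g" using assms[of 0] by simp
  then show ?case using continuous_on_compose2[OF continuous_on_flat] by auto
next
  case (Suc k)
  show ?case
  proof (rule Ck_SucI)
    show "((\<lambda>x. flat m (g x)) has_derivative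
        (\<lambda>h. ((flat (m + 2) (g x) + (- real m) * flat (m + 1) (g x)) *\<^sub>R grad g x) \<bullet> h)) (at x)" for x
      using has_derivative_compose[OF Ck_has_derivative[OF assms[of "Suc 0"]]
          DERIV_flat[THEN has_field_derivative_imp_has_derivative]] by simp
    show "Ck k (\<lambda>x. ((flat (m + 2) (g x) + (- real m) * flat (m + 1) (g x)) *\<^sub>R grad g x) $ i)" for i
    proof -
      have "Ck k (\<lambda>x. (flat (m + 2) (g x) + (- real m) * flat (m + 1) (g x)) * grad g x $ i)"
        by (intro Ck_mult Ck_add Ck_cmult Suc Ck_grad assms)
      then show ?thesis by simp
    qed
  qed
qed

text \<open>Smooth, positive exactly on \<open>box a b\<close>, and increasing to its
  indicator as \<open>j\<close> grows because \<open>exp (- 1 / (j s))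
  \<longlonglongrightarrow> 1\<close> for \<open>s > 0\<close>. The scaling by
  \<open>j\<close> replaces a normalisation.\<close>

definition bump :: "real \<Rightarrow> real^'n \<Rightarrow> real^'n \<Rightarrow> real^'n \<Rightarrow> real" where
  "bump j a b x = (\<Prod>i\<in>UNIV. flat 0 (j * (x $ i - a $ i)) * flat 0 (j * (b $ i - x $ i)))"

lemma flat_0_bounds: "0 \<le> flat 0 s" "flat 0 s \<le> 1"
  by (auto simp: flat_def)

lemma bump_bounds: "0 \<le> bump j a b x" "bump j a b x \<le> 1"
  unfolding bump_def by (auto intro!: prod_nonneg prod_le_1 mult_le_one simp: flat_0_bounds)

lemma bump_nonzero_iff:
  assumes "j > 0" shows "bump j a b x \<noteq> 0 \<longleftrightarrow> x \<in> box a b"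
  using assms by (auto simp: bump_def mem_box_cart flat_def zero_less_mult_iff)

lemma Ck_affine: "Ck k (\<lambda>x. c * x $ i + d)"
  by (intro Ck_add Ck_cmult Ck_nth Ck_const)

lemma Ck_bump: "Ck k (bump j a b)"
proof -
  have "Ck k (\<lambda>x. flat 0 (j * x $ i + (- j * a $ i)) * flat 0 ((- j) * x $ i + j * b $ i))" for i
    by (intro Ck_mult Ck_flat_comp Ck_affine)
  then have "Ck k (\<lambda>x. \<Prod>i\<in>UNIV. flat 0 (j * x $ i + (- j * a $ i)) * flat 0 ((- j) * x $ i + j * b $ i))"
    by (rule Ck_prod)
  then show ?thesis unfolding bump_def[abs_def] by (simp add: algebra_simps)
qed

lemma test_functionsI:
  assumes "\<And>k. Ck k \<phi>" "{x. \<phi> x \<noteq> 0} \<subseteq> K" "compact K" "K \<subseteq> \<Omega>"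
  shows "\<phi> \<in> test_functions \<Omega>"
proof -
  have "closure {x. \<phi> x \<noteq> 0} \<subseteq> K" using assms(2,3) by (simp add: closure_minimal compact_imp_closed)
  moreover from this have "compact (closure {x. \<phi> x \<noteq> 0})"
    using assms(3) compact_Int_closed[of K "closure {x. \<phi> x \<noteq> 0}"] by (simp add: Int_absorb1)
  ultimately show ?thesis using assms by (auto simp: test_functions_def)
qed

lemma test_functions_support:
  assumes "\<phi> \<in> test_functions \<Omega>"
  obtains K where "compact K" "K \<subseteq> \<Omega>" "{x. \<phi> x \<noteq> 0} \<subseteq> K"
  using that[of "closure {x. \<phi> x \<noteq> 0}"] assms closure_subset[of "{x. \<phi> x \<noteq> 0}"]
  unfolding test_functions_def by blast

lemma test_functions_Ck: "\<phi> \<in> test_functions \<Omega> \<Longrightarrow> Ck k \<phi>"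
  by (simp add: test_functions_def)

lemma test_functions_continuous: "\<phi> \<in> test_functions \<Omega> \<Longrightarrow> continuous_on A \<phi>"
  by (rule Ck_continuous[OF test_functions_Ck])

lemma test_functions_has_derivative:
  "\<phi> \<in> test_functions \<Omega> \<Longrightarrow> (\<phi> has_derivative (\<lambda>h. grad \<phi> x \<bullet> h)) (at x)"
  by (rule Ck_has_derivative[OF test_functions_Ck])

lemma test_functions_grad_continuous: "\<phi> \<in> test_functions \<Omega> \<Longrightarrow> continuous_on A (grad \<phi>)"
proof -
  assume "\<phi> \<in> test_functions \<Omega>"
  then have "continuous_on A (\<lambda>x. grad \<phi> x $ i)" for i
    by (intro Ck_continuous[OF Ck_grad[OF test_functions_Ck]])
  then have "continuous_on A (\<lambda>x. \<chi> i. grad \<phi> x $ i)" by (rule continuous_on_vec_lambda)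
  then show ?thesis by simp
qed

lemma test_functions_grad_support:
  assumes \<phi>: "\<phi> \<in> test_functions \<Omega>"
  obtains K where "compact K" "K \<subseteq> \<Omega>" "{x. \<phi> x \<noteq> 0} \<subseteq> K" "{x. grad \<phi> x \<noteq> 0} \<subseteq> K"
proof -
  obtain K where K: "compact K" "K \<subseteq> \<Omega>" "{x. \<phi> x \<noteq> 0} \<subseteq> K" using test_functions_support[OF \<phi>] .
  have "grad \<phi> x = 0" if "x \<notin> K" for x
  proof (rule grad_eqI)
    have "((\<lambda>x. 0) has_derivative (\<lambda>h. 0 \<bullet> h)) (at x)" by simp
    then show "(\<phi> has_derivative (\<lambda>h. 0 \<bullet> h)) (at x)"
      by (rule has_derivative_transform_within_open[OF _ open_Compl[OF compact_imp_closed[OF K(1)]]])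
        (use K that in auto)
  qed
  then show ?thesis using that[OF K] by auto
qed

lemma test_functions_add:
  assumes "\<phi> \<in> test_functions \<Omega>" "\<psi> \<in> test_functions \<Omega>"
  shows "(\<lambda>x. \<phi> x + \<psi> x) \<in> test_functions \<Omega>"
proof -
  obtain K where K: "compact K" "K \<subseteq> \<Omega>" "{x. \<phi> x \<noteq> 0} \<subseteq> K" using test_functions_support[OF assms(1)] .
  obtain L where L: "compact L" "L \<subseteq> \<Omega>" "{x. \<psi> x \<noteq> 0} \<subseteq> L" using test_functions_support[OF assms(2)] .
  show ?thesis
    proof (rule test_functionsI[of _ "K \<union> L"])
    show "Ck k (\<lambda>x. \<phi> x + \<psi> x)" for k
      by (intro Ck_add test_functions_Ck[OF assms(1)] test_functions_Ck[OF assms(2)])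
    have "\<phi> x = 0 \<and> \<psi> x = 0" if "x \<notin> K \<union> L" for x using that K(3) L(3) by blast
    then show "{x. \<phi> x + \<psi> x \<noteq> 0} \<subseteq> K \<union> L" by fastforce
  qed (use K L in auto)
qed

lemma test_functions_cmult:
  assumes "\<phi> \<in> test_functions \<Omega>" shows "(\<lambda>x. c * \<phi> x) \<in> test_functions \<Omega>"
proof -
  obtain K where K: "compact K" "K \<subseteq> \<Omega>" "{x. \<phi> x \<noteq> 0} \<subseteq> K" using test_functions_support[OF assms] .
  show ?thesis
    by (rule test_functionsI[of _ K]) (use K in \<open>auto intro!: Ck_cmult test_functions_Ck[OF assms]\<close>)
qed

lemma zero_test_function: "(\<lambda>x. 0) \<in> test_functions \<Omega>"
  by (rule test_functionsI[of _ "{}"]) (auto intro: Ck_const)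

lemma bump_test_function:
  assumes "j > 0" "cbox a b \<subseteq> \<Omega>" shows "bump j a b \<in> test_functions \<Omega>"
  by (rule test_functionsI[of _ "cbox a b"])
    (use assms in \<open>auto intro: Ck_bump subsetD[OF box_subset_cbox] simp: bump_nonzero_iff\<close>)

lemma bump_tendsto_indicator:
  fixes x :: "real^'n"
  shows "(\<lambda>j. bump (real (Suc j)) a b x) \<longlonglongrightarrow> indicator (box a b) x"
proof (cases "x \<in> box a b")
  case True
  have lim: "(\<lambda>j. flat 0 (real (Suc j) * s)) \<longlonglongrightarrow> 1" if "s > 0" for s
  proof -
    have "(\<lambda>j. 1 / real (Suc j) * (1 / s)) \<longlonglongrightarrow> 0 * (1 / s)"
      by (intro tendsto_intros LIMSEQ_Suc lim_1_over_n)
    then have "(\<lambda>j. exp (- (1 / real (Suc j) * (1 / s)))) \<longlonglongrightarrow> exp (- 0)"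
      by (intro tendsto_intros) simp
    then show ?thesis using that by (simp add: flat_def del: of_nat_Suc)
  qed
  have "(\<lambda>j. bump (real (Suc j)) a b x) \<longlonglongrightarrow> (\<Prod>i\<in>(UNIV::'n set). 1 * 1)"
    unfolding bump_def by (intro tendsto_prod tendsto_mult lim) (use True in \<open>auto simp: mem_box_cart\<close>)
  then show ?thesis using True by simp
next
  case False
  then have "bump (real (Suc j)) a b x = 0" for j using bump_nonzero_iff[of "real (Suc j)" a b x] by simp
  then show ?thesis using False by simp
qed

subsection \<open>Test functions determine a measure\<close>

lemma open_countable_Union_boxes:
  fixes S :: "'a::euclidean_space set"
  assumes S: "open S"
  obtains F where "F \<subseteq> {box a b | a b. cbox a b \<subseteq> S}" "countable F" "\<Union>F = S"
proof -
  let ?F = "{box a b | a b. cbox a b \<subseteq> S}"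
  have op: "open X" if "X \<in> ?F" for X using that by (auto simp: open_box)
  obtain F where F: "F \<subseteq> ?F" "countable F" "\<Union>F = \<Union>?F" by (rule Lindelof[of ?F, OF op])
  have "\<Union>?F = S"
  proof
    show "\<Union>?F \<subseteq> S"
    proof (rule Union_least)
      fix X assume "X \<in> ?F"
      then obtain a b where "X = box a b" "cbox a b \<subseteq> S" by blast
      then show "X \<subseteq> S" using box_subset_cbox[of a b] by blast
    qed
    show "S \<subseteq> \<Union>?F"
    proof
      fix x assume "x \<in> S"
      then obtain a b where "cbox a b \<subseteq> S" "x \<in> box a b"
        by (rule open_contains_cbox[OF S])
      then show "x \<in> \<Union>?F" by blast
    qed
  qed
  then show ?thesis using that F by simp
qed

lemma borel_subsets_eq_sigma_boxes:
  fixes \<Omega> :: "'a::euclidean_space set"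
  assumes \<Omega>: "open \<Omega>"
  shows "borel_subsets \<Omega> = sigma_sets \<Omega> {box a b | a b. cbox a b \<subseteq> \<Omega>}"
proof
  let ?E = "{box a b | a b. cbox a b \<subseteq> \<Omega>}"
  have sub: "?E \<subseteq> borel_subsets \<Omega>"
    using \<Omega> box_subset_cbox by (fastforce simp: sets_restrict_space_iff)
  interpret sigma_algebra \<Omega> "borel_subsets \<Omega>"
    using sets.sigma_algebra_axioms[of "restrict_space borel \<Omega>"] by (simp add: space_restrict_space)
  show "sigma_sets \<Omega> ?E \<subseteq> borel_subsets \<Omega>" by (rule sigma_sets_subset[OF sub])
  have "borel_subsets \<Omega> = sigma_sets \<Omega> ((\<inter>) \<Omega> ` {S. open S})"
    unfolding sets_restrict_space sets_borel by (rule sigma_sets_Int) (use \<Omega> in auto)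
  also have "\<dots> \<subseteq> sigma_sets \<Omega> ?E"
  proof (rule sigma_sets_mono, safe)
    fix S :: "'a set" assume S: "open S"
    let ?F = "{box a b | a b. cbox a b \<subseteq> \<Omega> \<inter> S}"
    have "open (\<Omega> \<inter> S)" using \<Omega> S by blast
    then obtain F where F: "F \<subseteq> ?F" "countable F" "\<Union>F = \<Omega> \<inter> S" by (rule open_countable_Union_boxes)
    have "F \<subseteq> ?E" using F(1) by blast
    then have "\<Union>F \<in> sigma_sets \<Omega> ?E"
      using F(2) by (intro sigma_sets_UNION) (blast intro: sigma_sets.Basic)+
    then show "\<Omega> \<inter> S \<in> sigma_sets \<Omega> ?E" using F(3) by simp
  qed
  finally show "borel_subsets \<Omega> \<subseteq> sigma_sets \<Omega> ?E" .
qed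

text \<open>Bump functions increase to the indicators of the open boxes whose closure lies
  in \<open>\<Omega>\<close>, and these boxes are an intersection-stable generator.\<close>

lemma measure_eqI_test_functions:
  fixes P N :: "(real^'n) measure"
  assumes \<Omega>: "open \<Omega>" and sets: "sets P = borel_subsets \<Omega>" "sets N = borel_subsets \<Omega>"
    and fin: "\<And>a b. cbox a b \<subseteq> \<Omega> \<Longrightarrow> emeasure P (cbox a b) < \<infinity>" "\<And>a b. cbox a b \<subseteq> \<Omega> \<Longrightarrow> emeasure N (cbox a b) < \<infinity>"
    and eq: "\<And>\<phi>. \<phi> \<in> test_functions \<Omega> \<Longrightarrow> integral\<^sup>L P \<phi> = integral\<^sup>L N \<phi>"
  shows "P = N"
proof -
  let ?E = "{box a b | a b. cbox a b \<subseteq> \<Omega>}"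
  have cbox_sets: "cbox a b \<in> borel_subsets \<Omega>" "box a b \<in> borel_subsets \<Omega>" if "cbox a b \<subseteq> \<Omega>" for a b :: "real^'n"
    using that \<Omega> box_subset_cbox[of a b] by (auto simp: sets_restrict_space_iff)
  have fin_box: "emeasure M (box a b) < \<infinity>"
    if "emeasure M (cbox a b) < \<infinity>" "sets M = borel_subsets \<Omega>" "cbox a b \<subseteq> \<Omega>" for M and a b :: "real^'n"
    using cbox_sets[OF that(3)] that(2)
    by (intro le_less_trans[OF emeasure_mono[OF box_subset_cbox] that(1)]) simp
  have lim: "(\<lambda>j. integral\<^sup>L M (bump (real (Suc j)) a b)) \<longlonglongrightarrow> measure M (box a b)"
    if "cbox a b \<subseteq> \<Omega>" "sets M = borel_subsets \<Omega>" "emeasure M (cbox a b) < \<infinity>" for M and a b :: "real^'n"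
  proof -
    have box: "box a b \<in> sets M" using cbox_sets that by simp
    have meas: "bump j a b \<in> borel_measurable M" for j
    proof -
      have "bump j a b \<in> borel_measurable (restrict_space borel \<Omega>)"
        by (intro measurable_restrict_space1 borel_measurable_continuous_onI Ck_continuous[OF Ck_bump])
      then show ?thesis by (subst measurable_cong_sets[OF that(2) refl])
    qed
    have "(\<lambda>j. integral\<^sup>L M (bump (real (Suc j)) a b)) \<longlonglongrightarrow> (\<integral>x. indicator (box a b) x \<partial>M)"
    proof (rule integral_dominated_convergence[where w="indicator (box a b)"])
      show "integrable M (indicator (box a b) :: _ \<Rightarrow> real)"
        using box fin_box[OF that(3,2,1)] by (simp add: integrable_real_indicator)
      show "AE x in M. norm (bump (real (Suc i)) a b x) \<le> indicator (box a b) x" for i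
      proof (intro AE_I2)
        fix x
        have "bump (real (Suc i)) a b x = 0" if "x \<notin> box a b"
          using that bump_nonzero_iff[of "real (Suc i)" a b x] by auto
        then show "norm (bump (real (Suc i)) a b x) \<le> indicator (box a b) x"
          using bump_bounds[of "real (Suc i)" a b x] by (auto simp: indicator_def)
      qed
      show "AE x in M. (\<lambda>j. bump (real (Suc j)) a b x) \<longlonglongrightarrow> indicator (box a b) x"
        by (intro AE_I2 bump_tendsto_indicator)
    qed (use meas box in auto)
    then show ?thesis using box sets.sets_into_space[OF box] by (simp add: Int_absorb1)
  qed
  have emeasure_eq: "emeasure P (box a b) = emeasure N (box a b)" if "cbox a b \<subseteq> \<Omega>" for a b
  proof -
    have "measure P (box a b) = measure N (box a b)"
      using lim[OF that sets(1) fin(1)[OF that]] lim[OF that sets(2) fin(2)[OF that]]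
        eq[OF bump_test_function[OF _ that]] by (simp add: LIMSEQ_unique del: of_nat_Suc)
    then show ?thesis
      using fin_box[OF fin(1)[OF that] sets(1) that] fin_box[OF fin(2)[OF that] sets(2) that]
      by (simp add: emeasure_eq_ennreal_measure less_top[symmetric])
  qed
  obtain F where F: "F \<subseteq> ?E" "countable F" "\<Union>F = \<Omega>" by (rule open_countable_Union_boxes[OF \<Omega>])
  show ?thesis
  proof (rule measure_eqI_generator_eq_countable)
    show "Int_stable ?E"
    proof (rule Int_stableI, safe)
      fix a b c d :: "real^'n" assume "cbox a b \<subseteq> \<Omega>" "cbox c d \<subseteq> \<Omega>"
      then show "\<exists>a' b'. box a b \<inter> box c d = box a' b' \<and> cbox a' b' \<subseteq> \<Omega>"
        unfolding box_Int_box using Int_interval[of a b c d] by blast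
    qed
    show "?E \<subseteq> Pow \<Omega>" using box_subset_cbox by blast
    show "sets P = sigma_sets \<Omega> ?E" "sets N = sigma_sets \<Omega> ?E"
      using sets borel_subsets_eq_sigma_boxes[OF \<Omega>] by auto
    show "emeasure P X = emeasure N X" if "X \<in> ?E" for X using that emeasure_eq by auto
    show "F \<subseteq> ?E" "countable F" "\<Union>F = \<Omega>" by (rule F)+
    show "emeasure P X \<noteq> \<infinity>" if "X \<in> F" for X
      using that F(1) fin_box[OF fin(1) sets(1)] by fastforce
  qed
qed

section \<open>Rademacher's theorem\<close>

subsection \<open>Lipschitz functions of one variable\<close>

text \<open>Adding a linear function, \<open>F = f + (L + 1) t\<close> is a bi-Lipschitz
  bijection of the line. The measure \<open>A \<mapsto> |F(A)|\<close> is absolutely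
  continuous because Lipschitz maps preserve null sets, so it has a density
  \<open>g\<close>, and \<open>F y - F x\<close> is the integral of \<open>g\<close> over
  \<open>{x..y}\<close>. Lebesgue's differentiation theorem then gives the limit of the
  quotients.\<close>

lemma Lipschitz_AE_right_difference_quotients:
  fixes f :: "real \<Rightarrow> real"
  assumes L: "L-lipschitz_on UNIV f"
  shows "AE t in lborel. convergent (\<lambda>k. real (Suc k) * (f (t + 1 / real (Suc k)) - f t))"
proof -
  have L0: "0 \<le> L" using L by (rule lipschitz_on_nonneg)
  define F where "F t = f t + (L + 1) * t" for t
  have lip: "\<bar>f x - f y\<bar> \<le> L * \<bar>x - y\<bar>" for x y
    using lipschitz_onD[OF L, of x y] by (simp add: dist_real_def)
  have F_lower: "y - x \<le> F y - F x" if "x \<le> y" for x y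
    using lip[of x y] that by (simp add: F_def abs_le_iff algebra_simps)
  have F_upper: "\<bar>F y - F x\<bar> \<le> (2 * L + 1) * \<bar>y - x\<bar>" for x y
  proof -
    have "\<bar>F y - F x\<bar> \<le> \<bar>f y - f x\<bar> + \<bar>(L + 1) * (y - x)\<bar>" by (simp add: F_def algebra_simps)
    also have "\<dots> \<le> L * \<bar>y - x\<bar> + (L + 1) * \<bar>y - x\<bar>" using lip[of y x] L0 by (simp add: abs_mult)
    finally show ?thesis by (simp add: algebra_simps)
  qed
  have F_mono: "F x \<le> F y \<longleftrightarrow> x \<le> y" for x y
    using F_lower[of x y] F_lower[of y x] by linarith
  have F_inj: "inj F" 
  proof (rule injI)
    fix x y assume "F x = F y"
    then show "x = y" using F_mono[of x y] F_mono[of y x] by simp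
  qed
  have F_cont: "continuous_on UNIV F"
    unfolding F_def by (intro continuous_intros lipschitz_on_continuous_on[OF L])
  have F_surj: "surj F"
  proof
    have "\<exists>x. F x = y" for y
    proof -
      define m where "m = \<bar>y - F 0\<bar>"
      have "F (- m) \<le> y" "y \<le> F m"
        using F_lower[of "- m" 0] F_lower[of 0 m] by (auto simp: m_def)
      then have "\<exists>x. - m \<le> x \<and> x \<le> m \<and> F x = y"
        by (intro IVT') (auto simp: m_def intro: continuous_on_subset[OF F_cont])
      then show ?thesis by blast
    qed
    then show "UNIV \<subseteq> range F" by (metis rangeI subsetI)
  qed simp
  define G where "G = inv F"
  have FG: "F (G y) = y" for y unfolding G_def by (rule surj_f_inv_f[OF F_surj])
  have GF: "G (F x) = x" for x unfolding G_def by (rule inv_f_f[OF F_inj])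
  have "1-lipschitz_on UNIV G"
  proof (rule lipschitz_onI)
    fix y z
    show "dist (G y) (G z) \<le> 1 * dist y z"
      using F_lower[of "G y" "G z"] F_lower[of "G z" "G y"] linear[of "G y" "G z"]
      by (auto simp: FG dist_real_def)
  qed simp
  then have "continuous_on UNIV G" by (rule lipschitz_on_continuous_on)
  then have G_meas [measurable]: "G \<in> borel_measurable borel" by (rule borel_measurable_continuous_onI)
  have vimage: "G -` A = F ` A" for A
  proof
    show "F ` A \<subseteq> G -` A" by (auto simp: GF)
    show "G -` A \<subseteq> F ` A"
    proof
      fix y assume "y \<in> G -` A"
      then show "y \<in> F ` A" using FG[of y] by (metis imageI vimage_eq)
    qed
  qed
  define \<nu> where "\<nu> = distr lborel borel G"
  have sets_\<nu>: "sets \<nu> = sets lborel" by (simp add: \<nu>_def)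
  have \<nu>_eq: "emeasure \<nu> A = emeasure lborel (F ` A)" if "A \<in> sets borel" for A
    using that by (simp add: \<nu>_def emeasure_distr vimage)
  have \<nu>_Icc: "emeasure \<nu> {x..y} = ennreal (F y - F x)" if "x \<le> y" for x y
  proof -
    have "F ` {x..y} = {F x..F y}"
    proof
      show "{F x..F y} \<subseteq> F ` {x..y}"
      proof
        fix z assume "z \<in> {F x..F y}"
        then have "F x \<le> F (G z)" "F (G z) \<le> F y" by (simp_all add: FG)
        then have "G z \<in> {x..y}" by (simp add: F_mono)
        then show "z \<in> F ` {x..y}" using FG[of z] by (metis imageI)
      qed
    qed (auto simp: F_mono)
    then show ?thesis using \<nu>_eq[of "{x..y}"] that by (simp add: F_mono)
  qed
  (* the image of a null set under the Lipschitz map F is a null set *)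
  have ac: "absolutely_continuous lborel \<nu>"
    unfolding absolutely_continuous_def
  proof
    fix A :: "real set" assume A: "A \<in> null_sets lborel"
    then have Ab: "A \<in> sets borel" by (simp add: null_sets_def)
    have "negligible A"
      using A by (simp add: negligible_iff_null_sets null_sets_completionI)
    then have "negligible (F ` A)"
    proof (rule negligible_locally_Lipschitz_image[rotated])
      show "\<exists>T B. open T \<and> x \<in> T \<and> (\<forall>y\<in>A \<inter> T. norm (F y - F x) \<le> B * norm (y - x))" for x
        using F_upper by (intro exI[of _ UNIV] exI[of _ "2 * L + 1"]) auto
    qed simp
    moreover have "F ` A \<in> sets borel"
      using measurable_sets[OF G_meas Ab] by (simp add: vimage)
    ultimately have "emeasure lborel (F ` A) = 0"
      by (simp add: negligible_iff_null_sets null_sets_def)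
    then show "A \<in> null_sets \<nu>" using \<nu>_eq[OF Ab] Ab by (simp add: null_sets_def sets_\<nu>)
  qed
  obtain p where p [measurable]: "p \<in> borel_measurable lborel" and dens: "density lborel p = \<nu>"
    using sigma_finite_measure.Radon_Nikodym[OF sigma_finite_lborel ac sets_\<nu>] by blast
  have p_Icc: "(\<integral>\<^sup>+t. p t * indicator {x..y} t \<partial>lborel) = ennreal (F y - F x)" if "x \<le> y" for x y
    using \<nu>_Icc[OF that] emeasure_density[OF p, of "{x..y}"] by (simp add: dens)
  have p_fin: "AE t in lborel. p t \<noteq> \<infinity>"
  proof -
    have "AE t in lborel. p t * indicator {- real n..real n} t \<noteq> \<infinity>" for n
      by (rule nn_integral_PInf_AE) (use p_Icc[of "- real n" "real n"] in auto)
    then have "AE t in lborel. \<forall>n. p t * indicator {- real n..real n} t \<noteq> \<infinity>"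
      by (simp add: AE_all_countable)
    then show ?thesis
    proof (rule AE_mp, intro AE_I2 impI)
      fix t assume *: "\<forall>n. p t * indicator {- real n..real n} t \<noteq> \<infinity>"
      obtain n :: nat where "\<bar>t\<bar> \<le> n" using real_arch_simple by blast
      then have "t \<in> {- real n..real n}" by auto
      then show "p t \<noteq> \<infinity>" using *[rule_format, of n] by simp
    qed
  qed
  define g where "g t = enn2real (p t)" for t
  have g_meas [measurable]: "g \<in> borel_measurable lborel" unfolding g_def by measurable
  have g_int: "set_integrable lborel {x..y} g \<and> integral {x..y} g = F y - F x" if "x \<le> y" for x y
  proof -
    have nn: "(\<integral>\<^sup>+t. ennreal (indicator {x..y} t * g t) \<partial>lborel) = ennreal (F y - F x)"
      unfolding p_Icc[OF that, symmetric]
    proof (rule nn_integral_cong_AE, rule AE_mp[OF p_fin], intro AE_I2 impI)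
      fix t assume "p t \<noteq> \<infinity>"
      then show "ennreal (indicator {x..y} t * g t) = p t * indicator {x..y} t"
        by (auto simp: g_def indicator_def ennreal_enn2real less_top)
    qed
    have "integrable lborel (\<lambda>t. indicator {x..y} t * g t)"
      using nn by (intro integrableI_nonneg) (auto simp: g_def)
    then have int: "set_integrable lborel {x..y} g" by (simp add: set_integrable_def)
    have "(\<integral>t. indicator {x..y} t * g t \<partial>lborel) = F y - F x"
      using nn F_mono[of x y] that by (subst integral_eq_nn_integral) (auto simp: g_def)
    then have "integral {x..y} g = F y - F x"
      using set_borel_integral_eq_integral(2)[OF int] by (simp add: set_lebesgue_integral_def)
    then show ?thesis using int by simp
  qed
  have "g integrable_on cbox x y" for x y :: real
    using g_int[of x y] set_borel_integral_eq_integral(1) by (cases "x \<le> y") auto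
  then obtain N where N: "negligible N" and deriv: "\<And>x e. x \<notin> N \<Longrightarrow> 0 < e \<Longrightarrow>
      \<exists>d>0. \<forall>h. 0 < h \<and> h < d \<longrightarrow> norm (integral (cbox x (x + h *\<^sub>R One)) g /\<^sub>R h ^ DIM(real) - g x) < e"
    using integrable_ccontinuous_explicit[of g] by metis
  have conv: "convergent (\<lambda>k. real (Suc k) * (f (x + 1 / real (Suc k)) - f x))" if x: "x \<notin> N" for x
  proof -
    have "(\<lambda>k. real (Suc k) * (F (x + 1 / real (Suc k)) - F x)) \<longlonglongrightarrow> g x"
    proof (rule LIMSEQ_I)
      fix e :: real assume "0 < e"
      then obtain d where d: "d > 0" and *: "\<And>h. 0 < h \<and> h < d \<Longrightarrow> norm (integral {x..x + h} g / h - g x) < e"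
        using deriv[OF x, of e] by (auto simp: divide_inverse mult.commute)
      obtain k0 where k0: "1 / real (Suc k0) < d" using d nat_approx_posE by metis
      show "\<exists>k0. \<forall>k\<ge>k0. norm (real (Suc k) * (F (x + 1 / real (Suc k)) - F x) - g x) < e"
      proof (intro exI allI impI)
        fix k assume "k \<ge> k0"
        then have "1 / real (Suc k) \<le> 1 / real (Suc k0)" by (simp add: field_simps)
        then have h: "0 < 1 / real (Suc k) \<and> 1 / real (Suc k) < d" using k0 by simp
        have "integral {x..x + 1 / real (Suc k)} g = F (x + 1 / real (Suc k)) - F x"
          using g_int[of x "x + 1 / real (Suc k)"] h by simp
        then show "norm (real (Suc k) * (F (x + 1 / real (Suc k)) - F x) - g x) < e"
          using *[OF h] by (simp add: mult.commute)
      qed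
    qed
    then have "(\<lambda>k. real (Suc k) * (F (x + 1 / real (Suc k)) - F x) - (L + 1)) \<longlonglongrightarrow> g x - (L + 1)"
      by (intro tendsto_intros)
    moreover have "real (Suc k) * (F (x + 1 / real (Suc k)) - F x) - (L + 1)
        = real (Suc k) * (f (x + 1 / real (Suc k)) - f x)" for k
      by (simp add: F_def field_simps)
    ultimately show ?thesis by (auto simp: convergent_def)
  qed
  have "AE x in lebesgue. x \<notin> N" using N by (intro AE_not_in) (simp add: negligible_iff_null_sets)
  then have "AE x in lebesgue. convergent (\<lambda>k. real (Suc k) * (f (x + 1 / real (Suc k)) - f x))"
    by (rule AE_mp) (use conv in auto)
  then show ?thesis by (simp add: AE_completion_iff)
qed

subsection \<open>Directional difference quotients\<close>

text \<open>One-sided quotients along the sequence of step sizes \<open>1 / (k + 1)\<close>.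
  The limit of a sequence is measurable in \<open>x\<close>, and for Lipschitz functions
  these quotients in a dense set of directions decide differentiability
  (\<open>differentiable_if_dense_directional\<close>).\<close>

definition quot :: "('a::real_vector \<Rightarrow> real) \<Rightarrow> 'a \<Rightarrow> nat \<Rightarrow> 'a \<Rightarrow> real" where
  "quot f e k x = real (Suc k) * (f (x + (1 / real (Suc k)) *\<^sub>R e) - f x)"

definition dirderiv :: "('a::real_vector \<Rightarrow> real) \<Rightarrow> 'a \<Rightarrow> 'a \<Rightarrow> real" where
  "dirderiv f e x = lim (\<lambda>k. quot f e k x)"

lemma quot_bound:
  fixes f :: "'a::real_normed_vector \<Rightarrow> real"
  assumes "L-lipschitz_on UNIV f" shows "\<bar>quot f e k x\<bar> \<le> L * norm e"
proof -
  have "\<bar>f (x + (1 / real (Suc k)) *\<^sub>R e) - f x\<bar> \<le> L * ((1 / real (Suc k)) * norm e)"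
    using lipschitz_onD[OF assms, of "x + (1 / real (Suc k)) *\<^sub>R e" x]
    by (simp add: dist_real_def dist_norm)
  then have "real (Suc k) * \<bar>f (x + (1 / real (Suc k)) *\<^sub>R e) - f x\<bar> \<le> L * norm e"
    by (simp add: field_simps)
  then show ?thesis by (simp add: quot_def abs_mult)
qed

lemma quot_measurable:
  fixes f :: "'a::euclidean_space \<Rightarrow> real"
  assumes "continuous_on UNIV f" shows "quot f e k \<in> borel_measurable borel"
proof -
  have "continuous_on UNIV (\<lambda>x. f (x + (1 / real (Suc k)) *\<^sub>R e))"
    by (rule continuous_on_compose2[OF assms]) (auto intro!: continuous_intros)
  then show ?thesis unfolding quot_def[abs_def]
    by (intro borel_measurable_continuous_onI continuous_intros assms)
qed

text \<open>The exceptional set \<open>E\<close> meets every line in direction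
  \<open>e\<close> in a null set. Integrating the indicator of \<open>E\<close> at \<open>x
  + t e\<close> over \<open>x\<close> and \<open>t \<in> {0..1}\<close>, first in
  \<open>t\<close> and then in \<open>x\<close>, gives zero; in the other order, translation
  invariance gives the measure of \<open>E\<close>. No rotation of coordinates is involved.\<close>

lemma Lipschitz_AE_convergent_quot:
  fixes f :: "'a::euclidean_space \<Rightarrow> real"
  assumes L: "L-lipschitz_on UNIV f"
  shows "AE x in lborel. convergent (\<lambda>k. quot f e k x)"
proof -
  have cont: "continuous_on UNIV f" by (rule lipschitz_on_continuous_on[OF L])
  note quot_measurable[OF cont, measurable]
  define E where "E = {x. \<not> Cauchy (\<lambda>k. quot f e k x)}"
  have E [measurable]: "E \<in> sets borel"
  proof -
    have "{x \<in> space borel. Cauchy (\<lambda>k. quot f e k x)} \<in> sets borel" by measurable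
    then have "space borel - {x \<in> space borel. Cauchy (\<lambda>k. quot f e k x)} \<in> sets borel" by (rule sets.compl_sets)
    then show ?thesis by (simp add: E_def Diff_eq Collect_neg_eq)
  qed
  let ?g = "\<lambda>(t::real, x). indicator {0..1} t * indicator E (x + t *\<^sub>R e) :: ennreal"
  have meas: "?g \<in> borel_measurable (lborel \<Otimes>\<^sub>M lborel)" by measurable
  have line: "(\<integral>\<^sup>+t. ?g (t, x) \<partial>lborel) = 0" for x
  proof -
    have "(L * norm e)-lipschitz_on UNIV (\<lambda>t. f (x + t *\<^sub>R e))"
    proof (rule lipschitz_onI)
      fix s t :: real
      have "dist (f (x + s *\<^sub>R e)) (f (x + t *\<^sub>R e)) \<le> L * dist (x + s *\<^sub>R e) (x + t *\<^sub>R e)"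
        by (rule lipschitz_onD[OF L]) auto
      also have "dist (x + s *\<^sub>R e) (x + t *\<^sub>R e) = norm e * dist s t"
        by (simp add: dist_norm scaleR_diff_left[symmetric] dist_real_def)
      finally show "dist (f (x + s *\<^sub>R e)) (f (x + t *\<^sub>R e)) \<le> L * norm e * dist s t"
        by (simp add: mult.assoc)
    qed (use lipschitz_on_nonneg[OF L] in simp)
    from Lipschitz_AE_right_difference_quotients[OF this]
    have "AE t in lborel. x + t *\<^sub>R e \<notin> E"
      by (rule AE_mp) (auto simp: E_def quot_def Cauchy_convergent_iff algebra_simps)
    then have "AE t in lborel. ?g (t, x) = 0"
      by (rule AE_mp) auto
    then show ?thesis by (subst nn_integral_0_iff_AE) auto
  qed
  have translate: "(\<integral>\<^sup>+x. indicator E (x + t *\<^sub>R e) \<partial>lborel) = emeasure lborel E" for t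
  proof -
    have "(\<integral>\<^sup>+x. indicator E x \<partial>lborel) = (\<integral>\<^sup>+x. indicator E x \<partial>(distr lborel borel ((+) (t *\<^sub>R e))))"
      by (simp add: lborel_distr_plus)
    also have "\<dots> = (\<integral>\<^sup>+x. indicator E (x + t *\<^sub>R e) \<partial>lborel)"
      by (subst nn_integral_distr) (auto simp: add.commute)
    finally show ?thesis by simp
  qed
  have "0 = (\<integral>\<^sup>+x. (\<integral>\<^sup>+t. ?g (t, x) \<partial>lborel) \<partial>(lborel :: 'a measure))" using line by simp
  also have "\<dots> = (\<integral>\<^sup>+t. (\<integral>\<^sup>+x. ?g (t, x) \<partial>(lborel :: 'a measure)) \<partial>lborel)"
    using lborel_pair.Fubini'[OF meas] by simp
  also have "\<dots> = (\<integral>\<^sup>+t. indicator {0..1::real} t * emeasure lborel E \<partial>lborel)"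
    using translate by (simp add: nn_integral_cmult)
  also have "\<dots> = emeasure lborel E" by (simp add: nn_integral_multc)
  finally have "E \<in> null_sets lborel" by (simp add: null_sets_def)
  then have "AE x in lborel. x \<notin> E" by (rule AE_not_in)
  then show ?thesis by (rule AE_mp) (auto simp: E_def Cauchy_convergent_iff)
qed

lemma test_functions_bounded:
  assumes \<phi>: "\<phi> \<in> test_functions \<Omega>"
  obtains B R where "\<And>x. \<bar>\<phi> x\<bar> \<le> B" "\<And>x. norm (grad \<phi> x) \<le> B" "0 \<le> B" "0 \<le> R"
    "\<And>x. norm x > R \<Longrightarrow> \<phi> x = 0" "\<And>x. norm x > R \<Longrightarrow> grad \<phi> x = 0"
proof -
  obtain K where K: "compact K" "K \<subseteq> \<Omega>" "{x. \<phi> x \<noteq> 0} \<subseteq> K" "{x. grad \<phi> x \<noteq> 0} \<subseteq> K"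
    by (rule test_functions_grad_support[OF \<phi>])
  have "bounded (\<phi> ` K)" "bounded (grad \<phi> ` K)"
    using K(1) test_functions_continuous[OF \<phi>] test_functions_grad_continuous[OF \<phi>]
    by (auto intro!: compact_imp_bounded compact_continuous_image)
  then obtain B1 B2 where B: "\<And>x. x \<in> K \<Longrightarrow> norm (\<phi> x) \<le> B1" "\<And>x. x \<in> K \<Longrightarrow> norm (grad \<phi> x) \<le> B2"
    by (auto simp: bounded_iff)
  obtain R where R: "\<And>x. x \<in> K \<Longrightarrow> norm x \<le> R" using compact_imp_bounded[OF K(1)] by (auto simp: bounded_iff)
  show ?thesis
  proof (rule that[of "max 0 (max B1 B2)" "max 0 R"])
    show "\<bar>\<phi> x\<bar> \<le> max 0 (max B1 B2)" for x
    proof (cases "x \<in> K")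
      case False
      then have "\<phi> x = 0" using K(3) by blast
      then show ?thesis by simp
    qed (use B(1)[of x] in auto)
    show "norm (grad \<phi> x) \<le> max 0 (max B1 B2)" for x
    proof (cases "x \<in> K")
      case False
      then have "grad \<phi> x = 0" using K(4) by blast
      then show ?thesis by simp
    qed (use B(2)[of x] in auto)
    show "\<phi> x = 0" if "norm x > max 0 R" for x using that R[of x] K(3) by force
    show "grad \<phi> x = 0" if "norm x > max 0 R" for x using that R[of x] K(4) by force
  qed auto
qed

lemma test_functions_Lipschitz:
  assumes \<phi>: "\<phi> \<in> test_functions \<Omega>" and B: "\<And>x. norm (grad \<phi> x) \<le> B"
  shows "\<bar>\<phi> x - \<phi> y\<bar> \<le> B * norm (x - y)"
proof -
  have "norm (\<phi> x - \<phi> y) \<le> B * norm (x - y)"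
  proof (rule differentiable_bound[where S=UNIV and f'="\<lambda>x h. grad \<phi> x \<bullet> h"])
    fix x
    show "(\<phi> has_derivative (\<lambda>h. grad \<phi> x \<bullet> h)) (at x within UNIV)"
      using test_functions_has_derivative[OF \<phi>] by simp
    show "onorm (\<lambda>h. grad \<phi> x \<bullet> h) \<le> B"
    proof (rule onorm_le)
      fix h
      have "norm (grad \<phi> x \<bullet> h) \<le> norm (grad \<phi> x) * norm h" by (rule Cauchy_Schwarz_ineq2[folded real_norm_def])
      also have "\<dots> \<le> B * norm h" by (intro mult_right_mono B) simp
      finally show "norm (grad \<phi> x \<bullet> h) \<le> B * norm h" .
    qed
  qed auto
  then show ?thesis by simp
qed

subsection \<open>Integration by parts\<close>

lemma integrable_indicator_cball: "integrable lborel (\<lambda>x. c * indicator (cball 0 R) (x::'a::euclidean_space) :: real)"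
  using emeasure_lborel_cball_finite[of 0 R] by (intro integrable_mult_right integrable_real_indicator) simp_all

lemma continuous_bounded_on_cball:
  fixes f :: "'a::euclidean_space \<Rightarrow> real"
  assumes "continuous_on UNIV f"
  obtains M where "0 \<le> M" "\<And>x. norm x \<le> R \<Longrightarrow> \<bar>f x\<bar> \<le> M"
proof -
  have "compact (f ` cball 0 R)"
    by (intro compact_continuous_image continuous_on_subset[OF assms]) auto
  then have "bounded (f ` cball 0 R)" by (rule compact_imp_bounded)
  then obtain M where M: "\<forall>y\<in>f ` cball 0 R. norm y \<le> M"
    unfolding bounded_iff by blast
  then have "\<bar>f x\<bar> \<le> max 0 M" if "norm x \<le> R" for x using that by (auto simp: le_max_iff_disj)
  then show ?thesis by (intro that[of "max 0 M"]) auto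
qed

lemma integral_lborel_translate:
  fixes g :: "'a::euclidean_space \<Rightarrow> real"
  assumes "g \<in> borel_measurable borel"
  shows "(\<integral>x. g (x + h) \<partial>lborel) = (\<integral>x. g x \<partial>lborel)"
proof -
  have "(\<integral>x. g x \<partial>lborel) = (\<integral>x. g x \<partial>(distr lborel borel ((+) h)))" by (simp add: lborel_distr_plus)
  also have "\<dots> = (\<integral>x. g (x + h) \<partial>lborel)"
    using assms by (subst integral_distr) (auto simp: add.commute)
  finally show ?thesis by simp
qed

lemma dirderiv_tendsto: "convergent (\<lambda>k. quot f e k x) \<Longrightarrow> (\<lambda>k. quot f e k x) \<longlonglongrightarrow> dirderiv f e x"
  unfolding dirderiv_def by (simp add: convergent_LIMSEQ_iff)

lemma dirderiv_measurable:
  fixes f :: "'a::euclidean_space \<Rightarrow> real"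
  assumes "continuous_on UNIV f" shows "dirderiv f e \<in> borel_measurable borel"
  unfolding dirderiv_def[abs_def] by (intro borel_measurable_lim_metric quot_measurable assms)

lemma dirderiv_bound:
  fixes f :: "'a::real_normed_vector \<Rightarrow> real"
  assumes L: "L-lipschitz_on UNIV f" and "convergent (\<lambda>k. quot f e k x)"
  shows "\<bar>dirderiv f e x\<bar> \<le> L * norm e"
  by (rule LIMSEQ_le_const2[OF tendsto_rabs[OF dirderiv_tendsto[OF assms(2)]]])
    (use quot_bound[OF L] in auto)

lemma directional_quotient_tendsto:
  fixes \<phi> :: "'a::real_normed_vector \<Rightarrow> real"
  assumes "(\<phi> has_derivative D) (at x)"
  shows "((\<lambda>t. (\<phi> (x + t *\<^sub>R e) - \<phi> x) / t) \<longlongrightarrow> D e) (at 0)"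
proof -
  have lin: "linear D" by (rule has_derivative_linear[OF assms])
  have path: "((\<lambda>t. x + t *\<^sub>R e) has_derivative (\<lambda>t. t *\<^sub>R e)) (at 0)"
    by (auto intro!: derivative_eq_intros)
  have "((\<lambda>t. \<phi> (x + t *\<^sub>R e)) has_derivative (\<lambda>t. D (t *\<^sub>R e))) (at 0)"
    using has_derivative_compose[OF path, of \<phi> D] assms by simp
  then have "((\<lambda>t. \<phi> (x + t *\<^sub>R e)) has_real_derivative D e) (at 0)"
    by (simp add: has_field_derivative_def linear_scale[OF lin] mult.commute[of _ "D e"])
  then show ?thesis by (simp add: DERIV_def)
qed

lemma quot_tendsto_derivative:
  fixes \<phi> :: "'a::real_normed_vector \<Rightarrow> real"
  assumes "(\<phi> has_derivative D) (at x)"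
  shows "(\<lambda>k. quot \<phi> e k x) \<longlonglongrightarrow> D e"
proof -
  have "filterlim (\<lambda>k. 1 / real (Suc k)) (at 0) sequentially"
    unfolding filterlim_at by (auto simp del: of_nat_Suc intro!: LIMSEQ_Suc lim_1_over_n)
  with directional_quotient_tendsto[OF assms]
  have "(\<lambda>k. (\<phi> (x + (1 / real (Suc k)) *\<^sub>R e) - \<phi> x) / (1 / real (Suc k))) \<longlonglongrightarrow> D e"
    by (rule filterlim_compose)
  then show ?thesis by (simp add: quot_def mult.commute)
qed

text \<open>Move the difference quotient from \<open>f\<close> to \<open>\<phi>\<close> by a
  translation and pass to the limit by dominated convergence on both sides.\<close>

lemma integral_dirderiv_by_parts:
  fixes f :: "real^'n \<Rightarrow> real"
  assumes L: "L-lipschitz_on UNIV f" and \<phi>: "\<phi> \<in> test_functions UNIV"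
  shows "integrable lborel (\<lambda>x. dirderiv f e x * \<phi> x)"
    and "integrable lborel (\<lambda>x. f x * (grad \<phi> x \<bullet> e))"
    and "(\<integral>x. dirderiv f e x * \<phi> x \<partial>lborel) = - (\<integral>x. f x * (grad \<phi> x \<bullet> e) \<partial>lborel)"
proof -
  have cont: "continuous_on UNIV f" by (rule lipschitz_on_continuous_on[OF L])
  have L0: "0 \<le> L" by (rule lipschitz_on_nonneg[OF L])
  obtain B R where B: "\<And>x. \<bar>\<phi> x\<bar> \<le> B" "\<And>x. norm (grad \<phi> x) \<le> B" "0 \<le> B" "0 \<le> R"
    and supp: "\<And>x. norm x > R \<Longrightarrow> \<phi> x = 0" "\<And>x. norm x > R \<Longrightarrow> grad \<phi> x = 0"
    by (rule test_functions_bounded[OF \<phi>]) (rule that; assumption)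
  have \<phi>_lip: "\<bar>\<phi> x - \<phi> y\<bar> \<le> B * norm (x - y)" for x y by (rule test_functions_Lipschitz[OF \<phi> B(2)])
  have f_meas: "f \<in> borel_measurable borel" by (rule borel_measurable_continuous_onI[OF cont])
  have \<phi>_meas: "\<phi> \<in> borel_measurable borel"
    by (rule borel_measurable_continuous_onI[OF test_functions_continuous[OF \<phi>]])
  have grad_meas: "(\<lambda>x. grad \<phi> x \<bullet> e) \<in> borel_measurable borel"
    by (intro borel_measurable_continuous_onI continuous_intros test_functions_grad_continuous[OF \<phi>])
  note meas = f_meas \<phi>_meas grad_meas quot_measurable[OF cont] dirderiv_measurable[OF cont]
    quot_measurable[OF test_functions_continuous[OF \<phi>]]
  (* a radius that contains the supports of all translates of \<phi> by steps of length at most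
     norm e *)
  define R' where "R' = R + norm e"
  obtain M where M0: "0 \<le> M" and M: "\<And>x. norm x \<le> R' \<Longrightarrow> \<bar>f x\<bar> \<le> M"
    using continuous_bounded_on_cball[OF cont, of R'] by blast
  have conv: "AE x in lborel. convergent (\<lambda>k. quot f e k x)" by (rule Lipschitz_AE_convergent_quot[OF L])

  have lim1: "integrable lborel (\<lambda>x. dirderiv f e x * \<phi> x) \<and>
      (\<lambda>k. \<integral>x. quot f e k x * \<phi> x \<partial>lborel) \<longlonglongrightarrow> (\<integral>x. dirderiv f e x * \<phi> x \<partial>lborel)"
  proof (intro conjI)
    let ?w = "\<lambda>x. (L * norm e * B) * indicator (cball 0 R) x :: real"
    have 1: "AE x in lborel. (\<lambda>k. quot f e k x * \<phi> x) \<longlonglongrightarrow> dirderiv f e x * \<phi> x"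
      by (rule AE_mp[OF conv]) (auto intro!: tendsto_intros dirderiv_tendsto)
    have 2: "norm (quot f e k x * \<phi> x) \<le> ?w x" for k x
    proof (cases "norm x \<le> R")
      case True
      have "\<bar>quot f e k x\<bar> * \<bar>\<phi> x\<bar> \<le> (L * norm e) * B"
        using quot_bound[OF L] B(1,3) L0 by (intro mult_mono) auto
      then show ?thesis using True by (simp add: abs_mult)
    qed (simp add: supp)
    have m: "(\<lambda>x. dirderiv f e x * \<phi> x) \<in> borel_measurable lborel"
      "(\<lambda>x. quot f e k x * \<phi> x) \<in> borel_measurable lborel" for k
      using meas by (auto intro!: borel_measurable_times)
    show "integrable lborel (\<lambda>x. dirderiv f e x * \<phi> x)"
      by (rule integrable_dominated_convergence[OF m integrable_indicator_cball 1]) (use 2 in auto)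
    show "(\<lambda>k. \<integral>x. quot f e k x * \<phi> x \<partial>lborel) \<longlonglongrightarrow> (\<integral>x. dirderiv f e x * \<phi> x \<partial>lborel)"
      by (rule integral_dominated_convergence[OF m integrable_indicator_cball 1]) (use 2 in auto)
  qed
  have lim2: "integrable lborel (\<lambda>x. f x * (- (grad \<phi> x \<bullet> e))) \<and>
      (\<lambda>k. \<integral>x. f x * quot \<phi> (- e) k x \<partial>lborel) \<longlonglongrightarrow> (\<integral>x. f x * (- (grad \<phi> x \<bullet> e)) \<partial>lborel)"
  proof (intro conjI)
    let ?w = "\<lambda>x. (M * (B * norm e)) * indicator (cball 0 R') x :: real"
    have 1: "AE x in lborel. (\<lambda>k. f x * quot \<phi> (- e) k x) \<longlonglongrightarrow> f x * (- (grad \<phi> x \<bullet> e))"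
    proof (intro AE_I2)
      fix x
      have "(\<lambda>k. quot \<phi> (- e) k x) \<longlonglongrightarrow> grad \<phi> x \<bullet> (- e)"
        by (rule quot_tendsto_derivative[OF test_functions_has_derivative[OF \<phi>]])
      then show "(\<lambda>k. f x * quot \<phi> (- e) k x) \<longlonglongrightarrow> f x * (- (grad \<phi> x \<bullet> e))"
        by (intro tendsto_mult tendsto_const) simp
    qed
    have "(B)-lipschitz_on UNIV \<phi>"
      using \<phi>_lip B(3) by (intro lipschitz_onI) (auto simp: dist_norm)
    note \<phi>_quot = quot_bound[OF this]
    have 2: "norm (f x * quot \<phi> (- e) k x) \<le> ?w x" for k x
    proof (cases "norm x \<le> R'")
      case True
      have "\<bar>f x\<bar> * \<bar>quot \<phi> (- e) k x\<bar> \<le> M * (B * norm e)"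
        using \<phi>_quot[of "- e" k x] M[of x] True M0 B(3) by (intro mult_mono) auto
      then show ?thesis using True by (simp add: abs_mult)
    next
      case False
      have small: "norm ((1 / real (Suc k)) *\<^sub>R e) \<le> norm e" 
        unfolding norm_scaleR by (rule mult_left_le_one_le) auto
      then have "norm (x + (1 / real (Suc k)) *\<^sub>R (- e)) > R"
        using False norm_triangle_ineq2[of x "(1 / real (Suc k)) *\<^sub>R e"] by (simp add: R'_def)
      moreover have "norm x > R" using False norm_ge_zero[of e] unfolding R'_def by linarith
      ultimately show ?thesis using False by (simp add: quot_def supp)
    qed
    have m: "(\<lambda>x. f x * (- (grad \<phi> x \<bullet> e))) \<in> borel_measurable lborel"
      "(\<lambda>x. f x * quot \<phi> (- e) k x) \<in> borel_measurable lborel" for k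
      using meas by (auto intro!: borel_measurable_times borel_measurable_uminus)
    show "integrable lborel (\<lambda>x. f x * (- (grad \<phi> x \<bullet> e)))"
      by (rule integrable_dominated_convergence[OF m integrable_indicator_cball 1]) (use 2 in auto)
    show "(\<lambda>k. \<integral>x. f x * quot \<phi> (- e) k x \<partial>lborel) \<longlonglongrightarrow> (\<integral>x. f x * (- (grad \<phi> x \<bullet> e)) \<partial>lborel)"
      by (rule integral_dominated_convergence[OF m integrable_indicator_cball 1]) (use 2 in auto)
  qed
  (* both sides are the difference of the same two integrals, after a translation *)
  have shift: "(\<integral>x. quot f e k x * \<phi> x \<partial>lborel) = (\<integral>x. f x * quot \<phi> (- e) k x \<partial>lborel)" for k
  proof -
    define h where "h = (1 / real (Suc k)) *\<^sub>R e"
    have int: "integrable lborel (\<lambda>x. g x * \<phi> x)" if g: "continuous_on UNIV g" for g :: "real^'n \<Rightarrow> real"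
    proof -
      obtain C where C0: "0 \<le> C" and C: "\<And>x. norm x \<le> R \<Longrightarrow> \<bar>g x\<bar> \<le> C"
        using continuous_bounded_on_cball[OF g, of R] by blast
      show ?thesis
      proof (rule Bochner_Integration.integrable_bound[OF integrable_indicator_cball[of "C * B" R]])
        show "(\<lambda>x. g x * \<phi> x) \<in> borel_measurable lborel"
          using borel_measurable_continuous_onI[OF g] \<phi>_meas by auto
        show "AE x in lborel. norm (g x * \<phi> x) \<le> norm (C * B * indicator (cball 0 R) x :: real)"
        proof (intro AE_I2)
          fix x
          show "norm (g x * \<phi> x) \<le> norm (C * B * indicator (cball 0 R) x :: real)"
          proof (cases "norm x \<le> R")
            case True
            have "\<bar>g x\<bar> * \<bar>\<phi> x\<bar> \<le> C * B" using C[of x] True B(1) C0 by (intro mult_mono) auto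
            then show ?thesis using True C0 B(3) by (simp add: abs_mult)
          qed (simp add: supp)
        qed
      qed
    qed
    have fh: "continuous_on UNIV (\<lambda>x. f (x + h))"
      by (rule continuous_on_compose2[OF cont]) (auto intro!: continuous_intros)
    have \<phi>h: "(\<lambda>x. \<phi> (x + - h)) \<in> borel_measurable borel"
      using \<phi>_meas by measurable
    have tr: "(\<lambda>x. f (x + h) * \<phi> x) = (\<lambda>x. (\<lambda>y. f y * \<phi> (y + - h)) (x + h))" by (simp add: fun_eq_iff)
    have int2: "integrable lborel (\<lambda>x. f x * \<phi> (x + - h))"
    proof -
      have "integrable (distr lborel borel ((+) h)) (\<lambda>x. f x * \<phi> (x + - h))"
        using f_meas \<phi>h int[OF fh]
        by (subst integrable_distr_eq) (auto simp: add.commute)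
      then show ?thesis by (simp add: lborel_distr_plus)
    qed
    have eq: "(\<integral>x. f (x + h) * \<phi> x \<partial>lborel) = (\<integral>x. f x * \<phi> (x + - h) \<partial>lborel)"
      unfolding tr using f_meas \<phi>h by (intro integral_lborel_translate) auto
    have "(\<integral>x. quot f e k x * \<phi> x \<partial>lborel)
        = (\<integral>x. real (Suc k) * (f (x + h) * \<phi> x - f x * \<phi> x) \<partial>lborel)"
      by (simp add: quot_def h_def algebra_simps)
    also have "\<dots> = real (Suc k) * ((\<integral>x. f (x + h) * \<phi> x \<partial>lborel) - (\<integral>x. f x * \<phi> x \<partial>lborel))"
      using int[OF fh] int[OF cont] by (simp del: of_nat_Suc)
    also have "\<dots> = real (Suc k) * ((\<integral>x. f x * \<phi> (x + - h) \<partial>lborel) - (\<integral>x. f x * \<phi> x \<partial>lborel))"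
      by (simp only: eq)
    also have "\<dots> = (\<integral>x. real (Suc k) * (f x * \<phi> (x + - h) - f x * \<phi> x) \<partial>lborel)"
      using int2 int[OF cont] by (simp del: of_nat_Suc)
    also have "\<dots> = (\<integral>x. f x * quot \<phi> (- e) k x \<partial>lborel)"
      by (simp add: quot_def h_def algebra_simps)
    finally show ?thesis .
  qed
  show "integrable lborel (\<lambda>x. dirderiv f e x * \<phi> x)" using lim1 by simp
  show "integrable lborel (\<lambda>x. f x * (grad \<phi> x \<bullet> e))" using lim2 by simp
  have "(\<integral>x. dirderiv f e x * \<phi> x \<partial>lborel) = (\<integral>x. f x * (- (grad \<phi> x \<bullet> e)) \<partial>lborel)"
    using LIMSEQ_unique[OF conjunct2[OF lim1], of "\<integral>x. f x * (- (grad \<phi> x \<bullet> e)) \<partial>lborel"]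
      conjunct2[OF lim2] by (simp add: shift)
  then show "(\<integral>x. dirderiv f e x * \<phi> x \<partial>lborel) = - (\<integral>x. f x * (grad \<phi> x \<bullet> e) \<partial>lborel)" by simp
qed

lemma integrable_test_function:
  assumes \<phi>: "\<phi> \<in> test_functions \<Omega>" shows "integrable lborel \<phi>"
proof -
  obtain B R where B: "\<And>x. \<bar>\<phi> x\<bar> \<le> B" "\<And>x. norm (grad \<phi> x) \<le> B" "0 \<le> B" "0 \<le> R"
    and supp: "\<And>x. norm x > R \<Longrightarrow> \<phi> x = 0" "\<And>x. norm x > R \<Longrightarrow> grad \<phi> x = 0"
    by (rule test_functions_bounded[OF \<phi>]) (rule that; assumption)
  show ?thesis
  proof (rule Bochner_Integration.integrable_bound[OF integrable_indicator_cball[of B R]])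
    show "\<phi> \<in> borel_measurable lborel"
      using borel_measurable_continuous_onI[OF test_functions_continuous[OF \<phi>]] by simp
    show "AE x in lborel. norm (\<phi> x) \<le> norm (B * indicator (cball 0 R) x :: real)"
      using B(1,3) supp(1) by (intro AE_I2) (auto simp: indicator_def)
  qed
qed

subsection \<open>Differentiability almost everywhere\<close>

text \<open>After integration by parts the right-hand side is linear in \<open>e\<close>, so
  the defect \<open>G\<close> of linearity integrates to zero against every test function.
  Truncated to \<open>[- C, C]\<close>, which alters it on a null set only, \<open>G +
  C\<close> and \<open>C\<close> are densities of measures with the same integrals of test
  functions.\<close>

lemma AE_dirderiv_linear:
  fixes f :: "real^'n \<Rightarrow> real"
  assumes L: "L-lipschitz_on UNIV f"
  shows "AE x in lborel. dirderiv f e x = (\<chi> i. dirderiv f (axis i 1) x) \<bullet> e"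
proof -
  have cont: "continuous_on UNIV f" by (rule lipschitz_on_continuous_on[OF L])
  have L0: "0 \<le> L" by (rule lipschitz_on_nonneg[OF L])
  define G where "G x = dirderiv f e x - (\<Sum>i\<in>UNIV. e $ i * dirderiv f (axis i 1) x)" for x
  define C where "C = L * norm e + (\<Sum>i\<in>UNIV. \<bar>e $ i\<bar> * L)"
  have C0: "0 \<le> C" unfolding C_def using L0 by (intro add_nonneg_nonneg sum_nonneg) auto
  have G_meas: "G \<in> borel_measurable borel"
    unfolding G_def
    by (intro borel_measurable_diff borel_measurable_sum borel_measurable_times borel_measurable_const
        dirderiv_measurable[OF cont])
  define H where "H x = max (- C) (min C (G x))" for x
  have H_meas: "H \<in> borel_measurable borel" unfolding H_def
    by (intro borel_measurable_max borel_measurable_min G_meas borel_measurable_const)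
  have H_bounds: "- C \<le> H x" "H x \<le> C" for x using C0 by (auto simp: H_def)
  have "AE x in lborel. convergent (\<lambda>k. quot f e k x) \<and> (\<forall>i. convergent (\<lambda>k. quot f (axis i 1) k x))"
    using Lipschitz_AE_convergent_quot[OF L] by (auto simp: AE_all_countable)
  then have HG: "AE x in lborel. H x = G x"
  proof (rule AE_mp, intro AE_I2 impI)
    fix x assume *: "convergent (\<lambda>k. quot f e k x) \<and> (\<forall>i. convergent (\<lambda>k. quot f (axis i 1) k x))"
    have "\<bar>G x\<bar> \<le> \<bar>dirderiv f e x\<bar> + \<bar>\<Sum>i\<in>UNIV. e $ i * dirderiv f (axis i 1) x\<bar>"
      unfolding G_def by (rule abs_triangle_ineq4)
    also have "\<dots> \<le> L * norm e + (\<Sum>i\<in>UNIV. \<bar>e $ i\<bar> * L)"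
    proof (rule add_mono)
      show "\<bar>dirderiv f e x\<bar> \<le> L * norm e" using dirderiv_bound[OF L] * by blast
      have "\<bar>dirderiv f (axis i 1) x\<bar> \<le> L" for i :: 'n
        using dirderiv_bound[OF L, of "axis i 1" x] * by (simp add: norm_axis_1)
      then show "\<bar>\<Sum>i\<in>UNIV. e $ i * dirderiv f (axis i 1) x\<bar> \<le> (\<Sum>i\<in>UNIV. \<bar>e $ i\<bar> * L)"
        by (intro order_trans[OF sum_abs] sum_mono) (auto simp: abs_mult intro!: mult_left_mono)
    qed
    finally show "H x = G x" by (auto simp: H_def C_def abs_le_iff)
  qed
  let ?P = "density lborel (\<lambda>x. ennreal (H x + C))" and ?N = "density lborel (\<lambda>x. ennreal C)"
  have "?P = ?N"
  proof (rule measure_eqI_test_functions[of UNIV])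
    fix a b :: "real^'n"
    show "emeasure ?N (cbox a b) < \<infinity>"
      by (simp add: emeasure_density nn_integral_cmult_indicator emeasure_lborel_cbox_eq ennreal_mult_less_top)
    have "emeasure ?P (cbox a b) = (\<integral>\<^sup>+x. ennreal (H x + C) * indicator (cbox a b) x \<partial>lborel)"
      using H_meas by (simp add: emeasure_density)
    also have "\<dots> \<le> (\<integral>\<^sup>+x. ennreal (2 * C) * indicator (cbox a b) x \<partial>lborel)"
    proof (intro nn_integral_mono mult_right_mono ennreal_leI)
      show "H x + C \<le> 2 * C" for x using H_bounds(2)[of x] by linarith
    qed simp
    also have "\<dots> < \<infinity>"
      by (simp add: nn_integral_cmult_indicator emeasure_lborel_cbox_eq ennreal_mult_less_top)
    finally show "emeasure ?P (cbox a b) < \<infinity>" .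
  next
    fix \<phi> :: "real^'n \<Rightarrow> real" assume \<phi>: "\<phi> \<in> test_functions UNIV"
    have \<phi>_meas: "\<phi> \<in> borel_measurable borel"
      by (rule borel_measurable_continuous_onI[OF test_functions_continuous[OF \<phi>]])
    note parts = integral_dirderiv_by_parts[OF L \<phi>]
    have G\<phi>: "G x * \<phi> x = dirderiv f e x * \<phi> x - (\<Sum>i\<in>UNIV. e $ i * (dirderiv f (axis i 1) x * \<phi> x))" for x
      by (simp add: G_def left_diff_distrib sum_distrib_right mult.assoc)
    have int_sum: "integrable lborel (\<lambda>x. \<Sum>i\<in>UNIV. e $ i * (dirderiv f (axis i 1) x * \<phi> x))"
      using parts(1) by (intro Bochner_Integration.integrable_sum) auto
    have int_G: "integrable lborel (\<lambda>x. G x * \<phi> x)"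
      unfolding G\<phi> using parts(1) int_sum by (intro Bochner_Integration.integrable_diff)
    have "(\<integral>x. G x * \<phi> x \<partial>lborel) =
        (\<integral>x. dirderiv f e x * \<phi> x \<partial>lborel) - (\<Sum>i\<in>UNIV. e $ i * (\<integral>x. dirderiv f (axis i 1) x * \<phi> x \<partial>lborel))"
      unfolding G\<phi> using parts(1) int_sum
      by (subst Bochner_Integration.integral_diff) (auto simp: Bochner_Integration.integral_sum)
    also have "\<dots> = - (\<integral>x. f x * (grad \<phi> x \<bullet> e) \<partial>lborel) + (\<Sum>i\<in>UNIV. e $ i * (\<integral>x. f x * (grad \<phi> x \<bullet> axis i 1) \<partial>lborel))"
      unfolding parts(3) by (simp add: sum_negf)
    also have "(\<Sum>i\<in>UNIV. e $ i * (\<integral>x. f x * (grad \<phi> x \<bullet> axis i 1) \<partial>lborel))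
        = (\<integral>x. (\<Sum>i\<in>UNIV. e $ i * (f x * (grad \<phi> x \<bullet> axis i 1))) \<partial>lborel)"
      using parts(2) by (subst Bochner_Integration.integral_sum) auto
    also have "(\<lambda>x. \<Sum>i\<in>UNIV. e $ i * (f x * (grad \<phi> x \<bullet> axis i 1))) = (\<lambda>x. f x * (grad \<phi> x \<bullet> e))"
      by (auto simp: inner_axis inner_vec_def[of _ e] sum_distrib_left mult_ac)
    finally have zero: "(\<integral>x. G x * \<phi> x \<partial>lborel) = 0" by simp
    have "integral\<^sup>L ?P \<phi> = (\<integral>x. (H x + C) * \<phi> x \<partial>lborel)"
    proof (subst integral_density)
      show "AE x in lborel. 0 \<le> H x + C" 
      proof (intro AE_I2)
        show "0 \<le> H x + C" for x using H_bounds(1)[of x] by linarith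
      qed
    qed (use \<phi>_meas H_meas in auto)
    also have "\<dots> = (\<integral>x. G x * \<phi> x + C * \<phi> x \<partial>lborel)"
      by (rule integral_cong_AE) (use H_meas \<phi>_meas G_meas HG in \<open>auto simp: distrib_right elim: AE_mp\<close>)
    also have "\<dots> = (\<integral>x. C * \<phi> x \<partial>lborel)"
      using int_G zero integrable_test_function[OF \<phi>] by simp
    also have "\<dots> = integral\<^sup>L ?N \<phi>"
      using \<phi>_meas C0 by (subst integral_density) auto
    finally show "integral\<^sup>L ?P \<phi> = integral\<^sup>L ?N \<phi>" .
  qed auto
  then have "AE x in lborel. ennreal (H x + C) = ennreal C"
    using H_meas by (intro sigma_finite_measure.density_unique[OF sigma_finite_lborel]) auto
  then show ?thesis
    using HG
  proof eventually_elim
    fix x assume "ennreal (H x + C) = ennreal C" "H x = G x"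
    then have "G x = 0" using H_bounds(1)[of x] C0 by (subst (asm) ennreal_inj) auto
    then show "dirderiv f e x = (\<chi> i. dirderiv f (axis i 1) x) \<bullet> e"
      by (simp add: G_def inner_vec_def mult.commute)
  qed
qed

text \<open>Finitely many of the directions are \<open>\<delta>\<close>-dense in the unit
  ball, and there the convergence is uniform. An increment \<open>h\<close> is compared with
  \<open>e / n\<close>, where \<open>1 / n\<close> is comparable to \<open>norm h\<close>
  and \<open>e\<close> is a direction close to \<open>n h\<close>; the Lipschitz bound
  controls the error.\<close>

lemma differentiable_if_dense_directional:
  fixes f :: "'a::euclidean_space \<Rightarrow> real"
  assumes L: "L-lipschitz_on UNIV f"
    and dense: "\<And>S. open S \<Longrightarrow> S \<noteq> {} \<Longrightarrow> \<exists>d\<in>D. d \<in> S"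
    and lim: "\<And>e. e \<in> D \<Longrightarrow> (\<lambda>k. quot f e k x) \<longlonglongrightarrow> a \<bullet> e"
  shows "(f has_derivative (\<lambda>h. a \<bullet> h)) (at x)"
  unfolding has_derivative_at_alt
proof (intro conjI allI impI)
  show "bounded_linear (\<lambda>h. a \<bullet> h)" by (rule bounded_linear_inner_right)
  fix \<epsilon> :: real assume \<epsilon>: "0 < \<epsilon>"
  have L0: "0 \<le> L" by (rule lipschitz_on_nonneg[OF L])
  define M where "M = 1 + L + norm a"
  have M: "M > 0" using L0 norm_ge_zero[of a] unfolding M_def by linarith
  define \<delta> where "\<delta> = \<epsilon> / (2 * M)"
  have \<delta>: "\<delta> > 0" using \<epsilon> M by (simp add: \<delta>_def)
  have "cball 0 1 \<subseteq> (\<Union>e\<in>D. ball e \<delta>)"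
  proof
    fix h :: 'a
    have "open (ball h \<delta>)" "ball h \<delta> \<noteq> {}" using \<delta> by auto
    from dense[OF this] obtain d where "d \<in> D" "d \<in> ball h \<delta>" by blast
    then show "h \<in> (\<Union>e\<in>D. ball e \<delta>)" by (auto simp: dist_commute)
  qed
  then obtain D' where D': "D' \<subseteq> D" "finite D'" "cball 0 1 \<subseteq> (\<Union>e\<in>D'. ball e \<delta>)"
    using compactE_image[OF compact_cball, of D "\<lambda>e. ball e \<delta>" 0 1] open_ball by metis
  have "\<forall>\<^sub>F k in sequentially. \<forall>e\<in>D'. \<bar>quot f e k x - a \<bullet> e\<bar> < \<delta>"
    unfolding eventually_ball_finite_distrib[OF D'(2)]
    using lim[THEN tendstoD, OF _ \<delta>] D'(1) by (auto simp: dist_real_def)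
  then obtain K where K: "\<And>k e. k \<ge> K \<Longrightarrow> e \<in> D' \<Longrightarrow> \<bar>quot f e k x - a \<bullet> e\<bar> < \<delta>"
    by (auto simp: eventually_sequentially)
  show "\<exists>d>0. \<forall>y. norm (y - x) < d \<longrightarrow> norm (f y - f x - a \<bullet> (y - x)) \<le> \<epsilon> * norm (y - x)"
  proof (intro exI conjI allI impI)
    show "0 < 1 / real (K + 1)" by simp
    fix y assume y: "norm (y - x) < 1 / real (K + 1)"
    define h where "h = y - x"
    show "norm (f y - f x - a \<bullet> (y - x)) \<le> \<epsilon> * norm (y - x)"
    proof (cases "h = 0")
      case True then show ?thesis by (simp add: h_def)
    next
      case False
      then have h0: "norm h > 0" by simp
      (* the scale n with n <= 1 / |h| < n + 1, for which n h lies in the unit ball *)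
      define n where "n = nat \<lfloor>1 / norm h\<rfloor>"
      have big: "real (K + 1) < 1 / norm h" using y h0 by (simp add: h_def field_simps)
      have n_le: "real n \<le> 1 / norm h" "1 / norm h < real n + 1"
        using h0 by (auto simp: n_def of_nat_nat)
      have "K + 1 \<le> n" using big n_le(2) by linarith
      then obtain k where k: "n = Suc k" "k \<ge> K" by (metis Suc_eq_plus1 Suc_le_D Suc_le_mono)
      have n1: "1 \<le> real n" using k by simp
      have "norm (real n *\<^sub>R h) \<le> 1" using n_le(1) h0 by (simp add: field_simps)
      then have "real n *\<^sub>R h \<in> cball 0 1" by simp
      then obtain e where e: "e \<in> D'" "real n *\<^sub>R h \<in> ball e \<delta>" using D'(3) by blast
      then have e_close: "norm (real n *\<^sub>R h - e) < \<delta>" by (simp add: dist_norm norm_minus_commute)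
      define p where "p = x + (1 / real n) *\<^sub>R e"
      have close: "norm (y - p) \<le> \<delta> / real n"
      proof -
        have "y - p = (1 / real n) *\<^sub>R (real n *\<^sub>R h - e)"
          using n1 by (simp add: p_def h_def scaleR_diff_right)
        then have "norm (y - p) = norm (real n *\<^sub>R h - e) / real n" using n1 by simp
        then show ?thesis using e_close n1 by (simp add: divide_right_mono)
      qed
      have 1: "\<bar>f y - f p\<bar> \<le> L * (\<delta> / real n)"
        using lipschitz_onD[OF L, of y p] mult_left_mono[OF close L0] by (simp add: dist_norm)
      have 2: "\<bar>f p - f x - a \<bullet> (p - x)\<bar> \<le> \<delta> / real n"
      proof -
        have "\<bar>real n * (f p - f x) - a \<bullet> e\<bar> \<le> \<delta>"
          using K[OF k(2) e(1)] by (simp add: quot_def k(1) p_def)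
        moreover have "a \<bullet> e = real n * (a \<bullet> (p - x))" using n1 by (simp add: p_def)
        moreover have "real n * (f p - f x) - real n * (a \<bullet> (p - x)) = real n * (f p - f x - a \<bullet> (p - x))"
          by (simp add: right_diff_distrib)
        ultimately have "\<bar>real n * (f p - f x - a \<bullet> (p - x))\<bar> \<le> \<delta>" by simp
        then have "real n * \<bar>f p - f x - a \<bullet> (p - x)\<bar> \<le> \<delta>" by (simp add: abs_mult)
        then show ?thesis using n1 by (simp add: field_simps)
      qed
      have 3: "\<bar>a \<bullet> (p - y)\<bar> \<le> norm a * (\<delta> / real n)"
        using Cauchy_Schwarz_ineq2[of a "p - y"] mult_left_mono[OF close norm_ge_zero[of a]]
        by (simp add: norm_minus_commute)
      have "f y - f x - a \<bullet> (y - x) = (f y - f p) + (f p - f x - a \<bullet> (p - x)) + a \<bullet> (p - y)"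
        by (simp add: inner_diff_right)
      then have "\<bar>f y - f x - a \<bullet> (y - x)\<bar> \<le> L * (\<delta> / real n) + \<delta> / real n + norm a * (\<delta> / real n)"
        using 1 2 3 by linarith
      also have "\<dots> = M * \<delta> * (1 / real n)" by (simp add: M_def algebra_simps)
      also have "M * \<delta> = \<epsilon> / 2" using M by (simp add: \<delta>_def)
      also have "\<epsilon> / 2 * (1 / real n) \<le> \<epsilon> / 2 * (2 * norm h)"
      proof -
        have "1 / norm h < 2 * real n" using n_le(2) n1 by linarith
        then have "1 / real n \<le> 2 * norm h" using h0 n1 by (simp add: field_simps)
        then show ?thesis using \<epsilon> by (intro mult_left_mono) auto
      qed
      finally show ?thesis by (simp add: h_def)
    qed
  qed
qed

theorem Rademacher:
  fixes f :: "real^'n \<Rightarrow> real"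
  assumes L: "L-lipschitz_on UNIV f"
  shows "AE x in lborel. f differentiable (at x)"
proof -
  obtain D :: "(real^'n) set" where D: "countable D" "\<And>S. open S \<Longrightarrow> S \<noteq> {} \<Longrightarrow> \<exists>d\<in>D. d \<in> S"
    using countable_dense_setE by metis
  have "AE x in lborel. \<forall>e\<in>D. convergent (\<lambda>k. quot f e k x) \<and>
      dirderiv f e x = (\<chi> i. dirderiv f (axis i 1) x) \<bullet> e"
    using Lipschitz_AE_convergent_quot[OF L] AE_dirderiv_linear[OF L]
    by (auto simp: AE_ball_countable[OF D(1)])
  then show ?thesis
  proof (rule AE_mp, intro AE_I2 impI)
    fix x assume *: "\<forall>e\<in>D. convergent (\<lambda>k. quot f e k x) \<and>
      dirderiv f e x = (\<chi> i. dirderiv f (axis i 1) x) \<bullet> e"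
    have "(f has_derivative (\<lambda>h. (\<chi> i. dirderiv f (axis i 1) x) \<bullet> h)) (at x)"
    proof (rule differentiable_if_dense_directional[OF L D(2)])
      fix e assume "e \<in> D"
      then show "(\<lambda>k. quot f e k x) \<longlonglongrightarrow> (\<chi> i. dirderiv f (axis i 1) x) \<bullet> e"
        using dirderiv_tendsto[of f e x] * by auto
    qed
    then show "f differentiable (at x)" by (auto simp: differentiable_def)
  qed
qed

section \<open>Smooth approximation of Lipschitz functions\<close>

text \<open>Differentiation under the integral gives the convolution of \<open>f\<close>
  with the partial derivatives of the smooth kernel up to sign, so the induction is over all
  smooth kernels. The kernel is evaluated at \<open>y - x\<close>, so that only translations
  occur when the variable of integration is changed.\<close>

lemma Ck_convolution:
  fixes f :: "real^'n \<Rightarrow> real"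
  assumes f: "continuous_on UNIV f" and \<eta>: "\<And>k. Ck k \<eta>"
  shows "Ck k (\<lambda>x. integral (cbox a b) (\<lambda>y. \<eta> (y - x) * f y))"
  using \<eta>
proof (induction k arbitrary: \<eta>)
  case 0
  have \<eta>: "continuous_on UNIV \<eta>" by (rule Ck_continuous[OF 0])
  have "continuous_on (UNIV \<times> cbox a b) (\<lambda>(x, y). \<eta> (y - x) * f y)"
    unfolding split_def
    by (intro continuous_intros continuous_on_compose2[OF \<eta>] continuous_on_compose2[OF f]) auto
  then have "continuous_on UNIV (\<lambda>x. integral (cbox a b) (\<lambda>y. \<eta> (y - x) * f y))"
    by (intro integral_continuous_on_param)
  then show ?case by simp
next
  case (Suc k)
  have \<eta>_cont: "continuous_on UNIV \<eta>" by (rule Ck_continuous[OF Suc.prems])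
  have g_cont: "continuous_on UNIV (\<lambda>x. grad \<eta> x $ i)" for i by (rule Ck_continuous[OF Ck_grad[OF Suc.prems]])
  have grad_cont: "continuous_on UNIV (grad \<eta>)"
    using continuous_on_vec_lambda[of UNIV "\<lambda>i x. grad \<eta> x $ i"] g_cont by simp
  define G where "G x y = (- f y) *\<^sub>R grad \<eta> (y - x)" for x y
  have G_cont: "continuous_on (UNIV \<times> cbox a b) (\<lambda>(x, y). G x y)"
    unfolding split_def G_def
    by (intro continuous_intros continuous_on_compose2[OF grad_cont] continuous_on_compose2[OF f]) auto
  have G_int: "(\<lambda>y. G x y) integrable_on cbox a b" for x
    unfolding G_def
    by (intro integrable_continuous continuous_intros continuous_on_compose2[OF grad_cont] continuous_on_compose2[OF f]) auto
  let ?F = "\<lambda>x. integral (cbox a b) (\<lambda>y. \<eta> (y - x) * f y)"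
  show ?case
  proof (rule Ck_SucI)
    fix x0
    have "((\<lambda>x. integral (cbox a b) (\<lambda>y. \<eta> (y - x) * f y)) has_derivative
        integral (cbox a b) (\<lambda>y. blinfun_inner_left (G x0 y))) (at x0 within UNIV)"
    proof (rule leibniz_rule[where U=UNIV and fx="\<lambda>x y. blinfun_inner_left (G x y)"])
      fix x t :: "real^'n"
      have "((\<lambda>x. t - x) has_derivative (\<lambda>h. - h)) (at x)"
        by (auto intro!: derivative_eq_intros)
      then have "((\<lambda>x. \<eta> (t - x)) has_derivative (\<lambda>h. grad \<eta> (t - x) \<bullet> (- h))) (at x)"
        using has_derivative_compose[of "\<lambda>x. t - x" "\<lambda>h. - h" x UNIV \<eta> "\<lambda>h. grad \<eta> (t - x) \<bullet> h"]
          Ck_has_derivative[of 0 \<eta> "t - x"] Suc.prems[of "Suc 0"] by simp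
      then have "((\<lambda>x. \<eta> (t - x) * f t) has_derivative (\<lambda>h. (grad \<eta> (t - x) \<bullet> (- h)) * f t)) (at x)"
        by (rule has_derivative_mult_left)
      then show "((\<lambda>x. \<eta> (t - x) * f t) has_derivative blinfun_apply (blinfun_inner_left (G x t))) (at x within UNIV)"
        by (simp add: G_def inner_commute mult.commute)
    next
      fix x
      show "(\<lambda>y. \<eta> (y - x) * f y) integrable_on cbox a b"
        by (intro integrable_continuous continuous_intros continuous_on_compose2[OF \<eta>_cont] continuous_on_compose2[OF f]) auto
    next
      show "continuous_on (UNIV \<times> cbox a b) (\<lambda>(x, y). blinfun_inner_left (G x y))"
        using bounded_linear.continuous_on[OF bounded_linear_blinfun_inner_left G_cont] by (simp add: split_def)
    qed auto
    moreover have "blinfun_apply (integral (cbox a b) (\<lambda>y. blinfun_inner_left (G x0 y))) h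
        = integral (cbox a b) (G x0) \<bullet> h" for h
    proof -
      have "(\<lambda>y. blinfun_inner_left (G x0 y)) integrable_on cbox a b"
        using integrable_linear[OF G_int bounded_linear_blinfun_inner_left] by (simp add: o_def)
      then have "blinfun_apply (integral (cbox a b) (\<lambda>y. blinfun_inner_left (G x0 y))) h
          = integral (cbox a b) (\<lambda>y. h \<bullet> G x0 y)"
        by (subst blinfun_apply_integral) auto
      also have "\<dots> = h \<bullet> integral (cbox a b) (G x0)"
        using integral_linear[OF G_int[of x0] bounded_linear_inner_right[of h]] by (simp add: o_def)
      finally show ?thesis by (simp add: inner_commute)
    qed
    ultimately show "(?F has_derivative (\<lambda>h. integral (cbox a b) (G x0) \<bullet> h)) (at x0)"
      by (metis (no_types, lifting) ext)
  next
    fix i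
    have "Ck k (\<lambda>x. (- 1) * grad \<eta> x $ i)" for k by (intro Ck_cmult Ck_grad Suc.prems)
    from Suc.IH[OF this]
    have "Ck k (\<lambda>x. integral (cbox a b) (\<lambda>y. ((- 1) * grad \<eta> (y - x) $ i) * f y))" .
    moreover have "integral (cbox a b) (\<lambda>y. ((- 1) * grad \<eta> (y - x) $ i) * f y) = integral (cbox a b) (G x) $ i" for x
    proof -
      have "(\<lambda>y. G x y $ i) = (\<lambda>y. ((- 1) * grad \<eta> (y - x) $ i) * f y)"
        by (simp add: G_def fun_eq_iff)
      then show ?thesis
        using integral_linear[OF G_int[of x] bounded_linear_vec_nth[of i]] by (simp add: o_def)
    qed
    ultimately show "Ck k (\<lambda>x. integral (cbox a b) (G x) $ i)" by simp
  qed
qed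

lemma mollifier_exists:
  assumes \<delta>: "(\<delta>::real) > 0"
  obtains \<eta> :: "real^'n \<Rightarrow> real" where "\<And>k. Ck k \<eta>" "\<And>x. 0 \<le> \<eta> x" "\<And>x. \<delta> \<le> norm x \<Longrightarrow> \<eta> x = 0"
    "integrable lborel \<eta>" "(\<integral>x. \<eta> x \<partial>lborel) = 1"
proof -
  obtain a b :: "real^'n" where ab: "cbox a b \<subseteq> ball 0 \<delta>" "0 \<in> box a b"
    using open_contains_cbox[of "ball 0 \<delta>" "0 :: real^'n"] \<delta> by (metis centre_in_ball open_ball)
  have test: "bump 1 a b \<in> test_functions (ball 0 \<delta>)" by (rule bump_test_function[OF _ ab(1)]) simp
  have int: "integrable lborel (bump 1 a b)" by (rule integrable_test_function[OF test])
  define c where "c = (\<integral>x. bump 1 a b x \<partial>lborel)"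
  have "c \<noteq> 0"
  proof
    assume "c = 0"
    then have "AE x in lborel. bump 1 a b x = 0"
      using integral_nonneg_eq_0_iff_AE[OF int] bump_bounds(1)[of 1 a b] by (simp add: c_def)
    then have "AE x in lborel. x \<notin> box a b"
      by (rule AE_mp) (use bump_nonzero_iff[of 1 a b] in auto)
    then have "box a b \<in> null_sets lborel" by (subst (asm) AE_iff_null_sets[symmetric]) auto
    then have "negligible (box a b)" by (simp add: negligible_iff_null_sets null_sets_completionI)
    then show False using open_not_negligible[OF open_box, of a b] ab(2) by auto
  qed
  moreover have "0 \<le> c" unfolding c_def by (simp add: bump_bounds)
  ultimately have c: "c > 0" by simp
  show ?thesis
  proof (rule that[of "\<lambda>x. (1 / c) * bump 1 a b x"])
    show "Ck k (\<lambda>x. (1 / c) * bump 1 a b x)" for k by (intro Ck_cmult Ck_bump)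
    show "0 \<le> (1 / c) * bump 1 a b x" for x using c bump_bounds(1)[of 1 a b x] by simp
    show "(1 / c) * bump 1 a b x = 0" if "\<delta> \<le> norm x" for x
    proof -
      have "x \<notin> ball 0 \<delta>" using that by simp
      then have "x \<notin> box a b" using ab(1) box_subset_cbox[of a b] by blast
      then have "bump 1 a b x = 0" using bump_nonzero_iff[of 1 a b x] by auto
      then show ?thesis by simp
    qed
    show "integrable lborel (\<lambda>x. (1 / c) * bump 1 a b x)" using int by simp
    show "(\<integral>x. (1 / c) * bump 1 a b x \<partial>lborel) = 1" using c by (simp add: c_def[symmetric])
  qed
qed

text \<open>Mollification averages translates of \<open>f\<close> with weights of total mass
  one. It keeps the Lipschitz constant, moves values by at most \<open>M \<delta>\<close>,
  and enlarges the set where \<open>f\<close> does not vanish by at most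
  \<open>\<delta>\<close>.\<close>

lemma Lipschitz_smooth_approximation:
  fixes f :: "real^'n \<Rightarrow> real"
  assumes M: "M-lipschitz_on UNIV f" and supp: "bounded {x. f x \<noteq> 0}" and \<delta>: "\<delta> > 0"
  obtains \<phi> where "\<And>k. Ck k \<phi>" "M-lipschitz_on UNIV \<phi>" "\<And>x. \<bar>\<phi> x - f x\<bar> \<le> M * \<delta>"
    "\<And>x. \<phi> x \<noteq> 0 \<Longrightarrow> \<exists>y. norm y \<le> \<delta> \<and> f (x + y) \<noteq> 0"
proof -
  have f: "continuous_on UNIV f" by (rule lipschitz_on_continuous_on[OF M])
  have M0: "0 \<le> M" by (rule lipschitz_on_nonneg[OF M])
  have lip: "\<bar>f x - f y\<bar> \<le> M * norm (x - y)" for x y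
    using lipschitz_onD[OF M, of x y] by (simp add: dist_norm)
  obtain \<eta> :: "real^'n \<Rightarrow> real" where \<eta>: "\<And>k. Ck k \<eta>" "\<And>x. 0 \<le> \<eta> x" "\<And>x. \<delta> \<le> norm x \<Longrightarrow> \<eta> x = 0"
    "integrable lborel \<eta>" "(\<integral>x. \<eta> x \<partial>lborel) = 1"
    by (rule mollifier_exists[OF \<delta>]) (rule that; assumption)
  obtain a b where ab: "{x. f x \<noteq> 0} \<subseteq> cbox a b" using bounded_subset_cbox_symmetric[OF supp] by metis
  have \<eta>_cont: "continuous_on A \<eta>" for A by (rule Ck_continuous[OF \<eta>(1)])
  have \<eta>_meas [measurable]: "\<eta> \<in> borel_measurable borel" by (rule borel_measurable_continuous_onI[OF \<eta>_cont])
  have f_meas [measurable]: "f \<in> borel_measurable borel" by (rule borel_measurable_continuous_onI[OF f])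
  define \<phi> where "\<phi> x = (\<integral>y. \<eta> y * f (x + y) \<partial>lborel)" for x
  have bnd: "\<bar>\<eta> y * f (x + y)\<bar> \<le> \<eta> y * (\<bar>f x\<bar> + M * \<delta>)" for x y
  proof (cases "norm y \<ge> \<delta>")
    case False
    have "\<bar>f (x + y)\<bar> \<le> \<bar>f x\<bar> + M * norm y" using lip[of "x + y" x] by auto
    also have "\<dots> \<le> \<bar>f x\<bar> + M * \<delta>" using False M0 by (intro add_left_mono mult_left_mono) auto
    finally show ?thesis using \<eta>(2)[of y] by (simp add: abs_mult mult_left_mono)
  qed (simp add: \<eta>(3))
  have int: "integrable lborel (\<lambda>y. \<eta> y * f (x + y))" for x
  proof (rule Bochner_Integration.integrable_bound)
    show "integrable lborel (\<lambda>y. \<eta> y * (\<bar>f x\<bar> + M * \<delta>))" using \<eta>(4) by simp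
    show "AE y in lborel. norm (\<eta> y * f (x + y)) \<le> norm (\<eta> y * (\<bar>f x\<bar> + M * \<delta>))"
      by (intro AE_I2) (metis bnd abs_ge_self order_trans real_norm_def)
  qed measurable
  have \<phi>_eq: "\<phi> x = integral (cbox a b) (\<lambda>y. \<eta> (y - x) * f y)" for x
  proof -
    have meas': "(\<lambda>y. \<eta> (y - x) * f y) \<in> borel_measurable borel" by measurable
    have tr: "(\<lambda>y. \<eta> y * f (x + y)) = (\<lambda>y. (\<lambda>z. \<eta> (z - x) * f z) (y + x))" by (simp add: add.commute)
    have eq: "\<phi> x = (\<integral>y. \<eta> (y - x) * f y \<partial>lborel)"
      unfolding \<phi>_def tr by (rule integral_lborel_translate[OF meas'])
    have "integrable (distr lborel borel ((+) x)) (\<lambda>z. \<eta> (z - x) * f z)"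
      using int[of x] meas' by (subst integrable_distr_eq) auto
    then have "integrable lborel (\<lambda>z. \<eta> (z - x) * f z)" by (simp add: lborel_distr_plus)
    then have int_eq: "integral UNIV (\<lambda>z. \<eta> (z - x) * f z) = \<phi> x" unfolding eq by (rule integral_lborel)
    have outside: "(\<lambda>z. \<eta> (z - x) * f z) = (\<lambda>z. if z \<in> cbox a b then \<eta> (z - x) * f z else 0)"
      using ab by (auto simp: fun_eq_iff)
    have "integral UNIV (\<lambda>z. \<eta> (z - x) * f z) = integral (cbox a b) (\<lambda>z. \<eta> (z - x) * f z)"
      by (subst outside) (rule integral_restrict_UNIV)
    then show ?thesis using int_eq by simp
  qed
  show ?thesis
  proof (rule that)
    show "Ck k \<phi>" for k using Ck_convolution[OF f \<eta>(1), of k a b] by (simp add: \<phi>_eq[abs_def])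
    have est: "\<bar>(\<integral>y. \<eta> y * g y \<partial>lborel)\<bar> \<le> C"
      if "integrable lborel (\<lambda>y. \<eta> y * g y)" "\<And>y. norm y < \<delta> \<Longrightarrow> \<bar>g y\<bar> \<le> C" for g C
    proof -
      have "\<bar>(\<integral>y. \<eta> y * g y \<partial>lborel)\<bar> \<le> (\<integral>y. \<bar>\<eta> y * g y\<bar> \<partial>lborel)" by (rule integral_abs_bound)
      also have "\<dots> \<le> (\<integral>y. \<eta> y * C \<partial>lborel)"
      proof (rule integral_mono)
        show "integrable lborel (\<lambda>y. \<bar>\<eta> y * g y\<bar>)" using that(1) by (rule integrable_abs)
        show "integrable lborel (\<lambda>y. \<eta> y * C)" using \<eta>(4) by simp
        show "\<bar>\<eta> y * g y\<bar> \<le> \<eta> y * C" for y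
          using that(2)[of y] \<eta>(2)[of y] \<eta>(3)[of y]
          by (cases "norm y < \<delta>") (auto simp: abs_mult intro: mult_left_mono)
      qed
      also have "\<dots> = C" using \<eta>(5) by simp
      finally show ?thesis .
    qed
    show "M-lipschitz_on UNIV \<phi>"
    proof (rule lipschitz_onI[OF _ M0])
      fix x z
      have "\<phi> x - \<phi> z = (\<integral>y. \<eta> y * (f (x + y) - f (z + y)) \<partial>lborel)"
        unfolding \<phi>_def using int by (simp add: right_diff_distrib)
      moreover have "\<bar>\<dots>\<bar> \<le> M * norm (x - z)"
      proof (rule est)
        show "integrable lborel (\<lambda>y. \<eta> y * (f (x + y) - f (z + y)))"
          using Bochner_Integration.integrable_diff[OF int[of x] int[of z]] by (simp add: right_diff_distrib)
        show "\<bar>f (x + y) - f (z + y)\<bar> \<le> M * norm (x - z)" for y using lip[of "x + y" "z + y"] by simp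
      qed
      ultimately show "dist (\<phi> x) (\<phi> z) \<le> M * dist x z" by (simp add: dist_norm)
    qed
    show "\<bar>\<phi> x - f x\<bar> \<le> M * \<delta>" for x
    proof -
      have c: "integrable lborel (\<lambda>y. \<eta> y * f x)" "(\<integral>y. \<eta> y * f x \<partial>lborel) = f x" using \<eta>(4,5) by auto
      have "\<phi> x - f x = (\<integral>y. \<eta> y * (f (x + y) - f x) \<partial>lborel)"
        unfolding right_diff_distrib using int[of x] c by (simp add: \<phi>_def)
      moreover have "\<bar>\<dots>\<bar> \<le> M * \<delta>"
      proof (rule est)
        show "integrable lborel (\<lambda>y. \<eta> y * (f (x + y) - f x))"
          using Bochner_Integration.integrable_diff[OF int[of x] c(1)] by (simp add: right_diff_distrib)
        show "\<bar>f (x + y) - f x\<bar> \<le> M * \<delta>" if "norm y < \<delta>" for y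
        proof -
          have "\<bar>f (x + y) - f x\<bar> \<le> M * norm y" using lip[of "x + y" x] by simp
          also have "\<dots> \<le> M * \<delta>" using that M0 by (intro mult_left_mono) auto
          finally show ?thesis .
        qed
      qed
      ultimately show ?thesis by simp
    qed
    show "\<exists>y. norm y \<le> \<delta> \<and> f (x + y) \<noteq> 0" if "\<phi> x \<noteq> 0" for x
    proof (rule ccontr)
      assume *: "\<not> (\<exists>y. norm y \<le> \<delta> \<and> f (x + y) \<noteq> 0)"
      have "(\<lambda>y. \<eta> y * f (x + y)) = (\<lambda>y. 0)"
      proof
        fix y show "\<eta> y * f (x + y) = 0" using * \<eta>(3)[of y] by (cases "norm y \<le> \<delta>") auto
      qed
      then show False using that by (simp add: \<phi>_def)
    qed
  qed
qed

section \<open>The functional\<close>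

definition zero_ext :: "'a set \<Rightarrow> ('a \<Rightarrow> real) \<Rightarrow> 'a \<Rightarrow> real" where
  "zero_ext \<Omega> v x = (if x \<in> \<Omega> then v x else 0)"

lemma grad_cong_open:
  assumes "open S" "x \<in> S" "\<And>y. y \<in> S \<Longrightarrow> f y = g y"
  shows "grad f x = grad g x"
proof -
  have "(f has_derivative D) (at x) \<longleftrightarrow> (g has_derivative D) (at x)" for D
    using has_derivative_transform_within_open[OF _ assms(1,2), of f D UNIV g]
      has_derivative_transform_within_open[OF _ assms(1,2), of g D UNIV f] assms(3) by auto
  then have "frechet_derivative f (at x) = frechet_derivative g (at x)"
    unfolding frechet_derivative_def by simp
  then show ?thesis by (simp add: grad_def)
qed

lemma grad_zero_ext: "open \<Omega> \<Longrightarrow> x \<in> \<Omega> \<Longrightarrow> grad (zero_ext \<Omega> v) x = grad v x"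
  by (rule grad_cong_open[of \<Omega>]) (auto simp: zero_ext_def)

text \<open>Let \<open>z\<close> be the point of the segment outside \<open>\<Omega>\<close>
  closest to \<open>x\<close>. Up to \<open>z\<close> the segment stays inside
  \<open>\<Omega>\<close>, so the local estimate holds up to points \<open>w n\<close> that
  tend to \<open>z\<close>, where \<open>v\<close> vanishes.\<close>

lemma boundary_point_on_segment:
  fixes v :: "'a::euclidean_space \<Rightarrow> real"
  assumes \<Omega>: "open \<Omega>" and cont: "continuous_on (closure \<Omega>) v" and bd: "\<And>x. x \<in> frontier \<Omega> \<Longrightarrow> v x = 0"
    and loc: "\<And>x y. closed_segment x y \<subseteq> \<Omega> \<Longrightarrow> \<bar>v x - v y\<bar> \<le> M * norm (x - y)" and M: "0 \<le> M"
    and x: "x \<in> \<Omega>" and seg: "\<not> closed_segment x y \<subseteq> \<Omega>"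
  obtains z where "z \<in> closed_segment x y" "z \<notin> \<Omega>" "\<bar>v x\<bar> \<le> M * dist x z"
    "\<And>w. w \<in> closed_segment x y \<Longrightarrow> w \<notin> \<Omega> \<Longrightarrow> dist x z \<le> dist x w"
proof -
  let ?S = "closed_segment x y - \<Omega>"
  have "closed ?S" using \<Omega> by (intro closed_Diff closed_segment) auto
  moreover have "?S \<noteq> {}" using seg by auto
  ultimately obtain z where z: "z \<in> ?S" "\<And>w. w \<in> ?S \<Longrightarrow> dist x z \<le> dist x w"
    using distance_attains_inf by metis
  have inside: "w \<in> \<Omega>" if "w \<in> closed_segment x z" "dist x w < dist x z" for w
    using z that subset_closed_segment[of x z x y] by (meson DiffI leD subsetD ends_in_segment(1) DiffD1)
  (* points of the segment inside \<Omega> that tend to z *)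
  define w where "w n = x + (1 - 1 / real (Suc n)) *\<^sub>R (z - x)" for n
  have xz: "x \<noteq> z" using x z(1) by auto
  have w_seg: "closed_segment x (w n) \<subseteq> \<Omega>" for n
  proof
    fix p assume "p \<in> closed_segment x (w n)"
    then obtain s where s: "0 \<le> s" "s \<le> 1" "p = (1 - s) *\<^sub>R x + s *\<^sub>R w n" by (auto simp: in_segment)
    define t where "t = s * (1 - 1 / real (Suc n))"
    have t: "0 \<le> t" "t < 1"
    proof -
      have *: "0 \<le> 1 - 1 / real (Suc n)" "1 - 1 / real (Suc n) < 1" by auto
      show "0 \<le> t" unfolding t_def using s * by (intro mult_nonneg_nonneg)
      have "t \<le> 1 * (1 - 1 / real (Suc n))" unfolding t_def using s * by (intro mult_right_mono) auto
      also have "\<dots> < 1" using *(2) by simp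
      finally show "t < 1" .
    qed
    have p: "p = x + t *\<^sub>R (z - x)"
      unfolding s(3) w_def t_def by (simp add: algebra_simps)
    have "p \<in> closed_segment x z"
      unfolding in_segment using t by (intro exI[of _ t]) (simp add: p algebra_simps)
    moreover have "dist x p < dist x z"
    proof -
      have "dist x p = t * norm (z - x)" using t by (simp add: p dist_norm)
      also have "\<dots> < 1 * norm (z - x)" using t xz by (intro mult_strict_right_mono) auto
      finally show ?thesis by (simp add: dist_norm norm_minus_commute)
    qed
    ultimately show "p \<in> \<Omega>" by (rule inside)
  qed
  then have w_in: "w n \<in> \<Omega>" for n by (meson ends_in_segment(2) subsetD)
  have "(\<lambda>n. x + (1 - 1 / real (Suc n)) *\<^sub>R (z - x)) \<longlonglongrightarrow> x + (1 - 0) *\<^sub>R (z - x)"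
    by (intro tendsto_intros LIMSEQ_Suc lim_1_over_n)
  then have w_lim: "w \<longlonglongrightarrow> z" by (simp add: w_def[abs_def])
  have "z \<in> closure \<Omega>" using w_in w_lim unfolding closure_sequential by blast
  then have "(v \<circ> w) \<longlonglongrightarrow> v z"
    using cont[unfolded continuous_on_sequentially] w_in w_lim closure_subset by (metis subsetD)
  moreover have "v z = 0"
    using bd[of z] \<open>z \<in> closure \<Omega>\<close> z(1) \<Omega> by (simp add: frontier_def interior_open)
  ultimately have "(\<lambda>n. \<bar>v x - v (w n)\<bar>) \<longlonglongrightarrow> \<bar>v x - 0\<bar>"
    by (intro tendsto_rabs tendsto_diff tendsto_const) (simp add: o_def)
  moreover have "\<bar>v x - v (w n)\<bar> \<le> M * dist x z" for n
  proof -
    have "\<bar>v x - v (w n)\<bar> \<le> M * norm (x - w n)" by (rule loc[OF w_seg])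
    also have "norm (x - w n) \<le> 1 * norm (z - x)"
    proof -
      have "norm (x - w n) = (1 - 1 / real (Suc n)) * norm (z - x)"
        by (simp add: w_def)
      also have "\<dots> \<le> 1 * norm (z - x)" by (intro mult_right_mono) auto
      finally show ?thesis .
    qed
    finally show ?thesis using M by (simp add: mult_left_mono dist_norm norm_minus_commute)
  qed
  ultimately have "\<bar>v x - 0\<bar> \<le> M * dist x z" by (intro LIMSEQ_le_const2) auto
  then have "\<bar>v x\<bar> \<le> M * dist x z" by simp
  then show ?thesis using that[of z] z by blast
qed

text \<open>If the segment from \<open>x\<close> to \<open>y\<close> leaves
  \<open>\<Omega>\<close>, then \<open>v x\<close> is bounded by the distance to its first
  boundary point and \<open>v y\<close> by the distance to its last one; the two distances
  add up to at most \<open>dist x y\<close>.\<close>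

lemma zero_ext_Lipschitz:
  fixes v :: "'a::euclidean_space \<Rightarrow> real"
  assumes \<Omega>: "open \<Omega>" and cont: "continuous_on (closure \<Omega>) v" and bd: "\<And>x. x \<in> frontier \<Omega> \<Longrightarrow> v x = 0"
    and loc: "\<And>x y. closed_segment x y \<subseteq> \<Omega> \<Longrightarrow> \<bar>v x - v y\<bar> \<le> M * norm (x - y)" and M: "0 \<le> M"
  shows "M-lipschitz_on UNIV (zero_ext \<Omega> v)"
proof (rule lipschitz_onI[OF _ M])
  have bp: "\<exists>z\<in>closed_segment x y. z \<notin> \<Omega> \<and> \<bar>v x\<bar> \<le> M * dist x z \<and>
      (\<forall>w\<in>closed_segment x y. w \<notin> \<Omega> \<longrightarrow> dist x z \<le> dist x w)"
    if xy: "x \<in> \<Omega>" "\<not> closed_segment x y \<subseteq> \<Omega>" for x y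
    using boundary_point_on_segment[OF \<Omega> cont _ _ M xy] bd loc by (metis (no_types, lifting))
  have one_side: "\<bar>v x\<bar> \<le> M * dist x y" if "x \<in> \<Omega>" "y \<notin> \<Omega>" for x y
  proof -
    have "\<not> closed_segment x y \<subseteq> \<Omega>" using that by auto
    from bp[OF that(1) this] obtain z where "\<bar>v x\<bar> \<le> M * dist x z"
        "\<forall>w\<in>closed_segment x y. w \<notin> \<Omega> \<longrightarrow> dist x z \<le> dist x w"
      by blast
    then have "dist x z \<le> dist x y" using that by auto
    then show ?thesis using \<open>\<bar>v x\<bar> \<le> M * dist x z\<close> M by (meson mult_left_mono order_trans)
  qed
  fix x y
  show "dist (zero_ext \<Omega> v x) (zero_ext \<Omega> v y) \<le> M * dist x y"
  proof (cases "x \<in> \<Omega> \<and> y \<in> \<Omega>")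
    case True
    show ?thesis
    proof (cases "closed_segment x y \<subseteq> \<Omega>")
      case True': True
      then show ?thesis using loc[of x y] True by (simp add: zero_ext_def dist_norm)
    next
      case False
      obtain z where z: "z \<in> closed_segment x y" "z \<notin> \<Omega>" "\<bar>v x\<bar> \<le> M * dist x z"
        "\<forall>w\<in>closed_segment x y. w \<notin> \<Omega> \<longrightarrow> dist x z \<le> dist x w"
        using bp[of x y] True False by blast
      have "\<not> closed_segment y x \<subseteq> \<Omega>" using False by (simp add: closed_segment_commute)
      then obtain z' where z': "z' \<in> closed_segment y x" "z' \<notin> \<Omega>" "\<bar>v y\<bar> \<le> M * dist y z'"
        using bp[of y x] True by blast
      have "dist x z + dist y z' \<le> dist x z' + dist y z'"
        using z(4) z' by (simp add: closed_segment_commute)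
      also have "\<dots> = dist x y"
      proof -
        have "between (x, y) z'" using z'(1) by (simp add: between_mem_segment closed_segment_commute)
        then show ?thesis unfolding between by (simp add: dist_commute)
      qed
      finally have "M * (dist x z + dist y z') \<le> M * dist x y" using M by (rule mult_left_mono)
      then show ?thesis using z(3) z'(3) True by (simp add: zero_ext_def dist_real_def distrib_left abs_le_iff)
    qed
  next
    case False
    then show ?thesis
      using one_side[of x y] one_side[of y x] M by (auto simp: zero_ext_def dist_real_def dist_commute)
  qed
qed

lemma Lip0_zero_ext:
  assumes "open \<Omega>" "v \<in> Lip0 \<Omega>" obtains L where "L-lipschitz_on UNIV (zero_ext \<Omega> v)"
proof -
  obtain L where L: "L-lipschitz_on (closure \<Omega>) v" and bd: "\<And>x. x \<in> frontier \<Omega> \<Longrightarrow> v x = 0"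
    using assms(2) by (auto simp: Lip0_def)
  have "L-lipschitz_on UNIV (zero_ext \<Omega> v)"
  proof (rule zero_ext_Lipschitz[OF assms(1) lipschitz_on_continuous_on[OF L] bd])
    show "\<bar>v x - v y\<bar> \<le> L * norm (x - y)" if "closed_segment x y \<subseteq> \<Omega>" for x y
    proof -
      have "x \<in> closure \<Omega>" "y \<in> closure \<Omega>" using that closure_subset by fastforce+
      then show ?thesis using lipschitz_onD[OF L] by (auto simp: dist_norm)
    qed
  qed (use lipschitz_on_nonneg[OF L] in auto)
  then show ?thesis by (rule that)
qed

subsection \<open>The essential supremum of the gradient\<close>

text \<open>Completeness of the Lebesgue measure.\<close>

lemma lebesgue_measurable_if_AE_eq:
  assumes ae: "AE x in lborel. F x = G x" and G: "G \<in> borel_measurable lborel"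
  shows "F \<in> borel_measurable lebesgue"
proof (rule measurableI)
  fix B :: "'b set" assume B: "B \<in> sets borel"
  obtain N where N: "N \<in> null_sets lborel" "{x \<in> space lborel. \<not> F x = G x} \<subseteq> N"
    using ae by (auto simp: eventually_ae_filter)
  have "F -` B \<inter> space lebesgue = (G -` B - N) \<union> (F -` B \<inter> N)" using N(2) by auto
  then show "F -` B \<inter> space lebesgue \<in> sets lebesgue"
  proof (rule sets_completionI)
    show "G -` B - N \<in> sets lborel" using measurable_sets[OF G B] N(1) by (auto simp: null_sets_def)
  qed (use N(1) in auto)
qed simp

text \<open>By Rademacher's theorem the gradient agrees almost everywhere with limits of
  difference quotients. This matters because the essential supremum of a function that is
  not measurable is \<open>\<infinity>\<close>.\<close>

lemma Lipschitz_grad_measurable: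
  fixes f :: "real^'n \<Rightarrow> real"
  assumes L: "L-lipschitz_on UNIV f"
  shows "(\<lambda>x. ereal (norm (grad f x))) \<in> borel_measurable lebesgue"
proof (rule lebesgue_measurable_if_AE_eq)
  have cont: "continuous_on UNIV f" by (rule lipschitz_on_continuous_on[OF L])
  let ?G = "\<lambda>x. \<chi> i. dirderiv f (axis i 1) x"
  show "AE x in lborel. ereal (norm (grad f x)) = ereal (norm (?G x))"
    using Rademacher[OF L]
  proof (rule AE_mp, intro AE_I2 impI)
    fix x assume "f differentiable (at x)"
    from quot_tendsto_derivative[OF has_derivative_grad[OF this]]
    have "dirderiv f (axis i 1) x = grad f x \<bullet> axis i 1" for i
      unfolding dirderiv_def by (rule limI)
    then have "dirderiv f (axis i 1) x = grad f x $ i" for i by (simp add: inner_axis)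
    then show "ereal (norm (grad f x)) = ereal (norm (?G x))" by simp
  qed
  have "?G \<in> borel_measurable borel"
  proof (subst borel_measurable_euclidean_space, safe)
    fix b :: "real^'n" assume "b \<in> Basis"
    then obtain i where "b = axis i 1" by (auto simp: Basis_vec_def)
    then show "(\<lambda>x. ?G x \<bullet> b) \<in> borel_measurable borel"
      using dirderiv_measurable[OF cont, of "axis i 1"] by (simp add: inner_axis)
  qed
  then show "(\<lambda>x. ereal (norm (?G x))) \<in> borel_measurable lborel" by measurable
qed

lemma AE_lebesgue_on_open:
  assumes "open \<Omega>" shows "(AE x in lebesgue_on \<Omega>. P x) \<longleftrightarrow> (AE x in lborel. x \<in> \<Omega> \<longrightarrow> P x)"
  using assms by (subst AE_restrict_space_iff) (auto simp: AE_completion_iff)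

lemma Lip0_grad_measurable:
  assumes \<Omega>: "open \<Omega>" and v: "v \<in> Lip0 \<Omega>"
  shows "(\<lambda>x. ereal (norm (grad v x))) \<in> borel_measurable (lebesgue_on \<Omega>)"
proof -
  obtain L where L: "L-lipschitz_on UNIV (zero_ext \<Omega> v)" by (rule Lip0_zero_ext[OF \<Omega> v])
  have "(\<lambda>x. ereal (norm (grad (zero_ext \<Omega> v) x))) \<in> borel_measurable (lebesgue_on \<Omega>)"
    by (rule measurable_restrict_space1[OF Lipschitz_grad_measurable[OF L]])
  then show ?thesis
    by (rule measurable_cong[THEN iffD1, rotated]) (simp add: grad_zero_ext[OF \<Omega>])
qed

lemma J_inf_le_iff:
  assumes \<Omega>: "open \<Omega>" and v: "v \<in> Lip0 \<Omega>"
  shows "J_inf \<Omega> v \<le> ereal M \<longleftrightarrow> (AE x in lborel. x \<in> \<Omega> \<longrightarrow> norm (grad v x) \<le> M)"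
proof -
  let ?g = "\<lambda>x. ereal (norm (grad v x))"
  have J: "J_inf \<Omega> v = esssup (lebesgue_on \<Omega>) ?g" using v by (simp add: J_inf_def)
  have "esssup (lebesgue_on \<Omega>) ?g \<le> ereal M \<longleftrightarrow> (AE x in lebesgue_on \<Omega>. ?g x \<le> ereal M)"
  proof
    assume le: "esssup (lebesgue_on \<Omega>) ?g \<le> ereal M"
    show "AE x in lebesgue_on \<Omega>. ?g x \<le> ereal M"
      using esssup_AE[of ?g "lebesgue_on \<Omega>"] by eventually_elim (rule order_trans[OF _ le])
  qed (rule esssup_I[OF Lip0_grad_measurable[OF \<Omega> v]])
  then show ?thesis unfolding J AE_lebesgue_on_open[OF \<Omega>] by simp
qed

text \<open>Differentiate in the direction of the gradient.\<close>

lemma norm_grad_le_Lipschitz_constant: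
  fixes f :: "real^'n \<Rightarrow> real"
  assumes L: "L-lipschitz_on UNIV f" and d: "f differentiable (at x)"
  shows "norm (grad f x) \<le> L"
proof (cases "grad f x = 0")
  case False
  have "(\<lambda>k. \<bar>quot f (grad f x) k x\<bar>) \<longlonglongrightarrow> \<bar>grad f x \<bullet> grad f x\<bar>"
    by (intro tendsto_rabs quot_tendsto_derivative has_derivative_grad[OF d])
  then have "\<bar>grad f x \<bullet> grad f x\<bar> \<le> L * norm (grad f x)"
    by (rule LIMSEQ_le_const2) (use quot_bound[OF L] in auto)
  then have "norm (grad f x) * norm (grad f x) \<le> L * norm (grad f x)"
    by (simp add: dot_square_norm power2_eq_square)
  then show ?thesis using False by simp
qed (use lipschitz_on_nonneg[OF L] in simp)

text \<open>The lower bound needs that a nonempty open set is not a null set: over a null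
  set the essential supremum is \<open>- \<infinity>\<close>.\<close>

lemma J_inf_real:
  assumes \<Omega>: "open \<Omega>" "\<Omega> \<noteq> {}" and v: "v \<in> Lip0 \<Omega>"
  obtains M where "J_inf \<Omega> v = ereal M" "0 \<le> M"
proof -
  obtain L where L: "L-lipschitz_on UNIV (zero_ext \<Omega> v)" by (rule Lip0_zero_ext[OF \<Omega>(1) v])
  have "J_inf \<Omega> v \<le> ereal L"
    unfolding J_inf_le_iff[OF \<Omega>(1) v]
    using Rademacher[OF L]
  proof eventually_elim
    fix x assume d: "zero_ext \<Omega> v differentiable (at x)"
    show "x \<in> \<Omega> \<longrightarrow> norm (grad v x) \<le> L"
      using norm_grad_le_Lipschitz_constant[OF L d] grad_zero_ext[OF \<Omega>(1), of x v] by metis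
  qed
  moreover have "0 \<le> J_inf \<Omega> v"
  proof -
    have "emeasure (lebesgue_on \<Omega>) (space (lebesgue_on \<Omega>)) \<noteq> 0"
    proof
      assume "emeasure (lebesgue_on \<Omega>) (space (lebesgue_on \<Omega>)) = 0"
      then have "emeasure lebesgue \<Omega> = 0" using \<Omega>(1) by (simp add: emeasure_restrict_space)
      then have "negligible \<Omega>" using \<Omega>(1) by (simp add: negligible_iff_null_sets null_sets_def)
      then show False using open_not_negligible \<Omega> by blast
    qed
    then have "0 = esssup (lebesgue_on \<Omega>) (\<lambda>x. 0 :: ereal)" by (simp add: esssup_const)
    also have "\<dots> \<le> esssup (lebesgue_on \<Omega>) (\<lambda>x. ereal (norm (grad v x)))"
      by (rule esssup_mono) auto
    also have "\<dots> = J_inf \<Omega> v" using v by (simp add: J_inf_def)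
    finally show ?thesis .
  qed
  ultimately show ?thesis using that by (cases "J_inf \<Omega> v") auto
qed

lemma J_inf_double:
  assumes \<Omega>: "open \<Omega>" and v: "v \<in> Lip0 \<Omega>" and J: "J_inf \<Omega> v = ereal M"
  shows "(\<lambda>x. 2 * v x) \<in> Lip0 \<Omega>" "J_inf \<Omega> (\<lambda>x. 2 * v x) \<le> ereal (2 * M)"
proof -
  obtain L where "L-lipschitz_on (closure \<Omega>) v" using v by (auto simp: Lip0_def)
  then have "(2 * L)-lipschitz_on (closure \<Omega>) (\<lambda>x. 2 * v x)"
    using lipschitz_on_cmult_real[of L "closure \<Omega>" v 2] by simp
  then show v2: "(\<lambda>x. 2 * v x) \<in> Lip0 \<Omega>" using v by (auto simp: Lip0_def)
  obtain L' where L': "L'-lipschitz_on UNIV (zero_ext \<Omega> v)" by (rule Lip0_zero_ext[OF \<Omega> v])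
  have "AE x in lborel. x \<in> \<Omega> \<longrightarrow> norm (grad v x) \<le> M"
    using J_inf_le_iff[OF \<Omega> v, of M] J by simp
  then show "J_inf \<Omega> (\<lambda>x. 2 * v x) \<le> ereal (2 * M)"
    unfolding J_inf_le_iff[OF \<Omega> v2]
    using Rademacher[OF L']
  proof eventually_elim
    fix x assume *: "x \<in> \<Omega> \<longrightarrow> norm (grad v x) \<le> M" and d: "zero_ext \<Omega> v differentiable (at x)"
    show "x \<in> \<Omega> \<longrightarrow> norm (grad (\<lambda>x. 2 * v x) x) \<le> 2 * M"
    proof
      assume x: "x \<in> \<Omega>"
      have "grad (\<lambda>x. 2 * v x) x = grad (\<lambda>x. 2 * zero_ext \<Omega> v x) x"
        by (rule grad_cong_open[OF \<Omega> x]) (simp add: zero_ext_def)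
      also have "\<dots> = 2 *\<^sub>R grad (zero_ext \<Omega> v) x"
        using has_derivative_mult_right[OF has_derivative_grad[OF d], of 2] by (intro grad_eqI) simp
      finally show "norm (grad (\<lambda>x. 2 * v x) x) \<le> 2 * M" using * x by (simp add: grad_zero_ext[OF \<Omega> x])
    qed
  qed
qed

lemma J_inf_zero:
  fixes \<Omega> :: "(real^'n) set"
  shows "open \<Omega> \<Longrightarrow> (\<lambda>x. 0) \<in> Lip0 \<Omega>" "open \<Omega> \<Longrightarrow> J_inf \<Omega> (\<lambda>x. 0) \<le> 0"
proof -
  assume \<Omega>: "open \<Omega>"
  show z: "(\<lambda>x. 0) \<in> Lip0 \<Omega>" by (auto simp: Lip0_def intro!: exI[of _ 0] lipschitz_onI)
  have "grad (\<lambda>x::real^'n. 0) x = 0" for x :: "real^'n" by (rule grad_eqI) simp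
  then show "J_inf \<Omega> (\<lambda>x. 0) \<le> 0" using J_inf_le_iff[OF \<Omega> z, of 0] by (simp add: zero_ereal_def)
qed

lemma J_inf_test_function:
  assumes \<Omega>: "open \<Omega>" and \<phi>: "\<phi> \<in> test_functions \<Omega>" and B: "\<And>x. norm (grad \<phi> x) \<le> B"
  shows "\<phi> \<in> Lip0 \<Omega>" "J_inf \<Omega> \<phi> \<le> ereal B"
proof -
  have "0 \<le> B" using B[of 0] norm_ge_zero order_trans by blast
  then have "B-lipschitz_on (closure \<Omega>) \<phi>"
    using test_functions_Lipschitz[OF \<phi> B] by (intro lipschitz_onI) (auto simp: dist_norm)
  moreover have "\<phi> x = 0" if "x \<in> frontier \<Omega>" for x
  proof -
    obtain K where "K \<subseteq> \<Omega>" "{x. \<phi> x \<noteq> 0} \<subseteq> K" using test_functions_support[OF \<phi>] by metis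
    moreover have "x \<notin> \<Omega>" using that \<Omega> by (simp add: frontier_def interior_open)
    ultimately show ?thesis by blast
  qed
  ultimately show "\<phi> \<in> Lip0 \<Omega>" by (auto simp: Lip0_def)
  then show "J_inf \<Omega> \<phi> \<le> ereal B" using B by (simp add: J_inf_le_iff[OF \<Omega>])
qed

subsection \<open>The gradient bound is a Lipschitz bound\<close>

text \<open>The average \<open>\<Phi> t\<close> of \<open>f\<close> over a small ball around
  \<open>x + t e\<close>, with \<open>e = y - x\<close>, is differentiable at every
  \<open>t\<close>: the difference quotients are bounded and, by Rademacher's theorem,
  converge almost everywhere in the ball to \<open>grad f \<bullet> e\<close>. As long as
  the ball lies in \<open>\<Omega>\<close> the derivative is at most \<open>M * norm
  e\<close> times the volume of the ball, and the mean value theorem applies. Then the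
  radius \<open>\<rho>\<close> of the ball tends to zero.\<close>

lemma Lipschitz_along_segment:
  fixes f :: "real^'n \<Rightarrow> real"
  assumes \<Omega>: "open \<Omega>" and L: "L-lipschitz_on UNIV f"
    and M: "AE x in lborel. x \<in> \<Omega> \<longrightarrow> norm (grad f x) \<le> M" and M0: "0 \<le> M"
    and seg: "closed_segment x y \<subseteq> \<Omega>"
  shows "\<bar>f y - f x\<bar> \<le> M * norm (y - x)"
proof -
  have cont: "continuous_on UNIV f" by (rule lipschitz_on_continuous_on[OF L])
  have L0: "0 \<le> L" by (rule lipschitz_on_nonneg[OF L])
  have lip: "\<bar>f a - f b\<bar> \<le> L * norm (a - b)" for a b
    using lipschitz_onD[OF L, of a b] by (simp add: dist_norm)
  define e where "e = y - x"
  obtain r where r: "r > 0" "\<And>z w. z \<in> closed_segment x y \<Longrightarrow> dist z w < r \<Longrightarrow> w \<in> \<Omega>"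
  proof -
    have "compact (closed_segment x y)" by simp
    then obtain r where "r > 0" "(\<Union>z\<in>closed_segment x y. ball z r) \<subseteq> \<Omega>"
      using compact_subset_open_imp_ball_epsilon_subset[OF _ \<Omega> seg] by metis
    then show ?thesis using that by (fastforce simp: subset_eq)
  qed
  have main: "\<bar>f y - f x\<bar> \<le> M * norm e + 2 * L * \<rho>" if \<rho>: "0 < \<rho>" "\<rho> < r" for \<rho>
  proof -
    let ?B = "cball (0::real^'n) \<rho>"
    define V where "V = measure lborel ?B"
    have V: "V > 0" unfolding V_def using \<rho> by (simp add: content_cball_pos)
    have B_fin: "emeasure lborel ?B < \<infinity>" by (rule emeasure_lborel_cball_finite)
    have int_const: "integrable lborel (\<lambda>w. indicator ?B w * c)" for c :: real
      using B_fin by (intro integrable_mult_left integrable_real_indicator) auto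
    have int_const_eq: "(\<integral>w. indicator ?B w * c \<partial>lborel) = V * c" for c :: real
      by (simp add: V_def)
    have f_tr: "(\<lambda>w. f (p + w)) \<in> borel_measurable borel" for p
      by (intro borel_measurable_continuous_onI continuous_on_compose2[OF cont]) (auto intro!: continuous_intros)
    have int_f: "integrable lborel (\<lambda>w. indicator ?B w * f (p + w))" for p
    proof (rule Bochner_Integration.integrable_bound[OF int_const[of "\<bar>f p\<bar> + L * \<rho>"]])
      show "(\<lambda>w. indicator ?B w * f (p + w)) \<in> borel_measurable lborel"
        using f_tr[of p] by (intro borel_measurable_times borel_measurable_indicator) auto
      show "AE w in lborel. norm (indicator ?B w * f (p + w)) \<le> norm (indicator ?B w * (\<bar>f p\<bar> + L * \<rho>))"
      proof (intro AE_I2)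
        fix w
        have "\<bar>f (p + w)\<bar> \<le> \<bar>f p\<bar> + L * \<rho>" if "norm w \<le> \<rho>"
          using lip[of "p + w" p] mult_left_mono[OF that L0] by auto
        then show "norm (indicator ?B w * f (p + w)) \<le> norm (indicator ?B w * (\<bar>f p\<bar> + L * \<rho>))"
          by (auto simp: indicator_def)
      qed
    qed
    define \<Phi> where "\<Phi> t = (\<integral>w. indicator ?B w * f (x + t *\<^sub>R e + w) \<partial>lborel)" for t
    have diff_tr: "AE w in lborel. f differentiable (at (p + w))" for p
    proof -
      have "AE z in distr lborel borel ((+) p). f differentiable (at z)"
        unfolding lborel_distr_plus by (rule Rademacher[OF L])
      then show ?thesis by (rule AE_distrD[rotated]) simp
    qed
    have M_tr: "AE w in lborel. p + w \<in> \<Omega> \<longrightarrow> norm (grad f (p + w)) \<le> M" for p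
    proof -
      have "AE z in distr lborel borel ((+) p). z \<in> \<Omega> \<longrightarrow> norm (grad f z) \<le> M"
        unfolding lborel_distr_plus by (rule M)
      then show ?thesis by (rule AE_distrD[rotated]) simp
    qed
    have deriv: "\<exists>d. (\<Phi> has_real_derivative d) (at t) \<and> (0 \<le> t \<and> t \<le> 1 \<longrightarrow> \<bar>d\<bar> \<le> M * norm e * V)" for t
    proof -
      define p where "p = x + t *\<^sub>R e"
      (* a Borel measurable version of w \<mapsto> grad f (p + w) \<bullet> e *)
      define g where "g w = dirderiv f e (p + w)" for w
      have g_meas: "g \<in> borel_measurable borel"
        unfolding g_def using dirderiv_measurable[OF cont, of e] by measurable
      have g_eq: "AE w in lborel. ((\<lambda>h. (f (p + w + h *\<^sub>R e) - f (p + w)) / h) \<longlongrightarrow> g w) (at 0) \<and>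
          g w = grad f (p + w) \<bullet> e"
        using diff_tr[of p]
      proof eventually_elim
        fix w assume d: "f differentiable (at (p + w))"
        have der: "(f has_derivative (\<lambda>h. grad f (p + w) \<bullet> h)) (at (p + w))" by (rule has_derivative_grad[OF d])
        have "g w = grad f (p + w) \<bullet> e"
          unfolding g_def dirderiv_def by (rule limI[OF quot_tendsto_derivative[OF der]])
        moreover have "((\<lambda>h. (f (p + w + h *\<^sub>R e) - f (p + w)) / h) \<longlongrightarrow> grad f (p + w) \<bullet> e) (at 0)"
          by (rule directional_quotient_tendsto[OF der])
        ultimately show "((\<lambda>h. (f (p + w + h *\<^sub>R e) - f (p + w)) / h) \<longlongrightarrow> g w) (at 0) \<and> g w = grad f (p + w) \<bullet> e"
          by simp
      qed
      define d where "d = (\<integral>w. indicator ?B w * g w \<partial>lborel)"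
      have "(\<Phi> has_real_derivative d) (at t)"
        unfolding DERIV_def tendsto_at_iff_sequentially
      proof (intro allI impI)
        fix X :: "nat \<Rightarrow> real" assume X: "\<forall>i. X i \<in> UNIV - {0}" "X \<longlonglongrightarrow> 0"
        have X0: "X i \<noteq> 0" for i using X(1) by simp
        let ?q = "\<lambda>i w. indicator ?B w * ((f (p + w + X i *\<^sub>R e) - f (p + w)) / X i)"
        have eq: "(\<Phi> (t + X i) - \<Phi> t) / X i = (\<integral>w. ?q i w \<partial>lborel)" for i
        proof -
          have i1: "integrable lborel (\<lambda>w. indicator ?B w * f (p + w + X i *\<^sub>R e))"
            using int_f[of "p + X i *\<^sub>R e"] by (simp add: ac_simps)
          have "\<Phi> (t + X i) = (\<integral>w. indicator ?B w * f (p + w + X i *\<^sub>R e) \<partial>lborel)"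
            unfolding \<Phi>_def p_def by (simp add: scaleR_add_left ac_simps)
          moreover have "\<Phi> t = (\<integral>w. indicator ?B w * f (p + w) \<partial>lborel)" by (simp add: \<Phi>_def p_def)
          ultimately have "(\<Phi> (t + X i) - \<Phi> t) / X i =
              (\<integral>w. (indicator ?B w * f (p + w + X i *\<^sub>R e) - indicator ?B w * f (p + w)) / X i \<partial>lborel)"
            using i1 int_f[of p] by simp
          also have "(\<lambda>w. (indicator ?B w * f (p + w + X i *\<^sub>R e) - indicator ?B w * f (p + w)) / X i) = ?q i"
            by (simp add: fun_eq_iff right_diff_distrib diff_divide_distrib)
          finally show ?thesis .
        qed
        have "(\<lambda>i. \<integral>w. ?q i w \<partial>lborel) \<longlonglongrightarrow> d"
          unfolding d_def
        proof (rule integral_dominated_convergence[OF _ _ int_const[of "L * norm e"]])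
          show "(\<lambda>w. indicator ?B w * g w) \<in> borel_measurable lborel"
            using g_meas by (intro borel_measurable_times borel_measurable_indicator) auto
          show "?q i \<in> borel_measurable lborel" for i
            using f_tr[of p] f_tr[of "p + X i *\<^sub>R e"]
            by (intro borel_measurable_times borel_measurable_indicator borel_measurable_divide
                borel_measurable_diff) (auto simp: ac_simps)
          show "AE w in lborel. (\<lambda>i. ?q i w) \<longlonglongrightarrow> indicator ?B w * g w"
            using g_eq
          proof eventually_elim
            fix w assume "((\<lambda>h. (f (p + w + h *\<^sub>R e) - f (p + w)) / h) \<longlongrightarrow> g w) (at 0) \<and> g w = grad f (p + w) \<bullet> e"
            then have "(\<lambda>i. (f (p + w + X i *\<^sub>R e) - f (p + w)) / X i) \<longlonglongrightarrow> g w"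
              unfolding tendsto_at_iff_sequentially using X by (auto simp: o_def)
            then show "(\<lambda>i. ?q i w) \<longlonglongrightarrow> indicator ?B w * g w" by (intro tendsto_mult tendsto_const)
          qed
          show "AE w in lborel. norm (?q i w) \<le> indicator ?B w * (L * norm e)" for i
          proof (intro AE_I2)
            fix w
            have "\<bar>f (p + w + X i *\<^sub>R e) - f (p + w)\<bar> \<le> L * (\<bar>X i\<bar> * norm e)"
              using lip[of "p + w + X i *\<^sub>R e" "p + w"] by simp
            then have "\<bar>(f (p + w + X i *\<^sub>R e) - f (p + w)) / X i\<bar> \<le> L * norm e"
              using X0[of i] by (simp add: abs_divide divide_le_eq mult_ac)
            then show "norm (?q i w) \<le> indicator ?B w * (L * norm e)" by (auto simp: indicator_def)
          qed
        qed
        then show "((\<lambda>h. (\<Phi> (t + h) - \<Phi> t) / h) \<circ> X) \<longlonglongrightarrow> d" by (simp add: o_def eq)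
      qed
      moreover have "\<bar>d\<bar> \<le> M * norm e * V" if t: "0 \<le> t" "t \<le> 1"
      proof -
        have p_seg: "p \<in> closed_segment x y"
          unfolding in_segment p_def e_def using t by (intro exI[of _ t]) (simp add: algebra_simps)
        have g_bound: "AE w in lborel. \<bar>indicator ?B w * g w\<bar> \<le> indicator ?B w * (M * norm e)"
          using g_eq M_tr[of p]
        proof eventually_elim
          fix w assume *: "((\<lambda>h. (f (p + w + h *\<^sub>R e) - f (p + w)) / h) \<longlongrightarrow> g w) (at 0) \<and> g w = grad f (p + w) \<bullet> e"
            and **: "p + w \<in> \<Omega> \<longrightarrow> norm (grad f (p + w)) \<le> M"
          show "\<bar>indicator ?B w * g w\<bar> \<le> indicator ?B w * (M * norm e)"
          proof (cases "norm w \<le> \<rho>")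
            case True
            then have "p + w \<in> \<Omega>" using r(2)[OF p_seg, of "p + w"] \<rho> by (simp add: dist_norm)
            then have "norm (grad f (p + w)) * norm e \<le> M * norm e" using ** by (intro mult_right_mono) auto
            then have "\<bar>g w\<bar> \<le> M * norm e" using Cauchy_Schwarz_ineq2[of "grad f (p + w)" e] * by linarith
            then show ?thesis using True by simp
          qed simp
        qed
        have int_g: "integrable lborel (\<lambda>w. indicator ?B w * g w)"
        proof (rule Bochner_Integration.integrable_bound[OF int_const[of "M * norm e"]])
          show "(\<lambda>w. indicator ?B w * g w) \<in> borel_measurable lborel"
            using g_meas by (intro borel_measurable_times borel_measurable_indicator) auto
          show "AE w in lborel. norm (indicator ?B w * g w) \<le> norm (indicator ?B w * (M * norm e))"
            using g_bound by eventually_elim (metis abs_ge_self order_trans real_norm_def)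
        qed
        have "\<bar>d\<bar> \<le> (\<integral>w. \<bar>indicator ?B w * g w\<bar> \<partial>lborel)" unfolding d_def by (rule integral_abs_bound)
        also have "\<dots> \<le> (\<integral>w. indicator ?B w * (M * norm e) \<partial>lborel)"
          by (rule integral_mono_AE[OF integrable_abs[OF int_g] int_const g_bound])
        also have "\<dots> = V * (M * norm e)" by (rule int_const_eq)
        also have "\<dots> = M * norm e * V" by (rule mult.commute)
        finally show ?thesis .
      qed
      ultimately show ?thesis by blast
    qed
    obtain t where t: "0 < t" "t < 1" and mvt: "\<exists>d. (\<Phi> has_real_derivative d) (at t) \<and> \<Phi> 1 - \<Phi> 0 = (1 - 0) * d"
    proof -
      have "\<exists>l t. 0 < t \<and> t < 1 \<and> (\<Phi> has_real_derivative l) (at t) \<and> \<Phi> 1 - \<Phi> 0 = (1 - 0) * l"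
      proof (rule MVT)
        have diff: "\<Phi> differentiable (at t)" for t
          using deriv[of t] by (auto simp: real_differentiable_def)
        then show "continuous_on {0..1} \<Phi>"
          by (intro continuous_at_imp_continuous_on ballI differentiable_imp_continuous_within)
        show "\<Phi> differentiable (at t)" for t by (rule diff)
      qed simp
      then show ?thesis using that by blast
    qed
    have "\<bar>\<Phi> 1 - \<Phi> 0\<bar> \<le> M * norm e * V"
    proof -
      obtain d' where d': "(\<Phi> has_real_derivative d') (at t)" "\<Phi> 1 - \<Phi> 0 = d'" using mvt by auto
      obtain d where d: "(\<Phi> has_real_derivative d) (at t)" "\<bar>d\<bar> \<le> M * norm e * V" using deriv[of t] t by auto
      have "d' = d" by (rule DERIV_unique[OF d'(1) d(1)])
      then show ?thesis using d d' by simp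
    qed
    moreover have average: "\<bar>\<Phi> t - V * f (x + t *\<^sub>R e)\<bar> \<le> V * (L * \<rho>)" for t
    proof -
      let ?p = "x + t *\<^sub>R e"
      have diff: "\<Phi> t - V * f ?p = (\<integral>w. indicator ?B w * f (?p + w) - indicator ?B w * f ?p \<partial>lborel)"
        unfolding \<Phi>_def int_const_eq[of "f ?p", symmetric]
        by (rule Bochner_Integration.integral_diff[OF int_f int_const, symmetric])
      have "\<bar>\<Phi> t - V * f ?p\<bar> \<le> (\<integral>w. \<bar>indicator ?B w * f (?p + w) - indicator ?B w * f ?p\<bar> \<partial>lborel)"
        unfolding diff by (rule integral_abs_bound)
      also have "\<dots> \<le> (\<integral>w. indicator ?B w * (L * \<rho>) \<partial>lborel)"
      proof (rule integral_mono)
        show "integrable lborel (\<lambda>w. \<bar>indicator ?B w * f (?p + w) - indicator ?B w * f ?p\<bar>)"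
          using int_f[of ?p] int_const[of "f ?p"] by (intro integrable_abs Bochner_Integration.integrable_diff)
        show "\<bar>indicator ?B w * f (?p + w) - indicator ?B w * f ?p\<bar> \<le> indicator ?B w * (L * \<rho>)" for w
        proof (cases "norm w \<le> \<rho>")
          case True
          have "\<bar>f (?p + w) - f ?p\<bar> \<le> L * norm w" using lip[of "?p + w" ?p] by simp
          also have "\<dots> \<le> L * \<rho>" using True L0 by (rule mult_left_mono)
          finally show ?thesis using True by simp
        qed simp
      qed (rule int_const)
      also have "\<dots> = V * (L * \<rho>)" by (rule int_const_eq)
      finally show ?thesis .
    qed
    moreover have "\<bar>\<Phi> 0 - V * f x\<bar> \<le> V * (L * \<rho>)" using average[of 0] by simp
    moreover have "\<bar>\<Phi> 1 - V * f (x + e)\<bar> \<le> V * (L * \<rho>)" using average[of 1] by simp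
    ultimately have "\<bar>V * f (x + e) - V * f x\<bar> \<le> M * norm e * V + V * (L * \<rho>) + V * (L * \<rho>)" by linarith
    also have "\<dots> = V * (M * norm e + 2 * L * \<rho>)" by (simp only: distrib_left) (simp add: mult_ac)
    also have "V * f (x + e) - V * f x = V * (f (x + e) - f x)" by (rule right_diff_distrib[symmetric])
    also have "\<bar>V * (f (x + e) - f x)\<bar> = V * \<bar>f (x + e) - f x\<bar>" using V by (simp only: abs_mult abs_of_pos)
    finally have "\<bar>f (x + e) - f x\<bar> \<le> M * norm e + 2 * L * \<rho>" using V by (simp only: mult_le_cancel_left_pos)
    then show ?thesis by (simp add: e_def)
  qed
  have "\<bar>f y - f x\<bar> - M * norm e \<le> 0"
  proof (rule le_of_le_mult_eps)
    fix \<epsilon> :: real assume \<epsilon>: "\<epsilon> > 0"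
    define \<rho> where "\<rho> = min (r / 2) \<epsilon>"
    have "0 < \<rho>" "\<rho> < r" "\<rho> \<le> \<epsilon>" using r(1) \<epsilon> by (auto simp: \<rho>_def)
    then have "\<bar>f y - f x\<bar> \<le> M * norm e + 2 * L * \<rho>" "2 * L * \<rho> \<le> 2 * L * \<epsilon>"
      using main[of \<rho>] L0 by (auto intro: mult_left_mono)
    moreover have "\<epsilon> * (2 * L) = 2 * L * \<epsilon>" by (rule mult.commute)
    ultimately show "\<bar>f y - f x\<bar> - M * norm e \<le> \<epsilon> * (2 * L)" by linarith
  qed
  then show ?thesis by (simp add: e_def)
qed

lemma J_inf_Lipschitz:
  assumes \<Omega>: "open \<Omega>" and v: "v \<in> Lip0 \<Omega>" and J: "J_inf \<Omega> v = ereal M" and M: "0 \<le> M"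
  shows "M-lipschitz_on UNIV (zero_ext \<Omega> v)"
proof -
  obtain L where L: "L-lipschitz_on UNIV (zero_ext \<Omega> v)" by (rule Lip0_zero_ext[OF \<Omega> v])
  obtain L' where "L'-lipschitz_on (closure \<Omega>) v" using v by (auto simp: Lip0_def)
  then have cont: "continuous_on (closure \<Omega>) v" by (rule lipschitz_on_continuous_on)
  have "AE x in lborel. x \<in> \<Omega> \<longrightarrow> norm (grad v x) \<le> M" using J_inf_le_iff[OF \<Omega> v, of M] J by simp
  then have bound: "AE x in lborel. x \<in> \<Omega> \<longrightarrow> norm (grad (zero_ext \<Omega> v) x) \<le> M"
    by (rule AE_mp) (auto simp: grad_zero_ext[OF \<Omega>])
  show ?thesis
  proof (rule zero_ext_Lipschitz[OF \<Omega> cont _ _ M])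
    show "v x = 0" if "x \<in> frontier \<Omega>" for x using v that by (auto simp: Lip0_def)
    show "\<bar>v x - v y\<bar> \<le> M * norm (x - y)" if "closed_segment x y \<subseteq> \<Omega>" for x y
    proof -
      have "x \<in> \<Omega>" "y \<in> \<Omega>" using that by auto
      then show ?thesis
        using Lipschitz_along_segment[OF \<Omega> L bound M that]
        by (simp add: zero_ext_def abs_minus_commute norm_minus_commute)
    qed
  qed
qed

section \<open>The subdifferential\<close>

lemma continuous_on_bounded_open:
  fixes v :: "real^'n \<Rightarrow> real"
  assumes "bounded \<Omega>" "continuous_on (closure \<Omega>) v"
  shows "v \<in> borel_measurable (restrict_space borel \<Omega>)" "bounded (v ` \<Omega>)"
proof -
  show "v \<in> borel_measurable (restrict_space borel \<Omega>)"
    by (rule borel_measurable_continuous_on_restrict[OF continuous_on_subset[OF assms(2) closure_subset]])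
  have "compact (v ` closure \<Omega>)"
    using assms by (intro compact_continuous_image) (auto simp: compact_closure)
  then have "bounded (v ` closure \<Omega>)" by (rule compact_imp_bounded)
  then show "bounded (v ` \<Omega>)" by (rule bounded_subset) (intro image_mono closure_subset)
qed

lemma test_functions_pairing:
  assumes \<phi>: "\<phi> \<in> test_functions \<Omega>"
  shows "\<phi> \<in> borel_measurable (restrict_space borel \<Omega>)" "bounded (\<phi> ` \<Omega>)"
proof -
  show "\<phi> \<in> borel_measurable (restrict_space borel \<Omega>)"
    by (intro measurable_restrict_space1 borel_measurable_continuous_onI test_functions_continuous[OF \<phi>])
  obtain B R where "\<And>x. \<bar>\<phi> x\<bar> \<le> B" "\<And>x. norm (grad \<phi> x) \<le> B" "0 \<le> B" "0 \<le> R"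
    "\<And>x. norm x > R \<Longrightarrow> \<phi> x = 0" "\<And>x. norm x > R \<Longrightarrow> grad \<phi> x = 0"
    by (rule test_functions_bounded[OF \<phi>]) (rule that; assumption)
  then show "bounded (\<phi> ` \<Omega>)" by (auto simp: bounded_iff)
qed

subsection \<open>Uniqueness of the divergence\<close>

lemma pairing_measure_diff:
  assumes \<mu>: "\<mu> \<in> measures_on \<Omega>" and \<nu>: "\<nu> \<in> measures_on \<Omega>"
    and f: "f \<in> borel_measurable (restrict_space borel \<Omega>)" "bounded (f ` \<Omega>)"
  shows "pairing \<Omega> (\<lambda>A. \<mu> A - \<nu> A) f = pairing \<Omega> \<mu> f - pairing \<Omega> \<nu> f"
proof -
  let ?K = "\<lambda>\<mu>. measure (pos_part \<Omega> \<mu>) \<Omega> + measure (pos_part \<Omega> (\<lambda>A. - \<mu> A)) \<Omega>"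
  let ?\<delta> = "\<lambda>A. \<mu> A - \<nu> A"
  have space: "space (restrict_space borel \<Omega>) = \<Omega>" by (simp add: space_restrict_space)
  have "\<bar>pairing \<Omega> ?\<delta> f - (pairing \<Omega> \<mu> f - pairing \<Omega> \<nu> f)\<bar> \<le> e * (?K ?\<delta> + ?K \<mu> + ?K \<nu>)" if e: "e > 0" for e
  proof -
    obtain A n and q :: "nat \<Rightarrow> real" where A: "\<And>i. A i \<in> borel_subsets \<Omega>" "disjoint_family A" "(\<Union>i<n. A i) = \<Omega>"
      and close: "\<And>i x. i < n \<Longrightarrow> x \<in> A i \<Longrightarrow> norm (f x - q i) \<le> e"
      using bounded_measurable_partition[OF f(1) _ e] f(2) unfolding space by metis
    have approx: "\<bar>pairing \<Omega> \<mu> f - (\<Sum>i<n. q i * \<mu> (A i))\<bar> \<le> e * ?K \<mu>" if "\<mu> \<in> measures_on \<Omega>" for \<mu>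
      by (rule pairing_Riemann_sum[OF that f(1) A]) (use close in auto)
    have "(\<Sum>i<n. q i * ?\<delta> (A i)) = (\<Sum>i<n. q i * \<mu> (A i)) - (\<Sum>i<n. q i * \<nu> (A i))"
      by (simp add: right_diff_distrib sum_subtractf)
    then show ?thesis
      using approx[OF \<mu>] approx[OF \<nu>] approx[OF measures_on_diff[OF \<mu> \<nu>]] unfolding distrib_left by linarith
  qed
  then have "\<bar>pairing \<Omega> ?\<delta> f - (pairing \<Omega> \<mu> f - pairing \<Omega> \<nu> f)\<bar> \<le> 0" by (rule le_of_le_mult_eps)
  then show ?thesis by simp
qed

text \<open>The pairing with the difference vanishes on test functions, so the positive and
  the negative part of the difference have the same integrals of test functions and
  coincide.\<close>

lemma measures_on_eqI_test_functions:
  fixes \<mu> \<nu> :: "(real^'n) set \<Rightarrow> real"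
  assumes \<Omega>: "open \<Omega>" and \<mu>: "\<mu> \<in> measures_on \<Omega>" and \<nu>: "\<nu> \<in> measures_on \<Omega>"
    and eq: "\<And>\<phi>. \<phi> \<in> test_functions \<Omega> \<Longrightarrow> pairing \<Omega> \<mu> \<phi> = pairing \<Omega> \<nu> \<phi>"
  shows "\<mu> = \<nu>"
proof
  let ?\<delta> = "\<lambda>A. \<mu> A - \<nu> A"
  have \<delta>: "?\<delta> \<in> measures_on \<Omega>" by (rule measures_on_diff[OF \<mu> \<nu>])
  have fin: "emeasure (pos_part \<Omega> \<kappa>) X < \<infinity>" if "\<kappa> \<in> measures_on \<Omega>" for \<kappa> X
    using finite_measure.emeasure_finite[OF finite_measure_pos_part[OF that]] by (simp add: less_top)
  have same: "pos_part \<Omega> ?\<delta> = pos_part \<Omega> (\<lambda>A. - ?\<delta> A)"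
  proof (rule measure_eqI_test_functions[OF \<Omega>])
    fix \<phi> assume \<phi>: "\<phi> \<in> test_functions \<Omega>"
    have "pairing \<Omega> ?\<delta> \<phi> = 0"
      using pairing_measure_diff[OF \<mu> \<nu> test_functions_pairing[OF \<phi>]] eq[OF \<phi>] by simp
    then show "integral\<^sup>L (pos_part \<Omega> ?\<delta>) \<phi> = integral\<^sup>L (pos_part \<Omega> (\<lambda>A. - ?\<delta> A)) \<phi>"
      by (simp add: pairing_def)
  qed (use fin[OF \<delta>] fin[OF measures_on_uminus[OF \<delta>]] in auto)
  fix A
  show "\<mu> A = \<nu> A"
  proof (cases "A \<in> borel_subsets \<Omega>")
    case True
    then show ?thesis using Jordan_decomposition[OF \<delta> True] same by simp
  next
    case False
    then show ?thesis using measures_on_outside \<mu> \<nu> by metis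
  qed
qed

lemma divergence_eqI:
  assumes \<Omega>: "open \<Omega>" and "has_divergence \<Omega> \<sigma> \<mu>" shows "divergence \<Omega> \<sigma> = \<mu>"
  unfolding divergence_def
proof (rule the_equality)
  show "has_divergence \<Omega> \<sigma> \<mu>" by fact
  fix \<nu> assume "has_divergence \<Omega> \<sigma> \<nu>"
  then show "\<nu> = \<mu>"
    using assms(2) by (intro measures_on_eqI_test_functions[OF \<Omega>]) (auto simp: has_divergence_def)
qed

subsection \<open>Divergences of unit fields are subgradients\<close>

lemma excess_Lipschitz:
  fixes a b e :: real
  assumes "e \<ge> 0"
  shows "\<bar>(max (a - e) 0 - max (- a - e) 0) - (max (b - e) 0 - max (- b - e) 0)\<bar> \<le> \<bar>a - b\<bar>"
  using assms by (auto simp: max_def abs_if)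

text \<open>Let \<open>f\<close> be the extension of \<open>v\<close> by zero and
  \<open>g\<close> the function \<open>f\<close> with values pushed towards zero by
  \<open>e\<close>. A mollification \<open>\<phi>\<close> of \<open>g\<close> at a scale
  \<open>\<delta>\<close> with \<open>M \<delta> \<le> e / 2\<close> vanishes unless
  \<open>|f| \<ge> e / 2\<close>, hence has compact support in \<open>\<Omega>\<close>; its
  gradient is at most \<open>M\<close>, and it is within \<open>2 e\<close> of
  \<open>f\<close>.\<close>

lemma pairing_divergence_le:
  fixes v :: "real^'n \<Rightarrow> real"
  assumes \<Omega>: "open \<Omega>" "bounded \<Omega>" and \<sigma>: "\<sigma> \<in> measures_on \<Omega>" and tv: "total_variation \<Omega> \<sigma> \<Omega> \<le> 1"
    and \<nu>: "has_divergence \<Omega> \<sigma> \<nu>" and v: "v \<in> Lip0 \<Omega>" and J: "J_inf \<Omega> v = ereal M" and M: "0 \<le> M"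
  shows "pairing \<Omega> (\<lambda>A. - \<nu> A) v \<le> M"
proof -
  define \<mu> where "\<mu> A = - \<nu> A" for A
  have \<mu>: "\<mu> \<in> measures_on \<Omega>"
    unfolding \<mu>_def using \<nu> by (intro measures_on_uminus) (simp add: has_divergence_def)
  let ?K = "measure (pos_part \<Omega> \<mu>) \<Omega> + measure (pos_part \<Omega> (\<lambda>A. - \<mu> A)) \<Omega>"
  define f where "f = zero_ext \<Omega> v"
  have f_lip: "M-lipschitz_on UNIV f" unfolding f_def by (rule J_inf_Lipschitz[OF \<Omega>(1) v J M])
  have f_cont: "continuous_on UNIV f" by (rule lipschitz_on_continuous_on[OF f_lip])
  have lip: "\<bar>f x - f y\<bar> \<le> M * norm (x - y)" for x y
    using lipschitz_onD[OF f_lip, of x y] by (simp add: dist_norm)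
  have fv: "f x = v x" if "x \<in> \<Omega>" for x using that by (simp add: f_def zero_ext_def)
  have f0: "f x = 0" if "x \<notin> \<Omega>" for x using that by (simp add: f_def zero_ext_def)
  have f_pair: "f \<in> borel_measurable (restrict_space borel \<Omega>)" "bounded (f ` \<Omega>)"
    using continuous_on_bounded_open[OF \<Omega>(2) continuous_on_subset[OF f_cont subset_UNIV]] by auto
  have "pairing \<Omega> \<mu> f - M \<le> e * (2 * ?K)" if e: "e > 0" for e
  proof -
    define g where "g x = max (f x - e) 0 - max (- f x - e) 0" for x
    have g_close: "\<bar>g x - f x\<bar> \<le> e" for x using e by (auto simp: g_def max_def)
    have g_supp: "\<bar>f x\<bar> > e" if "g x \<noteq> 0" for x using that by (auto simp: g_def max_def split: if_splits)
    have g_lip: "M-lipschitz_on UNIV g"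
    proof (rule lipschitz_onI[OF _ M])
      fix x y
      have "\<bar>g x - g y\<bar> \<le> \<bar>f x - f y\<bar>" unfolding g_def using e by (intro excess_Lipschitz) simp
      then show "dist (g x) (g y) \<le> M * dist x y" using lip[of x y] by (simp add: dist_norm)
    qed
    have g_bdd: "bounded {x. g x \<noteq> 0}"
      by (rule bounded_subset[OF \<Omega>(2)]) (use f0 g_supp e in force)
    (* M + 1 instead of M because M may be zero *)
    define \<delta> where "\<delta> = e / (2 * (M + 1))"
    have \<delta>: "\<delta> > 0" "M * \<delta> \<le> e / 2"
      using e M by (auto simp: \<delta>_def field_simps)
    obtain \<phi> where \<phi>: "\<And>k. Ck k \<phi>" "M-lipschitz_on UNIV \<phi>" "\<And>x. \<bar>\<phi> x - g x\<bar> \<le> M * \<delta>"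
      "\<And>x. \<phi> x \<noteq> 0 \<Longrightarrow> \<exists>y. norm y \<le> \<delta> \<and> g (x + y) \<noteq> 0"
      using Lipschitz_smooth_approximation[OF g_lip g_bdd \<delta>(1)] by blast
    have supp: "e / 2 \<le> \<bar>f x\<bar>" if nz: "\<phi> x \<noteq> 0" for x
    proof -
      obtain y where y: "norm y \<le> \<delta>" "g (x + y) \<noteq> 0" using \<phi>(4)[OF nz] by blast
      have "\<bar>f (x + y) - f x\<bar> \<le> M * norm y" using lip[of "x + y" x] by simp
      also have "\<dots> \<le> M * \<delta>" using y(1) M by (rule mult_left_mono)
      finally show ?thesis using g_supp[OF y(2)] \<delta>(2) by linarith
    qed
    have \<phi>_test: "\<phi> \<in> test_functions \<Omega>"
    proof (rule test_functionsI[OF \<phi>(1)])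
      let ?S = "{x. e / 2 \<le> \<bar>f x\<bar>}"
      show "{x. \<phi> x \<noteq> 0} \<subseteq> ?S" using supp by auto
      show sub: "?S \<subseteq> \<Omega>" using f0 e by force
      have "closed ?S" by (intro closed_Collect_le continuous_intros f_cont)
      moreover have "bounded ?S" by (rule bounded_subset[OF \<Omega>(2) sub])
      ultimately show "compact ?S" by (simp add: compact_eq_bounded_closed)
    qed
    have grad_le: "norm (grad \<phi> x) \<le> M" for x
      by (rule norm_grad_le_Lipschitz_constant[OF \<phi>(2)])
        (use test_functions_has_derivative[OF \<phi>_test] in \<open>auto simp: differentiable_def\<close>)
    have "pairing \<Omega> \<mu> \<phi> = vector_pairing \<Omega> \<sigma> (grad \<phi>)"
      using \<nu> \<phi>_test unfolding \<mu>_def pairing_uminus has_divergence_def by force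
    also have "\<dots> \<le> M * 1"
    proof (rule vector_pairing_bound[OF \<sigma>])
      show "total_variation \<Omega> \<sigma> \<Omega> \<le> ennreal 1" using tv by simp
      show "grad \<phi> \<in> borel_measurable (restrict_space borel \<Omega>)"
        by (intro measurable_restrict_space1 borel_measurable_continuous_onI test_functions_grad_continuous[OF \<phi>_test])
    qed (use grad_le M in auto)
    finally have 1: "pairing \<Omega> \<mu> \<phi> \<le> M" by simp
    have "\<bar>pairing \<Omega> \<mu> (\<lambda>x. f x - \<phi> x)\<bar> \<le> (2 * e) * ?K"
    proof (rule pairing_bound[OF \<mu>])
      show "(\<lambda>x. f x - \<phi> x) \<in> borel_measurable (restrict_space borel \<Omega>)"
        using f_pair(1) test_functions_pairing(1)[OF \<phi>_test] by (rule borel_measurable_diff)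
      show "\<bar>f x - \<phi> x\<bar> \<le> 2 * e" for x using g_close[of x] \<phi>(3)[of x] \<delta>(2) e by linarith
    qed
    moreover have "pairing \<Omega> \<mu> (\<lambda>x. f x - \<phi> x) = pairing \<Omega> \<mu> f - pairing \<Omega> \<mu> \<phi>"
      by (rule pairing_diff[OF \<mu> f_pair test_functions_pairing[OF \<phi>_test]])
    ultimately show ?thesis using 1 by (simp add: abs_le_iff mult_ac)
  qed
  then have "pairing \<Omega> \<mu> f - M \<le> 0" by (rule le_of_le_mult_eps)
  moreover have "pairing \<Omega> \<mu> f = pairing \<Omega> \<mu> v" by (rule pairing_cong) (rule fv)
  ultimately show ?thesis by (simp add: \<mu>_def[abs_def])
qed

lemma Lip0_subset_C0: "v \<in> Lip0 \<Omega> \<Longrightarrow> v \<in> C0 \<Omega>"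
  by (auto simp: Lip0_def C0_def intro: lipschitz_on_continuous_on)

lemma divergence_in_subdiff:
  fixes \<Omega> :: "(real^'n) set" and u :: "real^'n \<Rightarrow> real"
  assumes \<Omega>: "open \<Omega>" "\<Omega> \<noteq> {}" "bounded \<Omega>" and u: "u \<in> Lip0 \<Omega>"
    and \<sigma>: "\<sigma> \<in> DM \<Omega>" and attained: "ereal (pairing \<Omega> (\<lambda>A. - divergence \<Omega> \<sigma> A) u) = J_inf \<Omega> u"
    and tv: "total_variation \<Omega> \<sigma> \<Omega> \<le> 1"
  shows "(\<lambda>A. - divergence \<Omega> \<sigma> A) \<in> subdiff_J_inf \<Omega> u"
proof -
  obtain \<nu> where \<nu>: "has_divergence \<Omega> \<sigma> \<nu>" using \<sigma> by (auto simp: DM_def)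
  have div: "divergence \<Omega> \<sigma> = \<nu>" by (rule divergence_eqI[OF \<Omega>(1) \<nu>])
  define \<mu> where "\<mu> A = - divergence \<Omega> \<sigma> A" for A
  have \<mu>: "\<mu> \<in> measures_on \<Omega>"
    unfolding \<mu>_def div using \<nu> by (intro measures_on_uminus) (simp add: has_divergence_def)
  have "J_inf \<Omega> u + ereal (pairing \<Omega> \<mu> (\<lambda>x. v x - u x)) \<le> J_inf \<Omega> v" if v: "v \<in> C0 \<Omega>" for v
  proof (cases "v \<in> Lip0 \<Omega>")
    case False then show ?thesis by (simp add: J_inf_def)
  next
    case True
    obtain M where M: "J_inf \<Omega> v = ereal M" "0 \<le> M" by (rule J_inf_real[OF \<Omega>(1,2) True])
    have le: "pairing \<Omega> \<mu> v \<le> M"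
      using pairing_divergence_le[OF \<Omega>(1,3) _ tv \<nu> True M] \<sigma> by (simp add: \<mu>_def[abs_def] div DM_def)
    have "continuous_on (closure \<Omega>) v" "continuous_on (closure \<Omega>) u"
      using v Lip0_subset_C0[OF u] by (auto simp: C0_def)
    then have "pairing \<Omega> \<mu> (\<lambda>x. v x - u x) = pairing \<Omega> \<mu> v - pairing \<Omega> \<mu> u"
      by (intro pairing_diff[OF \<mu>] continuous_on_bounded_open[OF \<Omega>(3)])
    then show ?thesis using le attained[symmetric] M(1) by (simp add: \<mu>_def[abs_def])
  qed
  then show ?thesis using \<mu> by (simp add: subdiff_J_inf_def \<mu>_def[abs_def])
qed

subsection \<open>Subgradients are divergences of unit fields\<close>

text \<open>The subgradient inequality at \<open>v = 0\<close> gives \<open>J u \<le>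
  \<langle>\<mu>, u\<rangle>\<close>, and at \<open>v = 2u\<close> it gives
  \<open>\<langle>\<mu>, u\<rangle> \<le> J u\<close>. Then \<open>J u\<close> cancels,
  being finite.\<close>

lemma subdiff_J_inf_pairing:
  fixes \<Omega> :: "(real^'n) set" and u :: "real^'n \<Rightarrow> real"
  assumes \<Omega>: "open \<Omega>" "\<Omega> \<noteq> {}" "bounded \<Omega>" and u: "u \<in> Lip0 \<Omega>" and \<mu>: "\<mu> \<in> subdiff_J_inf \<Omega> u"
  shows "ereal (pairing \<Omega> \<mu> u) = J_inf \<Omega> u" "\<And>v. v \<in> C0 \<Omega> \<Longrightarrow> ereal (pairing \<Omega> \<mu> v) \<le> J_inf \<Omega> v"
proof -
  obtain m where m: "J_inf \<Omega> u = ereal m" "0 \<le> m" by (rule J_inf_real[OF \<Omega>(1,2) u])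
  have \<mu>': "\<mu> \<in> measures_on \<Omega>"
    and sub: "\<And>v. v \<in> C0 \<Omega> \<Longrightarrow> J_inf \<Omega> u + ereal (pairing \<Omega> \<mu> (\<lambda>x. v x - u x)) \<le> J_inf \<Omega> v"
    using \<mu> by (auto simp: subdiff_J_inf_def)
  have sub': "ereal (m + (pairing \<Omega> \<mu> v - pairing \<Omega> \<mu> u)) \<le> J_inf \<Omega> v" if v: "v \<in> C0 \<Omega>" for v
  proof -
    have "continuous_on (closure \<Omega>) v" "continuous_on (closure \<Omega>) u"
      using v Lip0_subset_C0[OF u] by (auto simp: C0_def)
    then have "pairing \<Omega> \<mu> (\<lambda>x. v x - u x) = pairing \<Omega> \<mu> v - pairing \<Omega> \<mu> u"
      by (intro pairing_diff[OF \<mu>'] continuous_on_bounded_open[OF \<Omega>(3)])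
    then show ?thesis using sub[OF v] m(1) by simp
  qed
  have "pairing \<Omega> \<mu> (\<lambda>x. 0) = 0" by (simp add: pairing_def)
  then have "ereal (m - pairing \<Omega> \<mu> u) \<le> 0"
    using order_trans[OF sub'[OF Lip0_subset_C0[OF J_inf_zero(1)[OF \<Omega>(1)]]] J_inf_zero(2)[OF \<Omega>(1)]] by simp
  then have 1: "m \<le> pairing \<Omega> \<mu> u" by (simp add: zero_ereal_def)
  have "ereal (m + (2 * pairing \<Omega> \<mu> u - pairing \<Omega> \<mu> u)) \<le> ereal (2 * m)"
    using order_trans[OF sub'[OF Lip0_subset_C0[OF J_inf_double(1)[OF \<Omega>(1) u m(1)]]] J_inf_double(2)[OF \<Omega>(1) u m(1)]]
    by (simp only: pairing_cmult)
  then have 2: "pairing \<Omega> \<mu> u \<le> m" by simp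
  have p: "pairing \<Omega> \<mu> u = m" using 1 2 by simp
  then show "ereal (pairing \<Omega> \<mu> u) = J_inf \<Omega> u" by (simp add: m(1))
  show "ereal (pairing \<Omega> \<mu> v) \<le> J_inf \<Omega> v" if "v \<in> C0 \<Omega>" for v using sub'[OF that] by (simp add: p)
qed

lemma test_functions_grad_bcontfun:
  assumes \<phi>: "\<phi> \<in> test_functions \<Omega>" shows "grad \<phi> \<in> bcontfun"
proof -
  obtain B R where "\<And>x. \<bar>\<phi> x\<bar> \<le> B" and B: "\<And>x. norm (grad \<phi> x) \<le> B" and "0 \<le> B" "0 \<le> R"
    "\<And>x. norm x > R \<Longrightarrow> \<phi> x = 0" "\<And>x. norm x > R \<Longrightarrow> grad \<phi> x = 0"
    by (rule test_functions_bounded[OF \<phi>]) (rule that; assumption)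
  then show ?thesis by (intro bcontfun_normI[OF test_functions_grad_continuous[OF \<phi>]])
qed

lemma grad_add:
  assumes "\<phi> \<in> test_functions \<Omega>" "\<psi> \<in> test_functions \<Omega>"
  shows "grad (\<lambda>x. \<phi> x + \<psi> x) x = grad \<phi> x + grad \<psi> x"
  using has_derivative_add[OF test_functions_has_derivative[OF assms(1)] test_functions_has_derivative[OF assms(2)]]
  by (intro grad_eqI) (simp add: inner_add_left)

lemma grad_cmult:
  assumes "\<phi> \<in> test_functions \<Omega>" shows "grad (\<lambda>x. c * \<phi> x) x = c *\<^sub>R grad \<phi> x"
  using has_derivative_mult_right[OF test_functions_has_derivative[OF assms], of c]
  by (intro grad_eqI) simp

lemma Bcontfun_grad_cmult:
  assumes \<phi>: "\<phi> \<in> test_functions \<Omega>"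
  shows "Bcontfun (grad (\<lambda>x. c * \<phi> x)) = c *\<^sub>R Bcontfun (grad \<phi>)"
  by (rule bcontfun_eqI)
    (simp add: Bcontfun_inverse test_functions_grad_bcontfun[OF \<phi>]
      test_functions_grad_bcontfun[OF test_functions_cmult[OF \<phi>]] grad_cmult[OF \<phi>])

text \<open>The pairs \<open>(grad \<phi>, \<langle>\<mu>, \<phi>\<rangle>)\<close> form a
  linear subspace, on which \<open>\<langle>\<mu>, \<phi>\<rangle> \<le> J \<phi> \<le> norm
  (grad \<phi>)\<close> in the sup norm. Hahn-Banach gives a functional of norm at most one
  on the bounded continuous fields, and its restriction to fields with compact support is
  represented by a vector measure.\<close>

lemma subgradient_is_divergence:
  fixes \<Omega> :: "(real^'n) set" and \<mu> :: "(real^'n) set \<Rightarrow> real"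
  assumes \<Omega>: "open \<Omega>" and \<mu>: "\<mu> \<in> measures_on \<Omega>"
    and le: "\<And>\<phi>. \<phi> \<in> test_functions \<Omega> \<Longrightarrow> ereal (pairing \<Omega> \<mu> \<phi>) \<le> J_inf \<Omega> \<phi>"
  obtains \<sigma> where "\<sigma> \<in> measures_on \<Omega>" "total_variation \<Omega> \<sigma> \<Omega> \<le> 1" "has_divergence \<Omega> \<sigma> (\<lambda>A. - \<mu> A)"
proof -
  have sup_bound: "pairing \<Omega> \<mu> \<phi> \<le> norm (Bcontfun (grad \<phi>))" if \<phi>: "\<phi> \<in> test_functions \<Omega>" for \<phi>
  proof -
    have "norm (grad \<phi> x) \<le> norm (Bcontfun (grad \<phi>))" for x
      using norm_bounded[of "Bcontfun (grad \<phi>)" x] Bcontfun_inverse[OF test_functions_grad_bcontfun[OF \<phi>]] by simp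
    from J_inf_test_function(2)[OF \<Omega> \<phi> this] le[OF \<phi>]
    have "ereal (pairing \<Omega> \<mu> \<phi>) \<le> ereal (norm (Bcontfun (grad \<phi>)))" by (rule order_trans[rotated])
    then show ?thesis by simp
  qed
  define R where "R = (\<lambda>\<phi>. (Bcontfun (grad \<phi>), pairing \<Omega> \<mu> \<phi>)) ` test_functions \<Omega>"
  have "sublinear (norm :: ((real^'n) \<Rightarrow>\<^sub>C (real^'n)) \<Rightarrow> real)"
    by (auto simp: sublinear_def norm_triangle_ineq)
  then obtain T :: "((real^'n) \<Rightarrow>\<^sub>C (real^'n)) \<Rightarrow> real" where T: "linear T" "\<And>F. T F \<le> norm F"
    and TR: "\<And>a s. (a, s) \<in> R \<Longrightarrow> T a \<le> s"
  proof (rule linear_below_sublinear_and_cone[where R=R])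
    have "Bcontfun (grad (\<lambda>x::real^'n. 0)) = 0"
    proof (rule bcontfun_eqI)
      fix x :: "real^'n"
      have "grad (\<lambda>x::real^'n. 0) x = 0" for x :: "real^'n" by (rule grad_eqI) simp
      then show "apply_bcontfun (Bcontfun (grad (\<lambda>x::real^'n. 0))) x = apply_bcontfun 0 x"
        by (simp add: Bcontfun_inverse[OF test_functions_grad_bcontfun[OF zero_test_function]])
    qed
    moreover have "pairing \<Omega> \<mu> (\<lambda>x. 0) = 0" by (simp add: pairing_def)
    ultimately show "(0, 0) \<in> R" unfolding R_def using zero_test_function by (force intro!: image_eqI)
  next
    fix a s b t assume "(a, s) \<in> R" "(b, t) \<in> R"
    then obtain \<phi> \<psi> where \<phi>: "\<phi> \<in> test_functions \<Omega>" "a = Bcontfun (grad \<phi>)" "s = pairing \<Omega> \<mu> \<phi>"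
      and \<psi>: "\<psi> \<in> test_functions \<Omega>" "b = Bcontfun (grad \<psi>)" "t = pairing \<Omega> \<mu> \<psi>" by (auto simp: R_def)
    have mem: "(\<lambda>x. \<phi> x + \<psi> x) \<in> test_functions \<Omega>" by (rule test_functions_add[OF \<phi>(1) \<psi>(1)])
    have "a + b = Bcontfun (grad (\<lambda>x. \<phi> x + \<psi> x))"
      by (rule bcontfun_eqI)
        (simp add: \<phi>(2) \<psi>(2) Bcontfun_inverse test_functions_grad_bcontfun[OF \<phi>(1)] test_functions_grad_bcontfun[OF \<psi>(1)]
          test_functions_grad_bcontfun[OF mem] grad_add[OF \<phi>(1) \<psi>(1)])
    moreover have "s + t = pairing \<Omega> \<mu> (\<lambda>x. \<phi> x + \<psi> x)"
      unfolding \<phi>(3) \<psi>(3)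
      by (rule pairing_add[OF \<mu> test_functions_pairing[OF \<phi>(1)] test_functions_pairing[OF \<psi>(1)], symmetric])
    ultimately show "(a + b, s + t) \<in> R" using mem by (simp add: R_def)
  next
    fix a s and c :: real assume "(a, s) \<in> R"
    then obtain \<phi> where \<phi>: "\<phi> \<in> test_functions \<Omega>" "a = Bcontfun (grad \<phi>)" "s = pairing \<Omega> \<mu> \<phi>" by (auto simp: R_def)
    have mem: "(\<lambda>x. c * \<phi> x) \<in> test_functions \<Omega>" by (rule test_functions_cmult[OF \<phi>(1)])
    have "c *\<^sub>R a = Bcontfun (grad (\<lambda>x. c * \<phi> x))"
      unfolding \<phi>(2) by (rule Bcontfun_grad_cmult[OF \<phi>(1), symmetric])
    moreover have "c * s = pairing \<Omega> \<mu> (\<lambda>x. c * \<phi> x)" by (simp add: \<phi>(3) pairing_cmult)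
    ultimately show "(c *\<^sub>R a, c * s) \<in> R" using mem by (simp add: R_def)
  next
    fix a s assume "(a, s) \<in> R"
    then obtain \<phi> where \<phi>: "\<phi> \<in> test_functions \<Omega>" "a = Bcontfun (grad \<phi>)" "s = pairing \<Omega> \<mu> \<phi>" by (auto simp: R_def)
    have mem: "(\<lambda>x. (- 1) * \<phi> x) \<in> test_functions \<Omega>" by (rule test_functions_cmult[OF \<phi>(1)])
    have "- a = Bcontfun (grad (\<lambda>x. (- 1) * \<phi> x))"
      unfolding \<phi>(2) Bcontfun_grad_cmult[OF \<phi>(1)] by simp
    then have "pairing \<Omega> \<mu> (\<lambda>x. (- 1) * \<phi> x) \<le> norm (- a)" using sup_bound[OF mem] by simp
    then show "- norm (- a) \<le> s" unfolding pairing_cmult \<phi>(3) by simp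
  qed (rule that; assumption)
  have T_grad: "T (Bcontfun (grad \<phi>)) = pairing \<Omega> \<mu> \<phi>" if \<phi>: "\<phi> \<in> test_functions \<Omega>" for \<phi>
  proof (rule antisym)
    show "T (Bcontfun (grad \<phi>)) \<le> pairing \<Omega> \<mu> \<phi>" by (rule TR) (use \<phi> in \<open>simp add: R_def\<close>)
    have mem: "(\<lambda>x. (- 1) * \<phi> x) \<in> test_functions \<Omega>" by (rule test_functions_cmult[OF \<phi>])
    have "- Bcontfun (grad \<phi>) = Bcontfun (grad (\<lambda>x. (- 1) * \<phi> x))"
      unfolding Bcontfun_grad_cmult[OF \<phi>] by simp
    moreover have "T (Bcontfun (grad (\<lambda>x. (- 1) * \<phi> x))) \<le> pairing \<Omega> \<mu> (\<lambda>x. (- 1) * \<phi> x)"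
      by (rule TR) (unfold R_def, rule imageI[OF mem])
    ultimately have "T (- Bcontfun (grad \<phi>)) \<le> - pairing \<Omega> \<mu> \<phi>" unfolding pairing_cmult by simp
    then show "pairing \<Omega> \<mu> \<phi> \<le> T (Bcontfun (grad \<phi>))" by (simp add: linear_neg[OF T(1)])
  qed
  have Cc_bcontfun: "F \<in> bcontfun" if "F \<in> Cc" for F :: "real^'n \<Rightarrow> real^'n"
    using Cc_bounded_range[OF that] bcontfun_normI[OF Cc_continuous[OF that]] by metis
  obtain \<sigma> where \<sigma>: "\<sigma> \<in> measures_on \<Omega>" "total_variation \<Omega> \<sigma> \<Omega> \<le> 1"
    and rep: "\<And>F. F \<in> Cc \<Longrightarrow> (\<And>x. x \<notin> \<Omega> \<Longrightarrow> F x = 0) \<Longrightarrow> vector_pairing \<Omega> \<sigma> F = T (Bcontfun F)"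
  proof (rule vector_Riesz[of "\<lambda>F. T (Bcontfun F)" \<Omega>])
    fix F G :: "real^'n \<Rightarrow> real^'n" assume F: "F \<in> Cc" and G: "G \<in> Cc"
    have "Bcontfun (\<lambda>x. F x + G x) = Bcontfun F + Bcontfun G"
      by (rule bcontfun_eqI) (simp add: Bcontfun_inverse Cc_bcontfun F G Cc_add)
    then show "T (Bcontfun (\<lambda>x. F x + G x)) = T (Bcontfun F) + T (Bcontfun G)"
      by (simp add: linear_add[OF T(1)])
  next
    fix F :: "real^'n \<Rightarrow> real^'n" assume F: "F \<in> Cc" "\<And>x. norm (F x) \<le> 1"
    have "norm (Bcontfun F) \<le> 1" by (rule norm_bound) (simp add: Bcontfun_inverse Cc_bcontfun F)
    then show "T (Bcontfun F) \<le> 1" using T(2) order_trans by blast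
  qed (use \<Omega> in auto)
  have "has_divergence \<Omega> \<sigma> (\<lambda>A. - \<mu> A)"
    unfolding has_divergence_def
  proof (intro conjI ballI measures_on_uminus \<mu>)
    fix \<phi> assume \<phi>: "\<phi> \<in> test_functions \<Omega>"
    obtain K where K: "compact K" "K \<subseteq> \<Omega>" "{x. \<phi> x \<noteq> 0} \<subseteq> K" "{x. grad \<phi> x \<noteq> 0} \<subseteq> K"
      by (rule test_functions_grad_support[OF \<phi>])
    have "grad \<phi> \<in> Cc"
      by (rule CcI[OF test_functions_grad_continuous[OF \<phi>] bounded_subset[OF compact_imp_bounded[OF K(1)] K(4)]])
    then have "vector_pairing \<Omega> \<sigma> (grad \<phi>) = T (Bcontfun (grad \<phi>))"
      by (rule rep) (use K in auto)
    then show "- vector_pairing \<Omega> \<sigma> (grad \<phi>) = pairing \<Omega> (\<lambda>A. - \<mu> A) \<phi>"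
      by (simp add: T_grad[OF \<phi>] pairing_uminus)
  qed
  then show ?thesis using that \<sigma> by blast
qed

theorem proposition2p7:
  fixes \<Omega> :: "(real^'n) set" and u :: "real^'n \<Rightarrow> real"
  assumes "open \<Omega>" and "connected \<Omega>" and "\<Omega> \<noteq> {}" and "bounded \<Omega>"
    and "u \<in> Lip0 \<Omega>"
  shows "subdiff_J_inf \<Omega> u =
    {(\<lambda>A. - divergence \<Omega> \<sigma> A) | \<sigma>.
       \<sigma> \<in> DM \<Omega> \<and>
       ereal (pairing \<Omega> (\<lambda>A. - divergence \<Omega> \<sigma> A) u) = J_inf \<Omega> u \<and>
       total_variation \<Omega> \<sigma> \<Omega> \<le> 1}"
proof (intro equalityI subsetI)
  note \<Omega> = assms(1,3,4)
  fix \<mu> assume \<mu>: "\<mu> \<in> subdiff_J_inf \<Omega> u"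
  note p = subdiff_J_inf_pairing[OF \<Omega> assms(5) \<mu>]
  have \<mu>': "\<mu> \<in> measures_on \<Omega>" using \<mu> by (simp add: subdiff_J_inf_def)
  obtain \<sigma> where \<sigma>: "\<sigma> \<in> measures_on \<Omega>" "total_variation \<Omega> \<sigma> \<Omega> \<le> 1" "has_divergence \<Omega> \<sigma> (\<lambda>A. - \<mu> A)"
  proof (rule subgradient_is_divergence[OF \<Omega>(1) \<mu>'])
    fix \<phi> assume \<phi>: "\<phi> \<in> test_functions \<Omega>"
    obtain B R where "\<And>x. \<bar>\<phi> x\<bar> \<le> B" and B: "\<And>x. norm (grad \<phi> x) \<le> B" and "0 \<le> B" "0 \<le> R"
      "\<And>x. norm x > R \<Longrightarrow> \<phi> x = 0" "\<And>x. norm x > R \<Longrightarrow> grad \<phi> x = 0"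
      by (rule test_functions_bounded[OF \<phi>]) (rule that; assumption)
    then have "\<phi> \<in> Lip0 \<Omega>" by (intro J_inf_test_function(1)[OF \<Omega>(1) \<phi>])
    then show "ereal (pairing \<Omega> \<mu> \<phi>) \<le> J_inf \<Omega> \<phi>" by (intro p(2) Lip0_subset_C0)
  qed
  have div: "(\<lambda>A. - divergence \<Omega> \<sigma> A) = \<mu>" using divergence_eqI[OF \<Omega>(1) \<sigma>(3)] by simp
  have "\<sigma> \<in> DM \<Omega>" using \<sigma> by (auto simp: DM_def)
  then show "\<mu> \<in> {(\<lambda>A. - divergence \<Omega> \<sigma> A) | \<sigma>. \<sigma> \<in> DM \<Omega> \<and>
      ereal (pairing \<Omega> (\<lambda>A. - divergence \<Omega> \<sigma> A) u) = J_inf \<Omega> u \<and> total_variation \<Omega> \<sigma> \<Omega> \<le> 1}"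
    using div p(1) \<sigma>(2) by (intro CollectI exI[of _ \<sigma>]) simp
next
  fix \<mu> assume "\<mu> \<in> {(\<lambda>A. - divergence \<Omega> \<sigma> A) | \<sigma>. \<sigma> \<in> DM \<Omega> \<and>
      ereal (pairing \<Omega> (\<lambda>A. - divergence \<Omega> \<sigma> A) u) = J_inf \<Omega> u \<and> total_variation \<Omega> \<sigma> \<Omega> \<le> 1}"
  then show "\<mu> \<in> subdiff_J_inf \<Omega> u"
    using divergence_in_subdiff[OF assms(1,3,4,5)] by blast
qed

end
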